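(* Let $\mathrm{supp}(\nu_{p,\beta, \frac{k}{3^n}, 0 })$ denote the support of $\nu_{p,\beta, \frac{k}{3^n}, 0 }$. Then $\mathrm{supp}(\nu_{p,\beta, \frac{k}{3^n}, 0 })=\sigma\big( \mathcal{H}_{p,\beta, \frac{k}{3^n}, 0 } \big)$. The sequence of density of states $\big\{\nu^{(l)}_{p,\beta, \frac{k}{3^n}, 0 } \big\}_{l \in \mathbb{N}}$ converges weakly to $\nu_{p,\beta, \frac{k}{3^n}, 0 }$. Moreover, the following identity holds \[ \int_{\sigma( \mathcal{H}_{p,\beta, \frac{k}{3^n}, 0 } )} f(x) \nu_{p,\beta, \frac{k}{3^n}, 0 }(dx)=\frac{1 }{3^{n} } \sum_{i=1}^{3^n} \int_{\sigma(\Delta_{p})} f(S_i(x)) \nu_{p}(dx) \] for every continuous bounded function $f$ on $\mathbb{C}$.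
   Context: Fix $p\in(0,1)$, $\beta\in\mathbb{R}$, $n\ge 1$, $k\in\{0,\dots,3^n-1\}$. For $x\in\mathbb{Z}_+\setminus\{0\}$ let $m(x)$ be the largest $m$ with $3^m\mid x$, and set $p(x,x-1)=1-p$, $p(x,x+1)=p$ if $3^{-m(x)}x\equiv1\pmod 3$, and $p(x,x-1)=p$, $p(x,x+1)=1-p$ if $3^{-m(x)}x\equiv2\pmod3$. The self-similar Laplacian $\Delta_p$ on $\mathbb{Z}_+$ is $(\Delta_pf)(0)=f(0)-f(1)$, $(\Delta_pf)(x)=f(x)-p(x,x-1)f(x-1)-p(x,x+1)f(x+1)$ for $x\ge1$; the self-similar almost Mathieu operator $\mathcal{H}_{p,\beta,\alpha,\theta}$ is $(\mathcal{H}f)(0)=\beta\cos(\theta)f(0)-f(1)$, $(\mathcal{H}f)(x)=\beta\cos(2\pi\alpha x+\theta)f(x)-p(x,x-1)f(x-1)-p(x,x+1)f(x+1)$ for $x\ge1$ (both self-adjoint on $\ell^2(\mathbb{Z}_+,d\pi)$ for a reversible measure $\pi$). Their truncations $\mathcal{H}^{(l)}_{p,\beta,\alpha,\theta}$, $\Delta^{(l)}_p$ to $\{0,\dots,3^l\}$ use the same formulas for $x<3^l$ and at $x=3^l$ the reflecting rows $\beta\cos(2\pi\alpha3^l+\theta)f(3^l)-f(3^l-1)$, resp. $f(3^l)-f(3^l-1)$. Here $\theta=0$, $\alpha=k/3^n$. There is a polynomial $R_{p,\beta,\frac{k}{3^n},0}$ of degree $3^n$ (the spectral decimation function of $\mathcal{H}^{(l)}_{p,\beta,\frac{k}{3^n},0}$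 relative to $\Delta^{(l-n)}_p$) with $\sigma(\mathcal{H}_{p,\beta,\frac{k}{3^n},0})=R^{-1}_{p,\beta,\frac{k}{3^n},0}(\sigma(\Delta_p))$; let $S_1,\dots,S_{3^n}$ be the $3^n$ branches of its inverse. $\sigma(\Delta_p)$ is the Julia set of $R_{\Delta_p}(z)=\frac{z(z+p-2)(z-p-1)}{p(1-p)}$ and $\nu_p$ denotes the balanced invariant measure of this Julia set. $\nu^{(l)}_{p,\beta,\frac{k}{3^n},0}=\frac{1}{3^l+1}\sum_{\lambda\in\sigma(\mathcal{H}^{(l)}_{p,\beta,\frac{k}{3^n},0})}\delta_\lambda$ is the density of states of the level-$l$ operator, and $\nu_{p,\beta,\frac{k}{3^n},0}(E):=\frac{1}{3^n}\sum_{i=1}^{3^n}\int_{\sigma(\Delta_p)}\chi_E(S_i(x))\,\nu_p(dx)$. *)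

theory Defs
  imports "HOL-Probability.Probability" "HOL-Computational_Algebra.Polynomial"
begin

definition m3 :: "nat \<Rightarrow> nat" where
  "m3 x = (GREATEST m. 3 ^ m dvd x)"

definition digit3 :: "nat \<Rightarrow> nat" where
  "digit3 x = (x div 3 ^ m3 x) mod 3"

definition p_up :: "real \<Rightarrow> nat \<Rightarrow> real" where
  "p_up p x = (if x = 0 then 1 else if digit3 x = 1 then p else 1 - p)"

definition p_down :: "real \<Rightarrow> nat \<Rightarrow> real" where
  "p_down p x = (if x = 0 then 0 else 1 - p_up p x)"

text \<open>Jacobi-type operator with potential V:
  (Jf)(0) = V 0 f(0) - f(1),
  (Jf)(x) = V x f(x) - p(x,x-1) f(x-1) - p(x,x+1) f(x+1).
  Delta_p is the case V = 1; the almost Mathieu operator is V x = beta cos(2 pi alpha x + theta).\<close>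
definition jac :: "real \<Rightarrow> (nat \<Rightarrow> real) \<Rightarrow> (nat \<Rightarrow> complex) \<Rightarrow> nat \<Rightarrow> complex" where
  "jac p V f x =
     (if x = 0 then complex_of_real (V 0) * f 0 - f 1
      else complex_of_real (V x) * f x - complex_of_real (p_down p x) * f (x - 1)
           - complex_of_real (p_up p x) * f (x + 1))"

text \<open>Truncation to {0..N} with reflecting row at N.\<close>
definition jac_trunc :: "real \<Rightarrow> (nat \<Rightarrow> real) \<Rightarrow> nat \<Rightarrow> (nat \<Rightarrow> complex) \<Rightarrow> nat \<Rightarrow> complex" where
  "jac_trunc p V N f x =
     (if x = N then complex_of_real (V N) * f N - f (N - 1) else jac p V f x)"

definition amo_pot :: "real \<Rightarrow> real \<Rightarrow> real \<Rightarrow> nat \<Rightarrow> real" where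
  "amo_pot \<beta> \<alpha> \<theta> x = \<beta> * cos (2 * pi * \<alpha> * real x + \<theta>)"

definition lap_pot :: "nat \<Rightarrow> real" where
  "lap_pot x = 1"

text \<open>Reversible measure, normalised by pi(0) = 1.\<close>
fun revm :: "real \<Rightarrow> nat \<Rightarrow> real" where
  "revm p 0 = 1"
| "revm p (Suc x) = revm p x * p_up p x / p_down p (Suc x)"

definition l2 :: "real \<Rightarrow> (nat \<Rightarrow> complex) set" where
  "l2 p = {f. summable (\<lambda>x. revm p x * (cmod (f x))\<^sup>2)}"

text \<open>Spectrum of a (bounded, everywhere defined) operator T on l^2(Z_+,pi):
  the lambda for which T - lambda is not a bijection of l^2 onto itself.\<close>
definition op_spectrum :: "real \<Rightarrow> ((nat \<Rightarrow> complex) \<Rightarrow> nat \<Rightarrow> complex) \<Rightarrow> complex set" where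
  "op_spectrum p T = {c. \<not> bij_betw (\<lambda>f x. T f x - c * f x) (l2 p) (l2 p)}"

definition trunc_spectrum :: "real \<Rightarrow> (nat \<Rightarrow> real) \<Rightarrow> nat \<Rightarrow> complex set" where
  "trunc_spectrum p V N =
     {c. \<exists>f. (\<exists>x\<le>N. f x \<noteq> 0) \<and> (\<forall>x\<le>N. jac_trunc p V N f x = c * f x)}"

text \<open>R is the spectral decimation function of H^(l) (potential V, on {0..3^l}) relative to
  Delta^(l-n) (on {0..3^(l-n)}, embedded via j \<mapsto> 3^n j): for every l \<ge> n and every z which is
  not a Dirichlet eigenvalue of the block of H^(l) - z on the non-coarse vertices, the Schur
  complement of H^(l) - z onto the coarse vertices equals phi(z) (Delta^(l-n) - R(z)), for a
  scalar function phi vanishing only at finitely many points.  The Schur complement is expressed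
  through harmonic extensions: if f vanishes outside {0..3^l} and (H^(l) - z) f = 0 on the
  non-coarse vertices, then (H^(l) - z) f restricted to the coarse vertices is the Schur
  complement applied to the restriction of f.\<close>
definition coarse :: "nat \<Rightarrow> nat \<Rightarrow> nat set" where
  "coarse n l = {3 ^ n * j | j. j \<le> 3 ^ (l - n)}"

definition non_coarse :: "nat \<Rightarrow> nat \<Rightarrow> nat set" where
  "non_coarse n l = {0..3 ^ l} - coarse n l"

definition dirichlet_regular :: "real \<Rightarrow> (nat \<Rightarrow> real) \<Rightarrow> nat \<Rightarrow> nat \<Rightarrow> complex \<Rightarrow> bool" where
  "dirichlet_regular p V n l z \<longleftrightarrow>
     (\<forall>f. (\<forall>x. x \<notin> non_coarse n l \<longrightarrow> f x = 0)
          \<and> (\<forall>x\<in>non_coarse n l. jac_trunc p V (3 ^ l) f x - z * f x = 0)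
          \<longrightarrow> (\<forall>x. f x = 0))"

definition spectral_decimation_function ::
  "real \<Rightarrow> (nat \<Rightarrow> real) \<Rightarrow> nat \<Rightarrow> complex poly \<Rightarrow> bool" where
  "spectral_decimation_function p V n R \<longleftrightarrow>
     (\<exists>\<phi> :: complex \<Rightarrow> complex. finite {z. \<phi> z = 0} \<and>
       (\<forall>l\<ge>n. \<forall>z. dirichlet_regular p V n l z \<longrightarrow>
          (\<forall>f. (\<forall>x>3 ^ l. f x = 0)
               \<and> (\<forall>x\<in>non_coarse n l. jac_trunc p V (3 ^ l) f x - z * f x = 0)
               \<longrightarrow> (\<forall>j\<le>3 ^ (l - n).
                      jac_trunc p V (3 ^ l) f (3 ^ n * j) - z * f (3 ^ n * j)
                      = \<phi> z * (jac_trunc p lap_pot (3 ^ (l - n)) (\<lambda>i. f (3 ^ n * i)) j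
                                 - poly R z * f (3 ^ n * j))))))"

definition inverse_branches :: "complex poly \<Rightarrow> nat \<Rightarrow> complex set \<Rightarrow> (nat \<Rightarrow> complex \<Rightarrow> complex) \<Rightarrow> bool" where
  "inverse_branches R N A S \<longleftrightarrow>
     (\<forall>i\<in>{1..N}. S i \<in> borel_measurable borel) \<and>
     (\<forall>x\<in>A. \<forall>w. count (image_mset (\<lambda>i. S i x) (mset_set {1..N})) w = order w (R - [:x:]))"

definition R_Delta :: "real \<Rightarrow> complex poly" where
  "R_Delta p = smult (complex_of_real (1 / (p * (1 - p))))
      ([:0, 1:] * [:complex_of_real (p - 2), 1:] * [:complex_of_real (- p - 1), 1:])"

definition filled_julia :: "complex poly \<Rightarrow> complex set" where
  "filled_julia P = {z. bounded (range (\<lambda>m. (poly P ^^ m) z))}"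

definition julia :: "complex poly \<Rightarrow> complex set" where
  "julia P = frontier (filled_julia P)"

text \<open>Balanced invariant (Brolin--Lyubich) measure of a polynomial P of degree d:
  a Borel probability measure on the Julia set, invariant under P, with
  nu(P(A)) = d nu(A) for every Borel set A on which P is injective.\<close>
definition balanced_invariant_measure :: "complex poly \<Rightarrow> complex measure \<Rightarrow> bool" where
  "balanced_invariant_measure P \<nu> \<longleftrightarrow>
     sets \<nu> = sets borel \<and> prob_space \<nu> \<and> emeasure \<nu> (- julia P) = 0 \<and>
     distr \<nu> borel (poly P) = \<nu> \<and>
     (\<forall>A\<in>sets borel. inj_on (poly P) A \<longrightarrow>
        emeasure \<nu> (poly P ` A) = of_nat (degree P) * emeasure \<nu> A)"

definition measure_support :: "complex measure \<Rightarrow> complex set" where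
  "measure_support M = {x. \<forall>U. open U \<and> x \<in> U \<longrightarrow> emeasure M U > 0}"

definition weak_conv_C :: "(nat \<Rightarrow> complex measure) \<Rightarrow> complex measure \<Rightarrow> bool" where
  "weak_conv_C Ms M \<longleftrightarrow>
     (\<forall>f :: complex \<Rightarrow> real. continuous_on UNIV f \<and> bounded (range f) \<longrightarrow>
        (\<lambda>l. integral\<^sup>L (Ms l) f) \<longlonglongrightarrow> integral\<^sup>L M f)"

definition dos_trunc :: "real \<Rightarrow> (nat \<Rightarrow> real) \<Rightarrow> nat \<Rightarrow> complex measure" where
  "dos_trunc p V N = measure_of UNIV (sets borel)
      (\<lambda>E. ennreal (real (card (E \<inter> trunc_spectrum p V N)) / (real N + 1)))"

definition limit_dos :: "nat \<Rightarrow> (nat \<Rightarrow> complex \<Rightarrow> complex) \<Rightarrow> complex measure \<Rightarrow> complex set \<Rightarrow> complex measure" where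
  "limit_dos N S \<nu>p \<Sigma> = measure_of UNIV (sets borel)
      (\<lambda>E. ennreal (1 / real N) *
            (\<Sum>i\<in>{1..N}. \<integral>\<^sup>+ x. indicator E (S i x) * indicator \<Sigma> x \<partial>\<nu>p))"

end

theory Submission
  imports Defs "HOL-Computational_Algebra.Fundamental_Theorem_Algebra"
begin

text \<open>
  Let \<open>P x z\<close> be the solution of \<open>H f = z f\<close> with \<open>f 0 = 1\<close>, a polynomial of degree \<open>x\<close> in \<open>z\<close>. The
  Schur complement identity at non-real \<open>z\<close>, which are never Dirichlet eigenvalues, forces
  \<open>P (3 ^ (n + m)) = 1 - W\<close>, where \<open>W\<close> is the \<open>m\<close>-th iterate of \<open>R_Delta p\<close> applied to \<open>R\<close>. Let \<open>F\<close> be the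
  preimage under \<open>R\<close> of the filled Julia set of \<open>R_Delta p\<close>, i.e. the set where \<open>P (3 ^ j) z\<close> stays bounded.

  Spectrum: eigenfunctions of a truncation extend periodically by reflection, so truncated eigenvalues
  lie in \<open>F\<close>; conversely they are dense in \<open>F\<close>, because \<open>R_Delta p\<close> expands the arccos metric of \<open>[0, 2]\<close>
  by a factor 3 and two zeros of \<open>P (3 ^ l)\<close> enclose an eigenvalue. Off \<open>F\<close> the truncated resolvents are
  bounded uniformly and converge along a subsequence; on \<open>F\<close> the cut off periodic eigenfunctions are
  approximate eigenvectors.

  Density of states: averaging a polynomial \<open>f\<close> over the roots of \<open>A - x\<close> gives a polynomial in \<open>x\<close> of degree
  at most \<open>degree f / degree A\<close>. Hence averages over the zeros of \<open>P (3 ^ l)\<close> are eventually equal to a constant,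
  which is also the integral against the limiting measure, since a balanced measure is invariant
  under averaging over the roots of \<open>R_Delta p - x\<close>. The zeros of \<open>P (3 ^ l)\<close> interlace with the eigenvalues.
\<close>

section \<open>Polynomials of a Jacobi recurrence\<close>

text \<open>\<open>R\<close> and its scalar \<phi> are known only through the Schur identity, so
  there is no formula for \<open>R\<close> to work with; everything passes through
  \<open>P (3 ^ l)\<close>. The \<open>1 -\<close> stems from the Laplacian, whose own solution has
  the value 1 - z at the vertex 1. The obstacle is that truncated eigenvalues are not zeros of
  \<open>P (3 ^ l)\<close>: the reflecting row mixes \<open>P N\<close> and
  \<open>P (N - 1)\<close>, and only \<open>P N\<close> is a composition with iterates. Interlacing
  transports density and averages from the zeros to the eigenvalues. No uniqueness of the balanced
  measure is invoked: balance on the three real intervals mapped onto [0, 2] already yields the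
  averaging identity. For p = 1/2 the map is the Chebyshev polynomial of degree 3 on [0, 2]; the
  factor 3 is its slope in the angle variable, and every other p expands at least as much.\<close>

lemma poly_eq_prod_distinct_roots:
  fixes q :: "'a::idom poly"
  assumes "finite B" "card B = degree q" "q \<noteq> 0" "\<And>x. x \<in> B \<Longrightarrow> poly q x = 0"
  shows "q = smult (lead_coeff q) (\<Prod>x\<in>B. [:-x, 1:])"
  using assms
proof (induction B arbitrary: q rule: finite_induct)
  case empty
  then obtain a where "q = [:a:]" by (metis card.empty degree_eq_zeroE)
  then show ?case by simp
next
  case (insert x B)
  have "[:-x, 1:] dvd q" using insert.prems by (simp add: poly_eq_0_iff_dvd)
  then obtain r where r: "q = [:-x, 1:] * r" by (elim dvdE)
  have r0: "r \<noteq> 0" using insert.prems(2) r by auto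
  have deg: "degree q = Suc (degree r)" unfolding r by (subst degree_mult_eq) (use r0 in auto)
  have lc: "lead_coeff q = lead_coeff r" unfolding r lead_coeff_mult by simp
  have "card B = degree r" using insert.hyps insert.prems(1) deg by simp
  moreover have "poly r y = 0" if "y \<in> B" for y
    using insert.prems(3)[of y] that insert.hyps by (auto simp: r)
  ultimately have "r = smult (lead_coeff r) (\<Prod>x\<in>B. [:-x, 1:])"
    using insert.IH r0 by blast
  then have "q = [:-x, 1:] * smult (lead_coeff r) (\<Prod>x\<in>B. [:-x, 1:])" using r by simp
  also have "\<dots> = smult (lead_coeff q) (\<Prod>x\<in>insert x B. [:-x, 1:])"
    using insert.hyps by (simp add: lc del: mult_pCons_left)
  finally show ?case .
qed

text \<open>Exhibiting as many distinct roots as the degree settles the whole root multiset, so no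
  multiplicity has to be computed. It serves for \<open>P N\<close> and for
  \<open>R_Delta p - [:z:]\<close>.\<close>

lemma proots_eq_mset_set:
  fixes q :: "'a::idom poly"
  assumes "finite B" "card B = degree q" "q \<noteq> 0" "\<And>x. x \<in> B \<Longrightarrow> poly q x = 0"
  shows "proots q = mset_set B"
proof -
  have "q = smult (lead_coeff q) (\<Prod>x\<in>B. [:-x, 1:])"
    by (rule poly_eq_prod_distinct_roots) (use assms in auto)
  then have "proots q = proots (smult (lead_coeff q) (\<Prod>x\<in>B. [:-x, 1:]))" by simp
  also have "\<dots> = proots (\<Prod>x\<in>B. [:-x, 1:])" using assms(3) by simp
  also have "\<dots> = (\<Sum>x\<in>B. {#x#})" by (subst proots_prod) auto
  also have "\<dots> = mset_set B" using assms(1) by (induction B rule: finite_induct) auto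
  finally show ?thesis .
qed

lemma poly_minfty_pos:
  fixes q :: "real poly"
  assumes "0 < (-1) ^ degree q * lead_coeff q"
  shows "\<exists>n. \<forall>x\<le>n. 0 < poly q x"
proof -
  have "lead_coeff (pcompose q [:0, -1:]) = lead_coeff q * (-1) ^ degree q"
    by (subst lead_coeff_comp) auto
  then have "0 < lead_coeff (pcompose q [:0, -1:])" using assms by (simp add: mult.commute)
  then obtain n where n: "\<And>x. x \<ge> n \<Longrightarrow> lead_coeff (pcompose q [:0,-1:]) \<le> poly (pcompose q [:0,-1:]) x"
    using poly_pinfty_gt_lc by blast
  have "0 < poly q x" if "x \<le> - n" for x
    using n[of "-x"] that \<open>0 < lead_coeff (pcompose q [:0, -1:])\<close> by (simp add: poly_pcompose)
  then show ?thesis by blast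
qed

text \<open>Exactly the N - i factors with index at least i are negative.\<close>

lemma prod_diff_sign:
  fixes b :: "nat \<Rightarrow> real"
  assumes "i \<le> N" "\<And>j. j < i \<Longrightarrow> b j < t" "\<And>j. i \<le> j \<Longrightarrow> j < N \<Longrightarrow> t < b j"
  shows "0 < (-1) ^ (N - i) * (\<Prod>j<N. t - b j)"
  using assms
proof (induction N rule: dec_induct)
  case base
  then show ?case by (auto intro!: prod_pos)
next
  case (step N)
  then have "0 < (-1) ^ (N - i) * (\<Prod>j<N. t - b j)" by auto
  moreover have "t - b N < 0" using step by auto
  ultimately have "0 < ((-1) ^ (N - i) * (\<Prod>j<N. t - b j)) * (b N - t)" by (simp only: mult_pos_pos diff_gt_0_iff_gt diff_less_0_iff_less)
  then show ?case using step.hyps by (simp add: Suc_diff_le algebra_simps)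
qed

text \<open>The eigenvalue equation \<open>V x f x - d x f (x - 1) - u x f (x + 1) = z f x\<close> with \<open>f 0 = 1\<close> is
  solved by the polynomials \<open>jpoly u d V x\<close> in \<open>z\<close>; since \<open>d 0 = 0\<close>, the value \<open>f (0 - 1) = f 0\<close>
  produced by truncated subtraction is harmless.\<close>

fun jpoly :: "(nat \<Rightarrow> real) \<Rightarrow> (nat \<Rightarrow> real) \<Rightarrow> (nat \<Rightarrow> real) \<Rightarrow> nat \<Rightarrow> 'a::real_field poly" where
  "jpoly u d V 0 = 1"
| "jpoly u d V (Suc 0) = smult (of_real (1 / u 0)) [:of_real (V 0), -1:]"
| "jpoly u d V (Suc (Suc x)) = smult (of_real (1 / u (Suc x)))
     ([:of_real (V (Suc x)), -1:] * jpoly u d V (Suc x) - smult (of_real (d (Suc x))) (jpoly u d V x))"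

text \<open>The symmetrising weight of the recurrence:
  \<open>w x * u x = w (Suc x) * d (Suc x)\<close>, that is, detailed balance. The reversible
  measure \<open>revm\<close> is the instance at the rates of the walk.\<close>

fun jweight :: "(nat \<Rightarrow> real) \<Rightarrow> (nat \<Rightarrow> real) \<Rightarrow> nat \<Rightarrow> real" where
  "jweight u d 0 = 1"
| "jweight u d (Suc x) = jweight u d x * u x / d (Suc x)"

lemma of_real_poly_jpoly:
  "of_real (poly (jpoly u d V x) t) = poly (jpoly u d V x :: 'a::real_field poly) (of_real t)"
  by (induction u d V x rule: jpoly.induct) (auto simp: algebra_simps)

lemma jpoly_cong:
  assumes "\<And>y. y < x \<Longrightarrow> u y = u' y" "\<And>y. y < x \<Longrightarrow> d y = d' y" "\<And>y. y < x \<Longrightarrow> V y = V' y"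
  shows "jpoly u d V x = jpoly u' d' V' x"
  using assms by (induction u d V x rule: jpoly.induct) (auto simp: numeral_2_eq_2)

text \<open>Kept abstract in the rates because the walk is used twice: on the half-line with
  \<open>p_up\<close>, \<open>p_down\<close>, and truncated at N with both rates at N replaced by
  1.\<close>

locale jacobi =
  fixes u d V :: "nat \<Rightarrow> real"
  assumes u_pos: "0 < u x" and d_0: "d 0 = 0" and d_pos: "0 < x \<Longrightarrow> 0 < d x"
begin

abbreviation "P \<equiv> jpoly u d V"
abbreviation "w \<equiv> jweight u d"

lemma u_neq_0 [simp]: "u x \<noteq> 0"
  using u_pos[of x] by simp

lemma w_pos: "0 < w x"
  by (induction x) (auto simp: u_pos d_pos)

lemma w_Suc: "w (Suc x) * d (Suc x) = w x * u x"
  using d_pos[of "Suc x"] by simp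

lemma P_rec:
  "of_real (u x) * poly (P (Suc x)) z
    = (of_real (V x) - z) * poly (P x) z - of_real (d x) * poly (P (x - 1)) (z::'a::real_field)"
proof (cases x)
  case 0
  have "of_real (1 / u 0) * of_real (u 0) = (1::'a)" by (subst of_real_mult[symmetric]) simp
  then show ?thesis by (simp add: 0 d_0 algebra_simps)
next
  case (Suc y)
  have "of_real (1 / u x) * of_real (u x) = (1::'a)" by (subst of_real_mult[symmetric]) simp
  then show ?thesis by (simp add: Suc algebra_simps)
qed

lemma P_unique:
  fixes f :: "nat \<Rightarrow> 'a::real_field"
  assumes "\<And>x. x < M \<Longrightarrow> of_real (u x) * f (Suc x) = (of_real (V x) - z) * f x - of_real (d x) * f (x - 1)"
    and "x \<le> M"
  shows "f x = f 0 * poly (P x) z"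
  using assms(2)
proof (induction x rule: less_induct)
  case (less x)
  show ?case
  proof (cases x)
    case (Suc y)
    have "of_real (u y) * f x = (of_real (V y) - z) * f y - of_real (d y) * f (y - 1)"
      using assms(1)[of y] less.prems Suc by simp
    also have "\<dots> = f 0 * ((of_real (V y) - z) * poly (P y) z - of_real (d y) * poly (P (y - 1)) z)"
      using less.IH[of y] less.IH[of "y - 1"] less.prems Suc by (simp add: algebra_simps)
    also have "\<dots> = of_real (u y) * (f 0 * poly (P x) z)"
      by (subst P_rec[symmetric]) (simp add: Suc mult.left_commute)
    finally show ?thesis by simp
  qed simp
qed

section \<open>Degrees, leading signs and interlacing zeros\<close>

lemma degree_lead_P:
  "degree (P x :: 'a::real_field poly) \<le> x \<and>
   (\<exists>c>0. coeff (P x :: 'a poly) x = of_real ((-1) ^ x * c))"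
proof (induction x rule: less_induct)
  case (less x)
  consider "x = 0" | "x = Suc 0" | y where "x = Suc (Suc y)"
    by (metis not0_implies_Suc)
  then show ?case
  proof cases
    case 1 then show ?thesis by (auto intro: exI[of _ 1])
  next
    case 2 then show ?thesis by (auto intro!: exI[of _ "1 / u 0"] simp: u_pos)
  next
    case 3
    have d1: "degree (P (Suc y) :: 'a poly) \<le> Suc y" and d2: "degree (P y :: 'a poly) \<le> y"
      using less.IH[of "Suc y"] less.IH[of y] 3 by auto
    obtain c where c: "0 < c" "coeff (P (Suc y) :: 'a poly) (Suc y) = of_real ((-1) ^ Suc y * c)"
      using less.IH[of "Suc y"] 3 by auto
    have c1: "coeff (P (Suc y) :: 'a poly) (Suc (Suc y)) = 0" "coeff (P y :: 'a poly) (Suc (Suc y)) = 0"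
      using d1 d2 by (auto intro!: coeff_eq_0)
    have "degree ([:of_real (V (Suc y)), -1:] * P (Suc y) :: 'a poly) \<le> 1 + Suc y"
      by (rule order.trans[OF degree_mult_le]) (use d1 in auto)
    moreover have "degree (smult (of_real (d (Suc y))) (P y) :: 'a poly) \<le> 1 + Suc y"
      using order.trans[OF degree_smult_le d2] by (meson le_SucI le_add2 order_trans)
    ultimately have "degree (P x :: 'a poly) \<le> x"
      unfolding 3 jpoly.simps
      by - (rule order.trans[OF degree_smult_le], rule degree_diff_le, simp_all only: plus_1_eq_Suc)
    moreover have "coeff (P x :: 'a poly) x = of_real ((-1) ^ x * (c / u (Suc y)))"
      using c c1 by (simp add: 3)
    ultimately show ?thesis using c(1) by (auto intro!: exI[of _ "c / u (Suc y)"] simp: u_pos)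
  qed
qed

lemma degree_P [simp]: "degree (P x :: 'a::real_field poly) = x"
proof -
  obtain c where "c > 0" "coeff (P x :: 'a poly) x = of_real ((-1) ^ x * c)"
    using degree_lead_P by blast
  then have "coeff (P x :: 'a poly) x \<noteq> 0" by auto
  then show ?thesis using degree_lead_P[where 'a='a, of x] le_degree by (metis antisym)
qed

lemma P_neq_0 [simp]: "P x \<noteq> (0 :: 'a::real_field poly)"
proof (cases x)
  case (Suc y) then show ?thesis using degree_P[of x, where 'a='a] by (metis degree_0 nat.distinct(1))
qed simp

lemma lead_P_sign: "0 < (-1) ^ x * lead_coeff (P x :: real poly)"
  using degree_lead_P[of x, where 'a=real] by (auto simp: mult.assoc[symmetric] simp flip: power_add mult_2)

text \<open>\<open>P (Suc N)\<close> changes sign between consecutive zeros of \<open>P N\<close>,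
  and its signs at minus and plus infinity add one zero on each side. The sign alternation of the
  following polynomial is part of the conclusion, since the induction needs it again.\<close>

lemma interlacing_step:
  fixes b :: "nat \<Rightarrow> real"
  assumes mono: "strict_mono_on {..<N} b"
    and zero: "\<And>i. i < N \<Longrightarrow> poly (P N) (b i) = 0"
    and sign: "\<And>i. i < N \<Longrightarrow> (-1) ^ i * poly (P (Suc N)) (b i) < 0"
  shows "\<exists>a. strict_mono_on {..N} a
    \<and> (\<forall>i\<le>N. poly (P (Suc N)) (a i) = 0 \<and> (-1) ^ i * poly (P (Suc (Suc N))) (a i) < 0)
    \<and> (\<forall>i<N. a i < b i \<and> b i < a (Suc i))"
proof -
  let ?G = "P (Suc N) :: real poly"
  \<comment> \<open>From \<open>l\<close> to \<open>r\<close> below,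
    \<open>(-1) ^ i * poly ?G\<close> goes from positive to negative; only the two outermost
    intervals need the leading sign of \<open>?G\<close>.\<close>
  have ex: "\<exists>t. poly ?G t = 0 \<and> (0 < i \<longrightarrow> b (i - 1) < t) \<and> (i < N \<longrightarrow> t < b i)" if i: "i \<le> N" for i
  proof -
    have "\<exists>l. (0 < i \<longrightarrow> b (i - 1) \<le> l) \<and> (i < N \<longrightarrow> l < b i) \<and> 0 < (-1) ^ i * poly ?G l"
    proof (cases i)
      case 0
      obtain n where n: "\<And>x. x \<le> n \<Longrightarrow> 0 < poly ?G x"
        using poly_minfty_pos[of ?G] lead_P_sign[of "Suc N"] by auto
      show ?thesis using n[of "min n (b 0 - 1)"] by (intro exI[of _ "min n (b 0 - 1)"]) (auto simp: 0)
    next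
      case (Suc j)
      have "b j < b i" if "i < N" using mono that Suc by (auto simp: strict_mono_on_def)
      moreover have "0 < (-1) ^ i * poly ?G (b j)" using sign[of j] i Suc by auto
      ultimately show ?thesis by (intro exI[of _ "b j"]) (auto simp: Suc)
    qed
    then obtain l where l: "0 < i \<Longrightarrow> b (i - 1) \<le> l" "i < N \<Longrightarrow> l < b i" "0 < (-1) ^ i * poly ?G l"
      by blast
    have "\<exists>r. l < r \<and> (i < N \<longrightarrow> r \<le> b i) \<and> (-1) ^ i * poly ?G r < 0"
    proof (cases "i < N")
      case True
      then show ?thesis using sign[OF True] l(2) by (intro exI[of _ "b i"]) auto
    next
      case False
      then have iN: "i = N" using i by simp
      let ?H = "smult (- ((-1) ^ i)) ?G"
      have "0 < lead_coeff ?H" using lead_P_sign[of "Suc N"] by (simp add: iN)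
      then obtain n where n: "\<And>x. x \<ge> n \<Longrightarrow> lead_coeff ?H \<le> poly ?H x"
        using poly_pinfty_gt_lc by blast
      have "0 < poly ?H (max n (l + 1))" using n[of "max n (l + 1)"] \<open>0 < lead_coeff ?H\<close> by linarith
      then show ?thesis by (intro exI[of _ "max n (l + 1)"]) (auto simp: iN)
    qed
    then obtain r where r: "l < r" "i < N \<Longrightarrow> r \<le> b i" "(-1) ^ i * poly ?G r < 0" by blast
    have "\<exists>x>l. x < r \<and> poly (smult ((-1) ^ i) ?G) x = 0"
      by (rule poly_IVT_neg) (use l r in auto)
    then show ?thesis using l r by force
  qed
  then obtain a where a: "\<And>i. i \<le> N \<Longrightarrow> poly ?G (a i) = 0 \<and> (0 < i \<longrightarrow> b (i - 1) < a i) \<and> (i < N \<longrightarrow> a i < b i)"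
    by metis
  have inter: "a i < b i \<and> b i < a (Suc i)" if "i < N" for i
    using a[of i] a[of "Suc i"] that by auto
  have b_le: "b i \<le> b j" if "i \<le> j" "j < N" for i j
    using mono that by (metis lessThan_iff order.order_iff_strict order.strict_trans1 strict_mono_onD)
  have lt: "a i < a j" if "i < j" "j \<le> N" for i j
    using a[of i] a[of j] b_le[of i "j - 1"] that by fastforce
  then have smono: "strict_mono_on {..N} a" by (auto simp: strict_mono_on_def)
  have inj: "inj_on b {..<N}" using mono by (rule strict_mono_on_imp_inj_on)
  \<comment> \<open>With all N zeros known, \<open>P N\<close> is a product of linear factors, so
    its sign at \<open>a i\<close> is read off from the number of \<open>b j\<close> to the
    right.\<close>
  have fac: "P N = smult (lead_coeff (P N)) (\<Prod>x\<in>b ` {..<N}. [:-x, 1:])"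
    by (rule poly_eq_prod_distinct_roots) (use zero in \<open>auto simp: card_image inj\<close>)
  have val: "poly (P N) t = lead_coeff (P N) * (\<Prod>j<N. t - b j)" for t
    by (subst fac) (simp add: poly_prod prod.reindex[OF inj])
  have "(-1) ^ i * poly (P (Suc (Suc N))) (a i) < 0" if i: "i \<le> N" for i
  proof -
    have "0 < (-1) ^ (N - i) * (\<Prod>j<N. a i - b j)"
    proof (rule prod_diff_sign[OF i])
      show "b j < a i" if "j < i" for j
        using a[OF i] b_le[of j "i - 1"] that i by (cases i) auto
      show "a i < b j" if "i \<le> j" "j < N" for j
        using a[OF i] b_le[OF that] that by auto
    qed
    then have "0 < ((-1) ^ N * lead_coeff (P N)) * ((-1) ^ (N - i) * (\<Prod>j<N. a i - b j))"
      using lead_P_sign[of N] by (intro mult_pos_pos[of "_ * lead_coeff _"]) (simp_all only: degree_P)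
    also have "\<dots> = ((-1) ^ N * (-1) ^ (N - i)) * poly (P N) (a i)" by (simp only: val mult_ac)
    also have "(-1::real) ^ N * (-1) ^ (N - i) = (-1) ^ i"
    proof -
      obtain k where k: "N = i + k" using i by (metis le_Suc_ex)
      show ?thesis by (simp add: k power_add mult.assoc)
    qed
    finally have *: "0 < (-1) ^ i * poly (P N) (a i)" .
    \<comment> \<open>At a zero of \<open>P (Suc N)\<close> the middle term of the recurrence drops
      out, so \<open>P (Suc (Suc N))\<close> and \<open>P N\<close> have opposite signs
      there.\<close>
    have "u (Suc N) * poly (P (Suc (Suc N))) (a i) = - d (Suc N) * poly (P N) (a i)"
      using P_rec[of "Suc N" "a i"] a[OF i] by simp
    then have "u (Suc N) * ((-1) ^ i * poly (P (Suc (Suc N))) (a i)) = - d (Suc N) * ((-1) ^ i * poly (P N) (a i))"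
      by (metis mult.left_commute)
    also have "\<dots> < 0" using * d_pos[of "Suc N"] by (simp add: mult_neg_pos)
    finally show ?thesis using u_pos[of "Suc N"] less_asym unfolding mult_less_0_iff by blast
  qed
  then show ?thesis using smono a inter by blast
qed

lemma interlacing_zeros:
  "\<exists>b. strict_mono_on {..<N} b \<and> (\<forall>i<N. poly (P N) (b i) = (0::real) \<and> (-1) ^ i * poly (P (Suc N)) (b i) < 0)"
proof (induction N)
  case (Suc N)
  then obtain b :: "nat \<Rightarrow> real" where b: "strict_mono_on {..<N} b" "\<And>i. i < N \<Longrightarrow> poly (P N) (b i) = 0"
      "\<And>i. i < N \<Longrightarrow> (-1) ^ i * poly (P (Suc N)) (b i) < 0" by blast
  show ?case using interlacing_step[of N b] b by (fastforce simp: less_Suc_eq_le lessThan_Suc_atMost)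
qed (simp add: strict_mono_on_def)

lemma interlacing:
  obtains a b where "strict_mono_on {..N} a" "strict_mono_on {..<N} b"
    "\<And>i. i \<le> N \<Longrightarrow> poly (P (Suc N)) (a i) = (0::real)" "\<And>i. i < N \<Longrightarrow> poly (P N) (b i) = (0::real)"
    "\<And>i. i < N \<Longrightarrow> a i < b i" "\<And>i. i < N \<Longrightarrow> b i < a (Suc i)"
proof -
  obtain b :: "nat \<Rightarrow> real" where b: "strict_mono_on {..<N} b" "\<And>i. i < N \<Longrightarrow> poly (P N) (b i) = 0"
      "\<And>i. i < N \<Longrightarrow> (-1) ^ i * poly (P (Suc N)) (b i) < 0"
    using interlacing_zeros[of N] by blast
  obtain a where "strict_mono_on {..N} a"
    "\<forall>i\<le>N. poly (P (Suc N)) (a i) = 0" "\<forall>i<N. a i < b i \<and> b i < a (Suc i)"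
    using interlacing_step[of N b] b by blast
  then show ?thesis using b(1,2) that by blast
qed

lemma proots_P:
  fixes b :: "nat \<Rightarrow> real"
  assumes "strict_mono_on {..<N} b" "\<And>i. i < N \<Longrightarrow> poly (P N) (b i) = 0"
  shows "proots (P N :: complex poly) = mset_set ((\<lambda>i. of_real (b i)) ` {..<N})"
proof (rule proots_eq_mset_set)
  have "inj_on (\<lambda>i. of_real (b i) :: complex) {..<N}"
    using strict_mono_on_imp_inj_on[OF assms(1)] by (auto simp: inj_on_def)
  then show "card ((\<lambda>i. of_real (b i) :: complex) ` {..<N}) = degree (P N :: complex poly)"
    by (simp add: card_image)
  show "poly (P N) x = 0" if "x \<in> (\<lambda>i. of_real (b i) :: complex) ` {..<N}" for x
    using that assms(2) by (auto simp flip: of_real_poly_jpoly)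
qed auto

end

declare jpoly.simps(2,3) [simp del] jweight.simps(2) [simp del]

section \<open>Orthogonality, completeness and resolvents of finite Jacobi matrices\<close>

context jacobi
begin

text \<open>Detailed balance makes the weighted cross terms telescope, leaving one boundary term. At
  two zeros of \<open>P (Suc N)\<close> it vanishes, which is the orthogonality of the truncated
  eigenvectors.\<close>

lemma christoffel_darboux:
  fixes s t :: "'a::real_field"
  shows "(s - t) * (\<Sum>x\<le>N. of_real (w x) * poly (P x) s * poly (P x) t)
    = of_real (w N * u N) * (poly (P N) s * poly (P (Suc N)) t - poly (P (Suc N)) s * poly (P N) t)"
proof (induction N)
  case 0
  show ?case using P_rec[of 0 s] P_rec[of 0 t] by (simp add: d_0 algebra_simps)
next
  case (Suc N)
  let ?A = "\<lambda>M. poly (P M) s" and ?B = "\<lambda>M. poly (P M) t"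
  have "(s - t) * (\<Sum>x\<le>Suc N. of_real (w x) * ?A x * ?B x)
    = of_real (w N * u N) * (?A N * ?B (Suc N) - ?A (Suc N) * ?B N)
      + (s - t) * (of_real (w (Suc N)) * ?A (Suc N) * ?B (Suc N))"
    by (simp only: sum.atMost_Suc distrib_left Suc.IH)
  also have "\<dots> = of_real (w (Suc N)) * (?A (Suc N) * (of_real (u (Suc N)) * ?B (Suc (Suc N)))
      - of_real (u (Suc N)) * ?A (Suc (Suc N)) * ?B (Suc N))"
    unfolding P_rec[of "Suc N" s] P_rec[of "Suc N" t] w_Suc[symmetric] of_real_mult
    by (simp add: algebra_simps)
  finally show ?case by (simp add: algebra_simps)
qed

text \<open>By detailed balance the imaginary parts of the off-diagonal terms cancel up to one
  boundary term. If f vanishes at M, this rules out a non-real eigenvalue.\<close>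

lemma green_Im:
  fixes f :: "nat \<Rightarrow> complex"
  shows "(\<Sum>x\<le>M. w x * Im (cnj (f x) * (of_real (V x) * f x - of_real (d x) * f (x - 1) - of_real (u x) * f (x + 1))))
    = - w M * u M * Im (cnj (f M) * f (Suc M))"
proof (induction M)
  case 0
  show ?case by (simp add: d_0 algebra_simps)
next
  case (Suc M)
  have "w (Suc M) * Im (cnj (f (Suc M)) * (of_real (V (Suc M)) * f (Suc M) - of_real (d (Suc M)) * f M
        - of_real (u (Suc M)) * f (Suc (Suc M))))
      = (w (Suc M) * d (Suc M)) * Im (cnj (f M) * f (Suc M)) - w (Suc M) * u (Suc M) * Im (cnj (f (Suc M)) * f (Suc (Suc M)))"
    by (simp add: algebra_simps)
  then show ?case using Suc.IH by (simp add: w_Suc)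
qed

lemma sum_smult_P_eq_0:
  assumes "(\<Sum>x\<le>N. smult (c x) (P x)) = (0 :: 'a::real_field poly)" "x \<le> N"
  shows "c x = 0"
  using assms
proof (induction N arbitrary: x)
  case (Suc N)
  have "coeff (\<Sum>y\<le>N. smult (c y) (P y :: 'a poly)) (Suc N) = 0"
    by (auto simp: coeff_sum intro!: sum.neutral coeff_eq_0)
  then have "c (Suc N) * lead_coeff (P (Suc N) :: 'a poly) = 0"
    using arg_cong[OF Suc.prems(1), of "\<lambda>q. coeff q (Suc N)"] by (simp del: jpoly.simps)
  then have "c (Suc N) = 0" by (metis P_neq_0 leading_coeff_0_iff mult_eq_0_iff)
  then show ?case using Suc by (cases "x = Suc N") (auto simp del: jpoly.simps)
qed simp

text \<open>The functions x \<mapsto> \<open>poly (P x) (a i)\<close> on {0..N} are the eigenvectors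
  of the truncated matrix; the vanishing of \<open>P (Suc N)\<close> at \<open>a i\<close> is its
  last row.\<close>

context
  fixes N :: nat and a :: "nat \<Rightarrow> real"
  assumes mono: "strict_mono_on {..N} a"
    and zero: "\<And>i. i \<le> N \<Longrightarrow> poly (P (Suc N)) (a i) = 0"
begin

lemma inj_zeros: "inj_on a {..N}"
  using mono by (rule strict_mono_on_imp_inj_on)

definition nrm :: "nat \<Rightarrow> real" where
  "nrm i = (\<Sum>x\<le>N. w x * (poly (P x) (a i))\<^sup>2)"

lemma nrm_pos: "0 < nrm i"
proof -
  have "0 < w 0 * (poly (P 0) (a i))\<^sup>2" by simp
  also have "\<dots> \<le> nrm i" unfolding nrm_def
    by (rule member_le_sum) (auto simp: w_pos less_imp_le)
  finally show ?thesis .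
qed

lemma eigenvectors_orthogonal:
  assumes "i \<le> N" "j \<le> N"
  shows "(\<Sum>x\<le>N. w x * poly (P x) (a i) * poly (P x) (a j)) = (if i = j then nrm i else 0)"
proof (cases "i = j")
  case True then show ?thesis by (simp add: nrm_def power2_eq_square mult.assoc)
next
  case False
  then have "a i \<noteq> a j" using inj_zeros assms by (auto simp: inj_on_def)
  then show ?thesis using christoffel_darboux[of "a i" "a j" N] zero assms False by simp
qed

text \<open>The dual of orthogonality without inverting a matrix: the polynomial whose coefficients
  in the basis \<open>P x\<close> are the weighted defects has degree at most N but vanishes at the
  N + 1 points \<open>a i\<close>, so all defects are zero.\<close>

lemma eigenvectors_complete:
  assumes "x \<le> N" "y \<le> N"
  shows "(\<Sum>i\<le>N. poly (P x) (a i) * poly (P y) (a i) / nrm i) = (if x = y then 1 / w x else 0)"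
proof -
  define r where "r x = (\<Sum>i\<le>N. poly (P x) (a i) * poly (P y) (a i) / nrm i) - (if x = y then 1 / w x else 0)" for x
  let ?q = "\<Sum>x\<le>N. smult (w x * r x) (P x)"
  have "poly ?q (a j) = 0" if j: "j \<le> N" for j
  proof -
    have "poly ?q (a j) = (\<Sum>x\<le>N. w x * r x * poly (P x) (a j))" by (simp add: poly_sum)
    also have "\<dots> = (\<Sum>x\<le>N. w x * (\<Sum>i\<le>N. poly (P x) (a i) * poly (P y) (a i) / nrm i) * poly (P x) (a j))
        - (\<Sum>x\<le>N. if x = y then poly (P x) (a j) else 0)"
      unfolding r_def sum_subtractf[symmetric] using w_pos[of y]
      by (intro sum.cong refl) (auto simp: right_diff_distrib left_diff_distrib)
    also have "(\<Sum>x\<le>N. w x * (\<Sum>i\<le>N. poly (P x) (a i) * poly (P y) (a i) / nrm i) * poly (P x) (a j))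
       = (\<Sum>i\<le>N. poly (P y) (a i) / nrm i * (\<Sum>x\<le>N. w x * poly (P x) (a i) * poly (P x) (a j)))"
      by (simp add: sum_distrib_left sum_distrib_right, subst sum.swap) (simp add: mult_ac)
    also have "\<dots> = (\<Sum>i\<le>N. if i = j then poly (P y) (a j) else 0)"
      by (rule sum.cong) (use eigenvectors_orthogonal j nrm_pos less_irrefl in \<open>auto, metis\<close>)
    finally show ?thesis using j assms by simp
  qed
  then have roots: "a ` {..N} \<subseteq> {x. poly ?q x = 0}" by auto
  have "?q = 0"
  proof (rule ccontr)
    assume nz: "?q \<noteq> 0"
    have "Suc N = card (a ` {..N})" using inj_zeros by (simp add: card_image)
    also have "\<dots> \<le> card {x. poly ?q x = 0}" by (rule card_mono[OF poly_roots_finite[OF nz] roots])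
    also have "\<dots> \<le> degree ?q" by (rule card_poly_roots_bound[OF nz])
    also have "\<dots> \<le> N" by (rule degree_sum_le) (auto intro: order.trans[OF degree_smult_le])
    finally show False by simp
  qed
  then have "w x * r x = 0" using sum_smult_P_eq_0[of "\<lambda>x. w x * r x" N x] assms by blast
  then show ?thesis using w_pos[of x] by (simp add: r_def)
qed

lemma parseval:
  fixes \<gamma> :: "nat \<Rightarrow> complex"
  shows "(\<Sum>x\<le>N. w x * (cmod (\<Sum>i\<le>N. \<gamma> i * of_real (poly (P x) (a i))))\<^sup>2) = (\<Sum>i\<le>N. (cmod (\<gamma> i))\<^sup>2 * nrm i)"
proof -
  have "complex_of_real (\<Sum>x\<le>N. w x * (cmod (\<Sum>i\<le>N. \<gamma> i * of_real (poly (P x) (a i))))\<^sup>2)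
      = (\<Sum>x\<le>N. of_real (w x) * ((\<Sum>i\<le>N. \<gamma> i * of_real (poly (P x) (a i))) * (\<Sum>j\<le>N. cnj (\<gamma> j) * of_real (poly (P x) (a j)))))"
    by (simp add: complex_norm_square del: of_real_power)
  also have "\<dots> = (\<Sum>x\<le>N. \<Sum>i\<le>N. \<Sum>j\<le>N. \<gamma> i * cnj (\<gamma> j) * of_real (w x * poly (P x) (a i) * poly (P x) (a j)))"
    by (intro sum.cong refl, simp only: sum_product, simp only: sum_distrib_left, intro sum.cong refl, simp)
  also have "\<dots> = (\<Sum>i\<le>N. \<Sum>j\<le>N. \<Sum>x\<le>N. \<gamma> i * cnj (\<gamma> j) * of_real (w x * poly (P x) (a i) * poly (P x) (a j)))"
    by (subst sum.swap, rule sum.cong[OF refl], rule sum.swap)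
  also have "\<dots> = (\<Sum>i\<le>N. \<Sum>j\<le>N. \<gamma> i * cnj (\<gamma> j) * of_real (\<Sum>x\<le>N. w x * poly (P x) (a i) * poly (P x) (a j)))"
    by (simp add: sum_distrib_left)
  also have "\<dots> = (\<Sum>i\<le>N. \<Sum>j\<le>N. if i = j then \<gamma> i * cnj (\<gamma> j) * of_real (nrm i) else 0)"
    by (intro sum.cong refl) (auto simp: eigenvectors_orthogonal)
  also have "\<dots> = (\<Sum>i\<le>N. of_real ((cmod (\<gamma> i))\<^sup>2 * nrm i))"
    by (auto intro!: sum.cong simp: complex_norm_square simp del: of_real_power)
  finally show ?thesis by (simp only: of_real_sum[symmetric] of_real_eq_iff)
qed

text \<open>Expand g in the eigenvectors and divide the i-th coefficient by \<open>a i - c\<close>;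
  Parseval turns the lower bound \<epsilon> on the divisors into the norm bound.\<close>

lemma trunc_resolvent_zeros:
  fixes c :: complex and g :: "nat \<Rightarrow> complex"
  assumes "0 < \<epsilon>" "\<And>i. i \<le> N \<Longrightarrow> \<epsilon> \<le> cmod (of_real (a i) - c)"
  shows "\<exists>f. f (Suc N) = 0 \<and>
    (\<forall>x\<le>N. of_real (V x) * f x - of_real (d x) * f (x - 1) - of_real (u x) * f (Suc x) - c * f x = g x) \<and>
    \<epsilon>\<^sup>2 * (\<Sum>x\<le>N. w x * (cmod (f x))\<^sup>2) \<le> (\<Sum>x\<le>N. w x * (cmod (g x))\<^sup>2)"
proof -
  define \<gamma> where "\<gamma> i = (\<Sum>y\<le>N. of_real (w y * poly (P y) (a i)) * g y) / of_real (nrm i)" for i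
  define f where "f x = (\<Sum>i\<le>N. \<gamma> i / (of_real (a i) - c) * of_real (poly (P x) (a i)))" for x
  have g: "g x = (\<Sum>i\<le>N. \<gamma> i * of_real (poly (P x) (a i)))" if x: "x \<le> N" for x
  proof -
    have "(\<Sum>i\<le>N. \<gamma> i * of_real (poly (P x) (a i)))
      = (\<Sum>i\<le>N. \<Sum>y\<le>N. of_real (w y) * g y * of_real (poly (P x) (a i) * poly (P y) (a i) / nrm i))"
      by (simp add: \<gamma>_def sum_distrib_left sum_distrib_right sum_divide_distrib mult_ac)
    also have "\<dots> = (\<Sum>y\<le>N. of_real (w y) * g y * of_real (\<Sum>i\<le>N. poly (P x) (a i) * poly (P y) (a i) / nrm i))"
      by (subst sum.swap) (simp add: sum_distrib_left)
    also have "\<dots> = (\<Sum>y\<le>N. if x = y then g y else 0)"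
      by (rule sum.cong) (use x w_pos less_irrefl in \<open>auto simp: eigenvectors_complete, metis\<close>)
    finally show ?thesis using x by simp
  qed
  have ne: "of_real (a i) - c \<noteq> 0" if "i \<le> N" for i
    using assms(1) assms(2)[OF that] by auto
  have "f (Suc N) = 0" unfolding f_def by (rule sum.neutral) (auto simp: zero)
  moreover have "of_real (V x) * f x - of_real (d x) * f (x - 1) - of_real (u x) * f (Suc x) - c * f x = g x" if x: "x \<le> N" for x
  proof -
    have "of_real (V x) * f x - of_real (d x) * f (x - 1) - of_real (u x) * f (Suc x) - c * f x
      = (\<Sum>i\<le>N. \<gamma> i / (of_real (a i) - c) * (of_real (V x * poly (P x) (a i) - d x * poly (P (x - 1)) (a i) - u x * poly (P (Suc x)) (a i)) - c * of_real (poly (P x) (a i))))"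
      unfolding f_def by (simp add: sum_distrib_left sum_subtractf[symmetric] algebra_simps diff_divide_distrib)
    also have "\<dots> = (\<Sum>i\<le>N. \<gamma> i * of_real (poly (P x) (a i)))"
    proof (rule sum.cong[OF refl])
      fix i assume i: "i \<in> {..N}"
      have "V x * poly (P x) (a i) - d x * poly (P (x - 1)) (a i) - u x * poly (P (Suc x)) (a i) = a i * poly (P x) (a i)"
        using P_rec[of x "a i"] by (simp add: algebra_simps)
      then show "\<gamma> i / (of_real (a i) - c) * (of_real (V x * poly (P x) (a i) - d x * poly (P (x - 1)) (a i) - u x * poly (P (Suc x)) (a i)) - c * of_real (poly (P x) (a i))) = \<gamma> i * of_real (poly (P x) (a i))"
        using ne[of i] i by (simp add: divide_simps) (simp add: algebra_simps)
    qed
    finally show ?thesis using g[OF x] by simp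
  qed
  moreover have "\<epsilon>\<^sup>2 * (\<Sum>x\<le>N. w x * (cmod (f x))\<^sup>2) \<le> (\<Sum>x\<le>N. w x * (cmod (g x))\<^sup>2)"
  proof -
    have "\<epsilon>\<^sup>2 * (\<Sum>x\<le>N. w x * (cmod (f x))\<^sup>2) = (\<Sum>i\<le>N. \<epsilon>\<^sup>2 * ((cmod (\<gamma> i / (of_real (a i) - c)))\<^sup>2 * nrm i))"
      unfolding f_def parseval by (rule sum_distrib_left)
    also have "\<dots> \<le> (\<Sum>i\<le>N. (cmod (\<gamma> i))\<^sup>2 * nrm i)"
    proof (rule sum_mono)
      fix i assume i: "i \<in> {..N}"
      have "\<epsilon> * cmod (\<gamma> i / (of_real (a i) - c)) \<le> cmod (of_real (a i) - c) * cmod (\<gamma> i / (of_real (a i) - c))"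
        using assms(2) i by (intro mult_right_mono) auto
      also have "\<dots> = cmod (\<gamma> i)" using ne[of i] i by (simp add: norm_divide)
      finally have "(\<epsilon> * cmod (\<gamma> i / (of_real (a i) - c)))\<^sup>2 \<le> (cmod (\<gamma> i))\<^sup>2"
        using assms(1) by (intro power_mono) auto
      then show "\<epsilon>\<^sup>2 * ((cmod (\<gamma> i / (of_real (a i) - c)))\<^sup>2 * nrm i) \<le> (cmod (\<gamma> i))\<^sup>2 * nrm i"
        using nrm_pos[of i] by (simp add: power_mult_distrib mult.assoc[symmetric] mult_right_mono less_imp_le)
    qed
    also have "\<dots> = (\<Sum>x\<le>N. w x * (cmod (g x))\<^sup>2)"
      unfolding parseval[symmetric] using g by simp
    finally show ?thesis .
  qed
  ultimately show ?thesis by blast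
qed

end

lemma real_zeros:
  assumes "strict_mono_on {..N} a" "\<And>i. i \<le> N \<Longrightarrow> poly (P (Suc N)) (a i) = 0"
  shows "{z. poly (P (Suc N)) z = 0} = (\<lambda>i. complex_of_real (a i)) ` {..N}"
proof -
  have "proots (P (Suc N) :: complex poly) = mset_set ((\<lambda>i. of_real (a i)) ` {..<Suc N})"
    by (rule proots_P) (use assms in \<open>auto simp: lessThan_Suc_atMost\<close>)
  then have "set_mset (proots (P (Suc N) :: complex poly)) = (\<lambda>i. of_real (a i)) ` {..<Suc N}"
    by simp
  then show ?thesis by (simp only: set_count_proots P_neq_0 not_False_eq_True lessThan_Suc_atMost)
qed

lemma trunc_resolvent:
  fixes c :: complex and g :: "nat \<Rightarrow> complex"
  assumes "0 < \<epsilon>" "\<And>z. poly (P (Suc N)) z = 0 \<Longrightarrow> \<epsilon> \<le> cmod (z - c)"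
  shows "\<exists>f. f (Suc N) = 0 \<and>
    (\<forall>x\<le>N. of_real (V x) * f x - of_real (d x) * f (x - 1) - of_real (u x) * f (Suc x) - c * f x = g x) \<and>
    \<epsilon>\<^sup>2 * (\<Sum>x\<le>N. w x * (cmod (f x))\<^sup>2) \<le> (\<Sum>x\<le>N. w x * (cmod (g x))\<^sup>2)"
proof -
  obtain a :: "nat \<Rightarrow> real" where ab: "strict_mono_on {..N} a" "\<And>i. i \<le> N \<Longrightarrow> poly (P (Suc N)) (a i) = 0"
    by (rule interlacing[of N]) blast
  show ?thesis
  proof (rule trunc_resolvent_zeros[OF ab assms(1)])
    show "\<epsilon> \<le> cmod (of_real (a i) - c)" if "i \<le> N" for i
      using real_zeros[OF ab] that by (intro assms(2)) auto
  qed
qed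

end

section \<open>The decimation map of the Laplacian\<close>

lemma poly_R_Delta:
  "poly (R_Delta p) z = z * (z + of_real (p - 2)) * (z - of_real p - 1) / of_real (p * (1 - p))"
  by (simp add: R_Delta_def divide_inverse algebra_simps)

text \<open>Stewart's theorem for the segment from 0 to 1: the distance to a real t is expressed by
  the distances to the two foci.\<close>

lemma cmod_diff_of_real_square:
  "(cmod (z - of_real t))\<^sup>2 = (1 - t) * (cmod z)\<^sup>2 + t * (cmod (z - 1))\<^sup>2 - t * (1 - t)"
  unfolding cmod_power2 by (simp add: power2_eq_square algebra_simps)

lemma foci_sum_expansion:
  fixes \<kappa> A B :: real
  assumes "0 < \<kappa>" "\<kappa> \<le> 1/4" "1 \<le> A + B" "A - B \<le> 1"
  shows "\<kappa>\<^sup>2 + 9 * \<kappa>\<^sup>2 * (A + B - 1) \<le>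
    A * (\<kappa> * A\<^sup>2 + (1 - \<kappa>) * B\<^sup>2 - \<kappa> * (1 - \<kappa>))
    + B * ((1/2 + \<kappa>) * A\<^sup>2 + (1/2 - \<kappa>) * B\<^sup>2 - 1/2 + \<kappa> + \<kappa>\<^sup>2)" (is "_ \<le> ?r")
proof -
  \<comment> \<open>Elliptic coordinates: in the sum and difference of the focal distances the
    right-hand side, less \<kappa>^2, splits off the factor \<open>s - 1\<close>.\<close>
  define s where "s = A + B"
  define t where "t = A - B"
  have AB: "A = (s + t) / 2" "B = (s - t) / 2" by (simp_all add: s_def t_def)
  have r: "?r = \<kappa>\<^sup>2 + (s - 1) * ((s + 1) * (s - (1 - 4 * \<kappa>) * t) / 4 + \<kappa>\<^sup>2)"
    unfolding AB by (simp add: power2_eq_square field_simps)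
  \<comment> \<open>Since s \<ge> 1 and t \<le> 1, the cofactor is at least 2 \<kappa> + \<kappa>^2,
    and 2 \<kappa> \<ge> 8 \<kappa>^2 because \<kappa> \<le> 1/4. This is where the 9 comes
    from.\<close>
  have "(1 - 4 * \<kappa>) * t \<le> (1 - 4 * \<kappa>) * 1" using assms by (intro mult_left_mono) (auto simp: t_def)
  then have "2 * (4 * \<kappa>) \<le> (s + 1) * (s - (1 - 4 * \<kappa>) * t)"
    using assms by (intro mult_mono) (auto simp: s_def)
  moreover have "\<kappa>\<^sup>2 \<le> \<kappa> * (1/4)" using assms by (simp add: power2_eq_square)
  ultimately have "9 * \<kappa>\<^sup>2 \<le> (s + 1) * (s - (1 - 4 * \<kappa>) * t) / 4 + \<kappa>\<^sup>2" by linarith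
  then have "(s - 1) * (9 * \<kappa>\<^sup>2) \<le> (s - 1) * ((s + 1) * (s - (1 - 4 * \<kappa>) * t) / 4 + \<kappa>\<^sup>2)"
    using assms by (intro mult_left_mono) (auto simp: s_def)
  then show ?thesis unfolding r by (simp add: s_def algebra_simps)
qed

locale delta_map =
  fixes p :: real
  assumes p_pos: "0 < p" and p_less: "p < 1"
begin

definition "\<kappa> = p * (1 - p)"

text \<open>The map depends on p only through \<kappa>, which is symmetric under p \<mapsto> 1 - p;
  taking the smaller of the two puts the endpoints of the laps in order.\<close>

definition "q = min p (1 - p)"

definition D :: "complex \<Rightarrow> complex" where "D = poly (R_Delta p)"

definition Dr :: "real \<Rightarrow> real" where "Dr x = 1 + (x - 1) * ((x - 1)\<^sup>2 - 1 + \<kappa>) / \<kappa>"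

text \<open>Excess over 1 of the sum of the distances of \<open>(z - 1)\<^sup>2\<close> to 0 and 1.
  It vanishes exactly on [0, 2] and serves as an escape function.\<close>

definition fociexc :: "complex \<Rightarrow> real" where
  "fociexc z = cmod ((z - 1)\<^sup>2) + cmod ((z - 1)\<^sup>2 - 1) - 1"

lemma \<kappa>_pos: "0 < \<kappa>" using p_pos p_less by (simp add: \<kappa>_def)

lemma \<kappa>_le: "\<kappa> \<le> 1/4"
proof -
  have "0 \<le> (p - 1/2)\<^sup>2" by simp
  then show ?thesis by (simp add: \<kappa>_def power2_eq_square algebra_simps)
qed

lemma q_pos: "0 < q" and q_le: "q \<le> 1/2" and \<kappa>_q: "\<kappa> = q * (1 - q)"
  using p_pos p_less by (auto simp: q_def \<kappa>_def min_def)

lemma D_eq: "D z = 1 + (z - 1) * ((z - 1)\<^sup>2 - 1 + of_real \<kappa>) / of_real \<kappa>"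
proof -
  have "complex_of_real \<kappa> \<noteq> 0" using \<kappa>_pos by simp
  then show ?thesis unfolding D_def poly_R_Delta \<kappa>_def[symmetric]
    by (simp add: divide_simps) (simp add: \<kappa>_def power2_eq_square algebra_simps)
qed

lemma D_of_real: "D (of_real x) = of_real (Dr x)"
  by (simp add: D_eq Dr_def)

lemma D_funpow_of_real: "(D ^^ m) (of_real x) = of_real ((Dr ^^ m) x)"
  by (induction m) (auto simp: D_of_real)

lemma fociexc_nonneg: "0 \<le> fociexc z"
  using norm_triangle_ineq4[of "(z - 1)\<^sup>2" "(z - 1)\<^sup>2 - 1"] by (simp add: fociexc_def)

text \<open>In the coordinate \<open>v = (z - 1)\<^sup>2\<close> the map becomes a cubic \<open>k\<close> with
  \<open>k - 1 = (v - 1) (v - p\<^sup>2) (v - (1 - p)\<^sup>2) / \<kappa>\<^sup>2\<close>; for \<open>p = 1/2\<close> it is the Chebyshev polynomial of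
  \<open>[0, 1]\<close>, and the excess of the sum of the distances to the foci \<open>0\<close> and \<open>1\<close> is expanded by
  at least \<open>9\<close> for every \<open>p\<close>.\<close>

lemma fociexc_D: "9 * fociexc z \<le> fociexc (D z)"
proof -
  define v where "v = (z - 1)\<^sup>2"
  define A where "A = cmod v"
  define B where "B = cmod (v - 1)"
  let ?k = "complex_of_real \<kappa>"
  have k0: "?k \<noteq> 0" using \<kappa>_pos by simp
  have v1: "(D z - 1)\<^sup>2 = v * (v - of_real (1 - \<kappa>))\<^sup>2 / ?k\<^sup>2"
  proof -
    have "D z - 1 = (z - 1) * (v - of_real (1 - \<kappa>)) / ?k" by (simp add: D_eq v_def)
    then show ?thesis by (simp only: power_mult_distrib power_divide v_def)
  qed
  have v2: "(D z - 1)\<^sup>2 - 1 = (v - 1) * ((v - of_real (1/2 - \<kappa>))\<^sup>2 - of_real (1/4 - \<kappa>)) / ?k\<^sup>2"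
    unfolding v1 using k0 by (simp add: divide_simps) (simp add: power2_eq_square algebra_simps)
  have X: "(cmod (v - of_real (1 - \<kappa>)))\<^sup>2 = \<kappa> * A\<^sup>2 + (1 - \<kappa>) * B\<^sup>2 - \<kappa> * (1 - \<kappa>)"
    by (simp add: cmod_diff_of_real_square A_def B_def algebra_simps del: of_real_diff)
  have Y0: "(cmod (v - of_real (1/2 - \<kappa>)))\<^sup>2 = (1/2 + \<kappa>) * A\<^sup>2 + (1/2 - \<kappa>) * B\<^sup>2 - (1/4 - \<kappa>\<^sup>2)"
    by (simp add: cmod_diff_of_real_square A_def B_def algebra_simps power2_eq_square[of \<kappa>] del: of_real_diff)
  have "(cmod (v - of_real (1/2 - \<kappa>)))\<^sup>2 - (1/4 - \<kappa>) \<le> cmod ((v - of_real (1/2 - \<kappa>))\<^sup>2 - of_real (1/4 - \<kappa>))"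
    using norm_triangle_ineq2[of "(v - of_real (1/2 - \<kappa>))\<^sup>2" "of_real (1/4 - \<kappa>)"] \<kappa>_le
    by (simp only: norm_power norm_of_real)
  then have Y: "(1/2 + \<kappa>) * A\<^sup>2 + (1/2 - \<kappa>) * B\<^sup>2 - 1/2 + \<kappa> + \<kappa>\<^sup>2
      \<le> cmod ((v - of_real (1/2 - \<kappa>))\<^sup>2 - of_real (1/4 - \<kappa>))"
    unfolding Y0 by linarith
  have "1 \<le> A + B" using norm_triangle_ineq4[of v "v - 1"] by (simp add: A_def B_def)
  moreover have "A - B \<le> 1" using norm_triangle_ineq[of "v - 1" 1] by (simp add: A_def B_def)
  ultimately have "\<kappa>\<^sup>2 + 9 * \<kappa>\<^sup>2 * (A + B - 1) \<le>
    A * (\<kappa> * A\<^sup>2 + (1 - \<kappa>) * B\<^sup>2 - \<kappa> * (1 - \<kappa>))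
    + B * ((1/2 + \<kappa>) * A\<^sup>2 + (1/2 - \<kappa>) * B\<^sup>2 - 1/2 + \<kappa> + \<kappa>\<^sup>2)"
    by (rule foci_sum_expansion[OF \<kappa>_pos \<kappa>_le])
  also have "\<dots> \<le> A * (cmod (v - of_real (1 - \<kappa>)))\<^sup>2 + B * cmod ((v - of_real (1/2 - \<kappa>))\<^sup>2 - of_real (1/4 - \<kappa>))"
    unfolding X using Y by (intro add_left_mono mult_left_mono) (auto simp: B_def)
  also have "\<dots> = \<kappa>\<^sup>2 * (cmod ((D z - 1)\<^sup>2) + cmod ((D z - 1)\<^sup>2 - 1))"
  proof -
    have "\<kappa>\<^sup>2 * cmod ((D z - 1)\<^sup>2) = A * (cmod (v - of_real (1 - \<kappa>)))\<^sup>2"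
      unfolding v1 using \<kappa>_pos by (simp add: norm_mult norm_divide norm_power A_def del: of_real_diff)
    moreover have "\<kappa>\<^sup>2 * cmod ((D z - 1)\<^sup>2 - 1) = B * cmod ((v - of_real (1/2 - \<kappa>))\<^sup>2 - of_real (1/4 - \<kappa>))"
      unfolding v2 using \<kappa>_pos by (simp add: norm_mult norm_divide norm_power B_def del: of_real_diff)
    ultimately show ?thesis by (simp only: distrib_left)
  qed
  finally have "\<kappa>\<^sup>2 * (9 * (A + B - 1)) \<le> \<kappa>\<^sup>2 * fociexc (D z)"
    by (simp add: fociexc_def algebra_simps)
  then show ?thesis using \<kappa>_pos by (simp add: fociexc_def A_def B_def v_def)
qed

lemma fociexc_D_funpow: "9 ^ m * fociexc z \<le> fociexc ((D ^^ m) z)"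
proof (induction m)
  case (Suc m)
  show ?case using fociexc_D[of "(D ^^ m) z"] Suc by simp
qed simp

lemma fociexc_0_real:
  assumes "fociexc z = 0"
  shows "\<exists>x\<in>{0..2}. z = of_real x"
proof -
  define v where "v = (z - 1)\<^sup>2"
  have e: "cmod v + cmod (v - 1) = 1" using assms by (simp add: fociexc_def v_def)
  have "\<bar>Re v\<bar> + \<bar>Re v - 1\<bar> \<le> cmod v + cmod (v - 1)"
    by (intro add_mono) (use abs_Re_le_cmod[of v] abs_Re_le_cmod[of "v - 1"] in auto)
  then have re: "0 \<le> Re v" "Re v \<le> 1" using e by auto
  have "Re v \<le> cmod v" "1 - Re v \<le> cmod (v - 1)"
    using complex_Re_le_cmod[of v] abs_Re_le_cmod[of "v - 1"] by auto
  then have "Re v = cmod v" using e by linarith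
  then have "(Re v)\<^sup>2 = (Re v)\<^sup>2 + (Im v)\<^sup>2" by (metis cmod_power2)
  then have im: "Im v = 0" by simp
  have "Im v = 2 * Re (z - 1) * Im (z - 1)" "Re v = (Re (z - 1))\<^sup>2 - (Im (z - 1))\<^sup>2"
    by (simp_all only: v_def Im_power2 Re_power2)
  then have "Im (z - 1) = 0" using im re(1)
    by (smt (verit) mult_eq_0_iff power2_less_0 zero_eq_power2)
  then have z: "z = of_real (Re z)" by (simp add: complex_eq_iff)
  have "(Re z - 1)\<^sup>2 \<le> 1" using re(2) \<open>Im (z - 1) = 0\<close> by (simp add: v_def power2_eq_square)
  then have "\<bar>Re z - 1\<bar> \<le> 1" by (simp add: abs_square_le_1)
  then show ?thesis using z by (intro bexI[of _ "Re z"]) auto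
qed

text \<open>A bounded orbit has bounded excess, yet every step multiplies the excess by at least 9;
  so the excess is 0.\<close>

lemma filled_julia_real:
  assumes "z \<in> filled_julia (R_Delta p)"
  shows "\<exists>x\<in>{0..2}. z = of_real x"
proof (rule fociexc_0_real, rule ccontr)
  assume ne: "fociexc z \<noteq> 0"
  then have pos: "0 < fociexc z" using fociexc_nonneg[of z] by simp
  obtain C where C: "\<And>m. cmod ((D ^^ m) z) \<le> C"
    using assms by (auto simp: filled_julia_def bounded_iff D_def)
  have "fociexc ((D ^^ m) z) \<le> 2 * (C + 1)\<^sup>2 + 1" for m
  proof -
    let ?y = "(D ^^ m) z"
    have "cmod (?y - 1) \<le> C + 1" using norm_triangle_ineq4[of ?y 1] C[of m] by simp
    then have "(cmod (?y - 1))\<^sup>2 \<le> (C + 1)\<^sup>2" by (intro power_mono) auto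
    moreover have "cmod ((?y - 1)\<^sup>2 - 1) \<le> (cmod (?y - 1))\<^sup>2 + 1"
      using norm_triangle_ineq4[of "(?y - 1)\<^sup>2" 1] by (simp add: norm_power)
    ultimately show ?thesis by (simp add: fociexc_def norm_power)
  qed
  then have "9 ^ m \<le> (2 * (C + 1)\<^sup>2 + 1) / fociexc z" for m
    using fociexc_D_funpow[of m z] pos by (simp add: field_simps order.trans)
  then show False using real_arch_pow[of 9 "(2 * (C + 1)\<^sup>2 + 1) / fociexc z"]
    by (meson not_less one_less_numeral_iff semiring_norm(77) numeral_eq_one_iff less_le_trans rel_simps(9) one_less_numeral)
qed

lemma D_filled_julia: "z \<in> filled_julia (R_Delta p) \<Longrightarrow> D z \<in> filled_julia (R_Delta p)"
proof -
  assume "z \<in> filled_julia (R_Delta p)"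
  then have "bounded (range (\<lambda>m. (D ^^ m) z))" by (simp add: filled_julia_def D_def)
  then have "bounded (range (\<lambda>m. (D ^^ (Suc m)) z))" by (rule bounded_subset) (auto simp del: funpow.simps)
  then show ?thesis by (simp add: filled_julia_def D_def funpow_swap1)
qed

lemma D_funpow_filled_julia:
  "z \<in> filled_julia (R_Delta p) \<Longrightarrow> (D ^^ m) z \<in> filled_julia (R_Delta p)"
  by (induction m) (auto intro: D_filled_julia)

lemma filled_julia_eq: "filled_julia (R_Delta p) = (\<Inter>m. (D ^^ m) -` (of_real ` {0..2}))"
proof
  show "filled_julia (R_Delta p) \<subseteq> (\<Inter>m. (D ^^ m) -` (of_real ` {0..2}))"
    using filled_julia_real D_funpow_filled_julia by blast
  show "(\<Inter>m. (D ^^ m) -` (of_real ` {0..2})) \<subseteq> filled_julia (R_Delta p)"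
  proof
    fix z assume z: "z \<in> (\<Inter>m. (D ^^ m) -` (of_real ` {0..2}))"
    have "cmod ((D ^^ m) z) \<le> 2" for m
    proof -
      obtain x where "x \<in> {0..2}" "(D ^^ m) z = of_real x" using z by blast
      then show ?thesis by simp
    qed
    then have "bounded (range (\<lambda>m. (D ^^ m) z))" unfolding bounded_iff by blast
    then show "z \<in> filled_julia (R_Delta p)" by (simp add: filled_julia_def D_def)
  qed
qed

lemma of_real_filled_julia:
  "of_real x \<in> filled_julia (R_Delta p) \<longleftrightarrow> (\<forall>m. (Dr ^^ m) x \<in> {0..2})"
  unfolding filled_julia_eq by (auto simp: D_funpow_of_real image_iff)

lemma closed_filled_julia: "closed (filled_julia (R_Delta p))"
  unfolding filled_julia_eq
proof (intro closed_INT ballI continuous_closed_vimage allI)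
  fix m z
  show "closed (complex_of_real ` {0..2})"
    by (intro compact_imp_closed compact_continuous_image) (auto intro: continuous_intros)
  have "continuous_on UNIV (D ^^ m)"
    by (induction m) (auto simp: D_def intro!: continuous_on_compose2[of UNIV "poly _"] continuous_intros)
  then show "isCont (D ^^ m) z" by (simp add: continuous_on_eq_continuous_at)
qed

lemma julia_subset: "julia (R_Delta p) \<subseteq> filled_julia (R_Delta p)"
  using closed_filled_julia by (simp add: julia_def frontier_def closure_closed Diff_subset)

text \<open>The three intervals that \<open>Dr\<close> maps monotonically onto [0, 2]; on the two
  gaps between them \<open>Dr\<close> leaves [0, 2]. For p = 1/2 the gaps are empty and neighbouring
  laps share an endpoint.\<close>

definition laps :: "(real \<times> real) set" where
  "laps = {(0, q), (1 - q, 1 + q), (2 - q, 2)}"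

lemma finite_laps: "finite laps" by (simp add: laps_def)

lemma lap_bounds: "(a, b) \<in> laps \<Longrightarrow> 0 \<le> a \<and> a < b \<and> b \<le> 2"
  using q_pos q_le by (auto simp: laps_def)

text \<open>The sign of the right-hand side separates laps from gaps, and the left-hand side is, up
  to \<kappa>^2, the radicand in the derivative of arccos at \<open>Dr x - 1\<close>.\<close>

lemma one_minus_Dr_square:
  "\<kappa>\<^sup>2 * (1 - (Dr x - 1)\<^sup>2) = (1 - (x - 1)\<^sup>2) * (((x - 1)\<^sup>2 - q\<^sup>2) * ((x - 1)\<^sup>2 - (1 - q)\<^sup>2))"
proof -
  have "(\<kappa> * (Dr x - 1))\<^sup>2 = ((x - 1) * ((x - 1)\<^sup>2 - 1 + \<kappa>))\<^sup>2"
    using \<kappa>_pos by (simp add: Dr_def)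
  moreover have "\<kappa>\<^sup>2 * (1 - (Dr x - 1)\<^sup>2) = \<kappa>\<^sup>2 - (\<kappa> * (Dr x - 1))\<^sup>2"
    unfolding power_mult_distrib by (simp only: right_diff_distrib mult_1_right)
  ultimately have "\<kappa>\<^sup>2 * (1 - (Dr x - 1)\<^sup>2) = \<kappa>\<^sup>2 - ((x - 1) * ((x - 1)\<^sup>2 - 1 + \<kappa>))\<^sup>2"
    by simp
  also have "\<dots> = (1 - (x - 1)\<^sup>2) * (((x - 1)\<^sup>2 - q\<^sup>2) * ((x - 1)\<^sup>2 - (1 - q)\<^sup>2))"
    unfolding \<kappa>_q by (simp add: power2_eq_square algebra_simps)
  finally show ?thesis .
qed

lemma in_lap_if_Dr_mem:
  assumes "x \<in> {0..2}" "Dr x \<in> {0..2}"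
  shows "\<exists>(a, b)\<in>laps. x \<in> {a..b}"
proof (rule ccontr)
  assume "\<not> ?thesis"
  then have n: "x \<in> {q<..<1-q} \<or> x \<in> {1+q<..<2-q}" using assms(1) q_pos q_le
    by (auto simp: laps_def)
  define s where "s = \<bar>x - 1\<bar>"
  have s: "q < s" "s < 1 - q" "(x - 1)\<^sup>2 = s\<^sup>2" using n by (auto simp: s_def)
  have "q\<^sup>2 < s\<^sup>2" "s\<^sup>2 < (1 - q)\<^sup>2"
    using s q_pos by (auto intro!: power_strict_mono)
  moreover have "s\<^sup>2 < 1\<^sup>2" using s q_pos by (intro power_strict_mono) auto
  ultimately
  have "(1 - (x - 1)\<^sup>2) * (((x - 1)\<^sup>2 - q\<^sup>2) * ((x - 1)\<^sup>2 - (1 - q)\<^sup>2)) < 0"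
    unfolding s(3) by (intro mult_pos_neg) auto
  then have "1 < (Dr x - 1)\<^sup>2" using \<kappa>_pos unfolding one_minus_Dr_square[symmetric]
    by (simp add: mult_less_0_iff)
  moreover have "\<bar>Dr x - 1\<bar> \<le> 1" using assms(2) by auto
  ultimately show False by (simp add: abs_square_le_1[symmetric])
qed

lemma Dr_open_lap:
  assumes "(a, b) \<in> laps" "x \<in> {a<..<b}"
  shows "Dr x \<in> {0<..<2}" "0 < ((x - 1)\<^sup>2 - q\<^sup>2) * ((x - 1)\<^sup>2 - (1 - q)\<^sup>2)" "(x - 1)\<^sup>2 < 1"
proof -
  define s where "s = \<bar>x - 1\<bar>"
  have s2: "(x - 1)\<^sup>2 = s\<^sup>2" by (simp add: s_def)
  have s: "0 \<le> s \<and> (s < q \<or> 1 - q < s \<and> s < 1)" using assms q_pos q_le by (auto simp: laps_def s_def)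
  show 2: "0 < ((x - 1)\<^sup>2 - q\<^sup>2) * ((x - 1)\<^sup>2 - (1 - q)\<^sup>2)"
  proof (cases "s < q")
    case True
    then have "s\<^sup>2 < q\<^sup>2" "s\<^sup>2 < (1 - q)\<^sup>2" using s q_le by (auto intro!: power_strict_mono)
    then show ?thesis unfolding s2 by (intro mult_neg_neg) auto
  next
    case False
    then have "q\<^sup>2 < s\<^sup>2" "(1 - q)\<^sup>2 < s\<^sup>2" using s q_le q_pos by (auto intro!: power_strict_mono)
    then show ?thesis unfolding s2 by (intro mult_pos_pos) auto
  qed
  have "s < 1" using s q_le by auto
  then have "s\<^sup>2 < 1\<^sup>2" using s by (intro power_strict_mono) auto
  then show 3: "(x - 1)\<^sup>2 < 1" unfolding s2 by simp
  have "0 < \<kappa>\<^sup>2 * (1 - (Dr x - 1)\<^sup>2)" unfolding one_minus_Dr_square using 2 3 by (intro mult_pos_pos[of "1 - _"]) simp_all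
  then have "(Dr x - 1)\<^sup>2 < 1" using \<kappa>_pos by (simp add: zero_less_mult_iff)
  then have "\<bar>Dr x - 1\<bar> < 1" by (simp add: abs_square_less_1)
  then show "Dr x \<in> {0<..<2}" by auto
qed

lemma Dr_ends:
  assumes "(a, b) \<in> laps"
  shows "(Dr a = 0 \<and> Dr b = 2) \<or> (Dr a = 2 \<and> Dr b = 0)"
proof -
  have k: "q * (1 - q) \<noteq> 0" using q_pos q_le by auto
  have "Dr 0 = 0" "Dr q = 2" "Dr (1 - q) = 2" "Dr (1 + q) = 0" "Dr (2 - q) = 0" "Dr 2 = 2"
    using k by (auto simp: Dr_def \<kappa>_q divide_simps) (auto simp: power2_eq_square algebra_simps)
  then show ?thesis using assms by (auto simp: laps_def)
qed

lemma continuous_Dr [continuous_intros]: "continuous_on A f \<Longrightarrow> continuous_on A (\<lambda>x. Dr (f x))"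
  unfolding Dr_def using \<kappa>_pos by (intro continuous_intros) auto

lemma Dr_lap_surj:
  assumes "(a, b) \<in> laps" "y \<in> {0..2}"
  shows "\<exists>x\<in>{a..b}. Dr x = y"
proof -
  have c: "continuous_on {a..b} Dr" by (intro continuous_Dr[of _ "\<lambda>x. x"] continuous_intros)
  from Dr_ends[OF assms(1)] show ?thesis
  proof
    assume "Dr a = 0 \<and> Dr b = 2"
    then show ?thesis using IVT'[of Dr a y b] c lap_bounds[OF assms(1)] assms(2) by force
  next
    assume "Dr a = 2 \<and> Dr b = 0"
    then show ?thesis using IVT2'[of Dr b y a] c lap_bounds[OF assms(1)] assms(2) by force
  qed
qed

lemma Dr_lap:
  assumes "(a, b) \<in> laps" "x \<in> {a..b}"
  shows "Dr x \<in> {0..2}"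
proof -
  consider "x = a" | "x = b" | "x \<in> {a<..<b}" using assms(2) by fastforce
  then show ?thesis using Dr_ends[OF assms(1)] Dr_open_lap(1)[OF assms(1)] by cases fastforce+
qed

text \<open>The angle variable: for p = 1/2 it turns \<open>Dr\<close> into a piecewise linear map
  of slope 3 in absolute value.\<close>

definition \<theta> :: "real \<Rightarrow> real" where "\<theta> x = arccos (x - 1)"

lemma \<theta>_dist_le_pi: "x \<in> {0..2} \<Longrightarrow> y \<in> {0..2} \<Longrightarrow> \<bar>\<theta> x - \<theta> y\<bar> \<le> pi"
  using arccos_bounded[of "x - 1"] arccos_bounded[of "y - 1"] by (auto simp: \<theta>_def)

lemma dist_le_\<theta>:
  assumes "x \<in> {0..2}" "y \<in> {0..2}"
  shows "\<bar>x - y\<bar> \<le> \<bar>\<theta> x - \<theta> y\<bar>"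
proof -
  have "\<bar>cos s - cos t\<bar> \<le> \<bar>s - t\<bar>" for s t :: real
  proof -
    have "\<bar>sin ((s + t) / 2)\<bar> * \<bar>sin ((t - s) / 2)\<bar> \<le> 1 * \<bar>(t - s) / 2\<bar>"
      using abs_sin_x_le_abs_x[of "(t - s) / 2"] by (intro mult_mono) auto
    then show ?thesis unfolding cos_diff_cos by (simp add: abs_mult)
  qed
  from this[of "\<theta> x" "\<theta> y"] show ?thesis using assms by (simp add: \<theta>_def)
qed

text \<open>Comparing \<open>\<theta> \<circ> Dr\<close> with \<theta> by Cauchy's mean value
  theorem reduces the claim to an inequality between derivatives. These are taken only inside the
  lap, because arccos can have infinite slope at its ends.\<close>

lemma lap_expansion:
  assumes lap: "(a, b) \<in> laps" and "x \<in> {a..b}" "y \<in> {a..b}"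
  shows "3 * \<bar>\<theta> x - \<theta> y\<bar> \<le> \<bar>\<theta> (Dr x) - \<theta> (Dr y)\<bar>"
  using assms(2,3)
proof (induction x y rule: linorder_wlog)
  case (sym x y) then show ?case by (simp add: abs_minus_commute)
next
  case (le x y)
  show ?case
  proof (cases "x = y")
    case False
    with le have xy: "x < y" by simp
    let ?f = "\<lambda>x. \<theta> (Dr x)"
    let ?h' = "\<lambda>x. (3 * (x - 1)\<^sup>2 - 1 + \<kappa>) / \<kappa>"
    let ?f' = "\<lambda>x. inverse (- sqrt (1 - (Dr x - 1)\<^sup>2)) * ?h' x"
    let ?g' = "\<lambda>x. inverse (- sqrt (1 - (x - 1)\<^sup>2))"
    have sub: "{x..y} \<subseteq> {a..b}" using le by auto
    have ab: "0 \<le> a" "b \<le> 2" using lap_bounds[OF lap] by auto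
    have cf: "continuous_on {x..y} ?f" unfolding \<theta>_def
      by (intro continuous_intros ballI) (use Dr_lap[OF lap] sub in force)+
    have cg: "continuous_on {x..y} \<theta>" unfolding \<theta>_def
      by (intro continuous_intros ballI) (use ab le in force)+
    have dg: "(\<theta> has_real_derivative ?g' c) (at c)" if "c \<in> {x<..<y}" for c
      unfolding \<theta>_def by (rule derivative_eq_intros refl | use that ab le in force)+
    have df: "(?f has_real_derivative ?f' c) (at c)" if "c \<in> {x<..<y}" for c
    proof -
      have "Dr c \<in> {0<..<2}" using Dr_open_lap(1)[OF lap, of c] that le by auto
      moreover have "(Dr has_real_derivative ?h' c) (at c)"
        unfolding Dr_def using \<kappa>_pos by (auto intro!: derivative_eq_intros simp: field_simps power2_eq_square)
      ultimately show ?thesis unfolding \<theta>_def by (auto intro!: derivative_eq_intros)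
    qed
    \<comment> \<open>Cauchy's auxiliary function: it takes equal values at x and y, so its
      derivative vanishes at some inner point.\<close>
    define G where "G t = (?f y - ?f x) * \<theta> t - (\<theta> y - \<theta> x) * ?f t" for t
    have cont: "continuous_on {x..y} G"
      unfolding G_def by (intro continuous_intros cf cg)
    have deriv: "(G has_real_derivative (?f y - ?f x) * ?g' c - (\<theta> y - \<theta> x) * ?f' c) (at c)"
      if "c \<in> {x<..<y}" for c
      unfolding G_def by (intro DERIV_diff DERIV_cmult df dg that)
    have "G differentiable (at c)" if "x < c" "c < y" for c
      unfolding real_differentiable_def using deriv[of c] that by (intro exI) auto
    from MVT[OF xy cont this] obtain l c where lc: "x < c" "c < y"
      "(G has_real_derivative l) (at c)" "G y - G x = (y - x) * l"
      by blast
    have "(y - x) * l = 0" unfolding lc(4)[symmetric] by (simp add: G_def algebra_simps)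
    then have "l = 0" using xy by simp
    moreover have "l = (?f y - ?f x) * ?g' c - (\<theta> y - \<theta> x) * ?f' c"
      by (rule DERIV_unique[OF lc(3) deriv]) (use lc in auto)
    ultimately have c: "x < c" "c < y" "(?f y - ?f x) * ?g' c = (\<theta> y - \<theta> x) * ?f' c"
      using lc(1,2) by simp_all
    have cab: "c \<in> {a<..<b}" using c le by auto
    note o = Dr_open_lap[OF lap cab]
    let ?A = "sqrt (1 - (c - 1)\<^sup>2)" and ?B = "sqrt (1 - (Dr c - 1)\<^sup>2)"
    have "\<bar>Dr c - 1\<bar> < 1" using o(1) by auto
    then have B2: "(Dr c - 1)\<^sup>2 < 1" by (simp add: abs_square_less_1)
    have A: "0 < ?A" and B: "0 < ?B" using o(3) B2 by auto
    \<comment> \<open>The inequality between the derivatives, squared to remove both square roots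
      coming from arccos.\<close>
    have "(3 * ?B)\<^sup>2 \<le> (\<bar>?h' c\<bar> * ?A)\<^sup>2"
    proof -
      have pos: "0 < 1 - (c - 1)\<^sup>2" using o(3) by simp
      \<comment> \<open>After the factorisation of \<open>1 - (Dr c - 1)\<^sup>2\<close> the claim
        is that this difference is nonnegative; it vanishes identically for \<kappa> = 1/4.\<close>
      have id: "(3 * t - 1 + \<kappa>)\<^sup>2 - 9 * ((t - q\<^sup>2) * (t - (1 - q)\<^sup>2))
          = (1 - 4 * \<kappa>) * (3 * t + 1 + 2 * \<kappa>)" for t
        unfolding \<kappa>_q by (simp add: power2_eq_square algebra_simps)
      have "0 \<le> (1 - 4 * \<kappa>) * (3 * (c - 1)\<^sup>2 + 1 + 2 * \<kappa>)"
        using \<kappa>_le \<kappa>_pos by (intro mult_nonneg_nonneg) auto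
      then have "9 * (((c - 1)\<^sup>2 - q\<^sup>2) * ((c - 1)\<^sup>2 - (1 - q)\<^sup>2)) \<le> (3 * (c - 1)\<^sup>2 - 1 + \<kappa>)\<^sup>2"
        using id[of "(c - 1)\<^sup>2"] by linarith
      then have "(1 - (c - 1)\<^sup>2) * (9 * (((c - 1)\<^sup>2 - q\<^sup>2) * ((c - 1)\<^sup>2 - (1 - q)\<^sup>2)))
          \<le> (1 - (c - 1)\<^sup>2) * (3 * (c - 1)\<^sup>2 - 1 + \<kappa>)\<^sup>2"
        using pos by (intro mult_left_mono) auto
      also have "(3 * (c - 1)\<^sup>2 - 1 + \<kappa>)\<^sup>2 = \<kappa>\<^sup>2 * (?h' c)\<^sup>2" using \<kappa>_pos by (simp add: power_divide)
      also have "(1 - (c - 1)\<^sup>2) * (9 * (((c - 1)\<^sup>2 - q\<^sup>2) * ((c - 1)\<^sup>2 - (1 - q)\<^sup>2))) = \<kappa>\<^sup>2 * (9 * (1 - (Dr c - 1)\<^sup>2))"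
        using one_minus_Dr_square[of c] by (simp only: mult.left_commute[of _ 9])
      finally have "\<kappa>\<^sup>2 * (9 * (1 - (Dr c - 1)\<^sup>2)) \<le> \<kappa>\<^sup>2 * ((1 - (c - 1)\<^sup>2) * (?h' c)\<^sup>2)"
        by (simp only: mult.left_commute)
      then have "9 * (1 - (Dr c - 1)\<^sup>2) \<le> (1 - (c - 1)\<^sup>2) * (?h' c)\<^sup>2"
        using \<kappa>_pos by (simp only: mult_le_cancel_left_pos zero_less_power)
      moreover have "(3 * ?B)\<^sup>2 = 9 * (1 - (Dr c - 1)\<^sup>2)" using B2 by (simp add: power_mult_distrib)
      moreover have "(\<bar>?h' c\<bar> * ?A)\<^sup>2 = (1 - (c - 1)\<^sup>2) * (?h' c)\<^sup>2"
        unfolding power_mult_distrib power2_abs using pos by (subst real_sqrt_pow2) (simp_all add: mult.commute)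
      ultimately show ?thesis by (simp only:)
    qed
    then have ineq: "3 * ?B \<le> \<bar>?h' c\<bar> * ?A"
      using A by (intro power2_le_imp_le[of "3 * ?B"]) auto
    have abs_eq: "\<bar>?f y - ?f x\<bar> * inverse ?A = \<bar>\<theta> y - \<theta> x\<bar> * (inverse ?B * \<bar>?h' c\<bar>)"
      using arg_cong[OF c(3), of abs] A B by (simp only: abs_mult abs_inverse abs_minus_cancel abs_of_pos)
    have "X * b = Y * (h * a)" if "X * inverse a = Y * (inverse b * h)" "0 < a" "0 < b" for X Y a b h :: real
      using that by (simp add: field_simps)
    from this[OF abs_eq A B] have "\<bar>?f y - ?f x\<bar> * ?B = \<bar>\<theta> y - \<theta> x\<bar> * (\<bar>?h' c\<bar> * ?A)" .
    also have "\<dots> \<ge> \<bar>\<theta> y - \<theta> x\<bar> * (3 * ?B)" using ineq by (intro mult_left_mono) auto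
    finally have "(3 * \<bar>\<theta> y - \<theta> x\<bar>) * ?B \<le> \<bar>?f y - ?f x\<bar> * ?B" by (simp only: mult_ac)
    then have "3 * \<bar>\<theta> y - \<theta> x\<bar> \<le> \<bar>?f y - ?f x\<bar>" using B by (simp only: mult_le_cancel_right_pos)
    then show ?thesis by (simp add: abs_minus_commute)
  qed simp
qed

lemma Dr_lap_inj:
  assumes "(a, b) \<in> laps"
  shows "inj_on Dr {a..b}"
proof (rule inj_onI)
  fix x y assume xy: "x \<in> {a..b}" "y \<in> {a..b}" "Dr x = Dr y"
  have "\<bar>x - y\<bar> \<le> \<bar>\<theta> x - \<theta> y\<bar>" using lap_bounds[OF assms] xy by (intro dist_le_\<theta>) auto
  then show "x = y" using lap_expansion[OF assms xy(1,2)] xy(3) by simp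
qed

text \<open>Pull t back through the laps visited by the orbit of y: every pull-back divides the
  angular distance, at most pi at the start, by 3.\<close>

lemma julia_approx:
  assumes "of_real y \<in> filled_julia (R_Delta p)" "t \<in> {0..2}"
  shows "\<exists>x\<in>{0..2}. (Dr ^^ m) x = t \<and> \<bar>\<theta> x - \<theta> y\<bar> \<le> pi / 3 ^ m"
  using assms(1)
proof (induction m arbitrary: y)
  case 0
  then show ?case using assms(2) \<theta>_dist_le_pi[of t y] of_real_filled_julia[of y]
    by (auto intro!: bexI[of _ t] dest: spec[of _ 0])
next
  case (Suc m)
  have y: "y \<in> {0..2}" "Dr y \<in> {0..2}"
    using Suc.prems spec[of "\<lambda>m. (Dr ^^ m) y \<in> {0..2}" 0] spec[of "\<lambda>m. (Dr ^^ m) y \<in> {0..2}" 1]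
    by (auto simp: of_real_filled_julia)
  obtain a b where ab: "(a, b) \<in> laps" "y \<in> {a..b}" using in_lap_if_Dr_mem[OF y] by auto
  have "of_real (Dr y) \<in> filled_julia (R_Delta p)"
    using D_filled_julia[OF Suc.prems] by (simp add: D_of_real)
  from Suc.IH[OF this] obtain x1 where x1: "x1 \<in> {0..2}" "(Dr ^^ m) x1 = t" "\<bar>\<theta> x1 - \<theta> (Dr y)\<bar> \<le> pi / 3 ^ m"
    by blast
  obtain x where x: "x \<in> {a..b}" "Dr x = x1" using Dr_lap_surj[OF ab(1) x1(1)] by blast
  have "3 * \<bar>\<theta> x - \<theta> y\<bar> \<le> pi / 3 ^ m" using lap_expansion[OF ab(1) x(1) ab(2)] x1(3) x(2) by simp
  then show ?case using x x1(2) lap_bounds[OF ab(1)]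
    by (intro bexI[of _ x]) (auto simp: funpow_swap1 field_simps simp del: funpow.simps(2) simp: funpow_Suc_right)
qed

end

section \<open>The self-similar walk\<close>

lemma m3_eq:
  assumes "\<not> 3 dvd y"
  shows "m3 (3 ^ m * y) = m"
  unfolding m3_def
proof (rule Greatest_equality)
  fix k :: nat assume k: "3 ^ k dvd 3 ^ m * y"
  show "k \<le> m"
  proof (rule ccontr)
    assume "\<not> k \<le> m"
    then have "(3::nat) ^ Suc m dvd 3 ^ k" by (intro le_imp_power_dvd) simp
    from dvd_trans[OF this k] have "(3::nat) ^ m * 3 dvd 3 ^ m * y" by (simp only: power_Suc mult.commute[of 3])
    then show False using assms by simp
  qed
qed simp

lemma digit3_eq: "\<not> 3 dvd y \<Longrightarrow> digit3 (3 ^ m * y) = y mod 3"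
  by (simp add: digit3_def m3_eq)

lemma not_dvd3_decomp:
  assumes "0 < (x::nat)"
  obtains m y where "x = 3 ^ m * y" "\<not> 3 dvd y"
  using assms
proof (induction x arbitrary: thesis rule: less_induct)
  case (less x)
  show ?case
  proof (cases "3 dvd x")
    case True
    then obtain z where z: "x = 3 * z" by blast
    obtain m y where "z = 3 ^ m * y" "\<not> 3 dvd y" using less.IH[of z] less.prems(2) z by auto
    then show ?thesis using less.prems(1)[of "Suc m" y] z by simp
  next
    case False
    then show ?thesis using less.prems(1)[of 0 x] by simp
  qed
qed

lemma p_up_pow3_mult: "\<not> 3 dvd y \<Longrightarrow> p_up p (3 ^ m * y) = (if y mod 3 = 1 then p else 1 - p)"
  using digit3_eq[of y m] by (auto simp: p_up_def)

lemma p_down_pow3_mult: "\<not> 3 dvd y \<Longrightarrow> p_down p (3 ^ m * y) = (if y mod 3 = 1 then 1 - p else p)"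
  using p_up_pow3_mult[of y p m] by (auto simp: p_down_def)

lemma p_up_0 [simp]: "p_up p 0 = 1" and p_down_0 [simp]: "p_down p 0 = 0"
  by (simp_all add: p_up_def p_down_def)

lemma p_up_plus_p_down: "p_up p x + p_down p x = 1"
  by (simp add: p_down_def)

lemma p_up_triple: "p_up p (3 * x) = p_up p x"
proof (cases "x = 0")
  case False
  then obtain m y where y: "x = 3 ^ m * y" "\<not> 3 dvd y" using not_dvd3_decomp[of x] by auto
  then have "3 * x = 3 ^ Suc m * y" by simp
  then show ?thesis using p_up_pow3_mult[OF y(2), of p m] p_up_pow3_mult[OF y(2), of p "Suc m"] y(1)
    by (simp only:)
qed simp

lemma p_down_triple: "p_down p (3 * x) = p_down p x"
  using p_up_triple[of p x] by (simp add: p_down_def)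

lemma not_dvd3_add: "\<not> 3 dvd 3 * x + (1::nat)" "\<not> 3 dvd 3 * x + (2::nat)"
  by presburger+

lemma mod3: "(3 * x + 1) mod 3 = (1::nat)" "(3 * x + 2) mod 3 = (2::nat)"
  by presburger+

lemma p_up_1: "p_up p (3 * x + 1) = p" and p_up_2: "p_up p (3 * x + 2) = 1 - p"
  and p_down_1: "p_down p (3 * x + 1) = 1 - p" and p_down_2: "p_down p (3 * x + 2) = p"
  using p_up_pow3_mult[OF not_dvd3_add(1)[of x], of p 0] p_up_pow3_mult[OF not_dvd3_add(2)[of x], of p 0]
    p_down_pow3_mult[OF not_dvd3_add(1)[of x], of p 0] p_down_pow3_mult[OF not_dvd3_add(2)[of x], of p 0]
  unfolding mod3 by simp_all

text \<open>\<open>p_up\<close> depends only on the last nonzero ternary digit, and adding a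
  multiple of \<open>3 ^ l\<close> does not reach that digit of r.\<close>

lemma p_up_shift:
  assumes "0 < r" "r < 3 ^ l"
  shows "p_up p (3 ^ l * q + r) = p_up p r"
proof -
  obtain m y where y: "r = 3 ^ m * y" "\<not> 3 dvd y" using not_dvd3_decomp[OF assms(1)] by auto
  have "y \<ge> 1" using assms y by (cases y) auto
  then have "3 ^ m \<le> r" unfolding y(1) by simp
  then have "(3::nat) ^ m < 3 ^ l" using assms(2) by linarith
  then have "m < l" by simp
  then have l: "3 ^ l = (3::nat) ^ m * 3 ^ (l - m)" and "3 dvd (3::nat) ^ (l - m)" by (simp_all flip: power_add)
  then obtain e where e: "3 ^ (l - m) = 3 * (e::nat)" by blast
  have "3 ^ l * q + r = 3 ^ m * (3 * (e * q) + y)" unfolding l e y(1) by (simp add: algebra_simps)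
  moreover have "\<not> 3 dvd 3 * (e * q) + y" "(3 * (e * q) + y) mod 3 = y mod 3" using y(2) by (simp_all add: dvd_add_right_iff)
  ultimately show ?thesis
    using p_up_pow3_mult[of "3 * (e * q) + y" p m] p_up_pow3_mult[OF y(2), of p m] y(1) by (simp only: not_False_eq_True)
qed

text \<open>Reflection exchanges the last nonzero digits 1 and 2, hence the two directions of the
  walk.\<close>

lemma p_up_reflect:
  assumes "0 < r" "r < 3 ^ l" "0 < q"
  shows "p_up p (3 ^ l * q - r) = p_down p r"
proof -
  obtain m y where y: "r = 3 ^ m * y" "\<not> 3 dvd y" using not_dvd3_decomp[OF assms(1)] by auto
  have "y \<ge> 1" using assms y by (cases y) auto
  then have "3 ^ m \<le> r" unfolding y(1) by simp
  then have "(3::nat) ^ m < 3 ^ l" using assms(2) by linarith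
  then have "m < l" by simp
  then have l: "3 ^ l = (3::nat) ^ m * 3 ^ (l - m)" and "3 dvd (3::nat) ^ (l - m)" by (simp_all flip: power_add)
  then obtain e where e: "3 ^ (l - m) = 3 * (e::nat)" by blast
  have eq: "3 ^ l * q - r = 3 ^ m * (3 * (e * q) - y)"
    unfolding l e y(1) by (simp add: right_diff_distrib' mult_ac)
  have "3 ^ m * y < 3 ^ m * (3 * e)" using assms(2) unfolding l e y(1) .
  then have "y < 3 * e" by simp
  moreover have "3 * e \<le> 3 * (e * q)" using assms(3) by simp
  ultimately have lt: "y < 3 * (e * q)" by linarith
  have nd: "\<not> 3 dvd 3 * (e * q) - y" using y(2) lt by presburger
  have "(y + (3 * (e * q) - y)) mod 3 = 0" using lt by simp
  then have "(3 * (e * q) - y) mod 3 = 1 \<longleftrightarrow> y mod 3 \<noteq> 1"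
    using y(2) unfolding dvd_eq_mod_eq_0 by presburger
  then show ?thesis unfolding eq p_up_pow3_mult[OF nd] using y by (auto simp: p_down_pow3_mult)
qed

lemma p_down_shift:
  assumes "0 < r" "r < 3 ^ l"
  shows "p_down p (3 ^ l * q + r) = p_down p r"
  using p_up_shift[OF assms, of p q] assms by (simp add: p_down_def)

lemma p_down_reflect:
  assumes "0 < r" "r < 3 ^ l" "0 < q"
  shows "p_down p (3 ^ l * q - r) = p_up p r"
proof -
  have "r < 3 ^ l * q" using assms by (metis dual_order.strict_trans1 mult_le_mono2 nat_mult_1_right Suc_leI One_nat_def)
  then show ?thesis using p_up_reflect[OF assms, of p] assms by (simp add: p_down_def)
qed

declare revm.simps(2) [simp del]

lemma revm_eq_jweight: "revm p = jweight (p_up p) (p_down p)"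
proof
  fix x show "revm p x = jweight (p_up p) (p_down p) x" by (induction x) (simp_all add: jweight.simps(2) revm.simps(2))
qed

locale walk = delta_map p for p :: real + fixes V :: "nat \<Rightarrow> real"
begin

lemma p_up_pos: "0 < p_up p x"
  using p_pos p_less by (auto simp: p_up_def)

lemma p_down_pos: "0 < x \<Longrightarrow> 0 < p_down p x"
  using p_pos p_less by (auto simp: p_up_def p_down_def)

lemma p_up_le_1: "p_up p x \<le> 1" and p_down_le_1: "p_down p x \<le> 1"
  using p_pos p_less by (auto simp: p_up_def p_down_def)

sublocale jacobi "p_up p" "p_down p" V
  by unfold_locales (auto simp: p_up_pos p_down_pos)

lemma jac_eq: "jac p V f x = of_real (V x) * f x - of_real (p_down p x) * f (x - 1) - of_real (p_up p x) * f (x + 1)"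
  by (simp add: jac_def)

lemma revm_pos: "0 < revm p x"
  by (simp add: revm_eq_jweight w_pos)

lemma revm_Suc: "revm p (Suc x) * p_down p (Suc x) = revm p x * p_up p x"
  using w_Suc by (simp add: revm_eq_jweight)

text \<open>Across a block of length 3 the rates inside the block contribute 1 / (1 - p), 1 and 1 -
  p, whose product is 1, so only the coarse rates survive.\<close>

lemma revm_triple: "revm p (3 * x) = revm p x"
proof (induction x)
  case (Suc x)
  have s: "Suc (3 * x) = 3 * x + 1" "Suc (3 * x + 1) = 3 * x + 2" "3 * Suc x = Suc (3 * x + 2)" by simp_all
  have 1: "revm p (3 * x + 1) * (1 - p) = revm p (3 * x) * p_up p x"
    using revm_Suc[of "3 * x"] unfolding s(1) p_down_1 p_up_triple .
  have 2: "revm p (3 * x + 2) * p = revm p (3 * x + 1) * p"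
    using revm_Suc[of "3 * x + 1"] unfolding s(2) p_down_2 p_up_1 .
  have 3: "revm p (3 * Suc x) * p_down p (Suc x) = revm p (3 * x + 2) * (1 - p)"
    using revm_Suc[of "3 * x + 2"] unfolding s(3)[symmetric] p_down_triple p_up_2 .
  have "revm p (3 * Suc x) * p_down p (Suc x) = revm p (Suc x) * p_down p (Suc x)"
    using 1 2 3 p_pos Suc revm_Suc[of x] by simp
  then show ?case using p_down_pos[of "Suc x"] by simp
qed simp

text \<open>The weight does not decay along the powers of 3. Square-summability therefore bounds a
  function at these points, while equal nonzero values there have infinite mass.\<close>

lemma revm_pow3: "revm p (3 ^ j) = 1 / (1 - p)"
proof (induction j)
  case 0
  have "p_down p 1 = 1 - p" using p_down_1[of p 0] by simp
  then show ?case by (simp add: revm.simps(2))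
next
  case (Suc j)
  then show ?case using revm_triple[of "3 ^ j"] by simp
qed

end

section \<open>Tripling and the iterated decimation polynomial\<close>

context delta_map
begin

sublocale Lap: walk p lap_pot
  by unfold_locales

abbreviation "Q \<equiv> jpoly (p_up p) (p_down p) lap_pot"

text \<open>Eliminating the two inner vertices of a block of length 3 multiplies by
  \<open>(1 - z)\<^sup>2 - p\<^sup>2\<close> without ever dividing by it, so the identity also holds at the
  Dirichlet eigenvalues.\<close>

lemma Q_triple: "poly (Q (3 * j)) z = poly (Q j) (D z)"
proof -
  let ?f = "\<lambda>x. poly (Q x) z"
  have rec: "of_real (p_up p x) * ?f (Suc x) = (1 - z) * ?f x - of_real (p_down p x) * ?f (x - 1)" for x
    using Lap.P_rec[of x z] by (simp add: lap_pot_def)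
  let ?pc = "complex_of_real p"
  have k0: "complex_of_real \<kappa> \<noteq> 0" using \<kappa>_pos by simp
  let ?E = "(1 - z)\<^sup>2 - ?pc\<^sup>2"
  \<comment> \<open>Cramer's rule for the two inner equations of a block; \<open>?E\<close> is the
    determinant.\<close>
  have right: "?E * ?f (3 * x + 1) = (1 - z) * (1 - ?pc) * ?f (3 * x) + of_real \<kappa> * ?f (3 * (x + 1))"
    and left: "?E * ?f (3 * x + 2) = of_real \<kappa> * ?f (3 * x) + (1 - z) * (1 - ?pc) * ?f (3 * (x + 1))" for x
  proof -
    have s: "Suc (3 * x + 1) = 3 * x + 2" "Suc (3 * x + 2) = 3 * (x + 1)" "3 * x + 1 - 1 = 3 * x" "3 * x + 2 - 1 = 3 * x + 1"
      by simp_all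
    have a: "?pc * ?f (3 * x + 2) = (1 - z) * ?f (3 * x + 1) - (1 - ?pc) * ?f (3 * x)"
      using rec[of "3 * x + 1"] unfolding s p_up_1 p_down_1 by simp
    have b: "(1 - ?pc) * ?f (3 * (x + 1)) = (1 - z) * ?f (3 * x + 2) - ?pc * ?f (3 * x + 1)"
      using rec[of "3 * x + 2"] unfolding s p_up_2 p_down_2 by simp
    have k: "of_real \<kappa> = ?pc * (1 - ?pc)" by (simp add: \<kappa>_def)
    have "of_real \<kappa> * ?f (3 * (x + 1)) = (1 - z) * (?pc * ?f (3 * x + 2)) - ?pc\<^sup>2 * ?f (3 * x + 1)"
      unfolding k mult.assoc b by (simp add: algebra_simps power2_eq_square)
    then show "?E * ?f (3 * x + 1) = (1 - z) * (1 - ?pc) * ?f (3 * x) + of_real \<kappa> * ?f (3 * (x + 1))"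
      unfolding a by (simp add: algebra_simps power2_eq_square)
    have "of_real \<kappa> * ?f (3 * x) = ?pc * ((1 - ?pc) * ?f (3 * x))" unfolding k by simp
    also have "(1 - ?pc) * ?f (3 * x) = (1 - z) * ?f (3 * x + 1) - ?pc * ?f (3 * x + 2)" using a by simp
    also have "?pc * ((1 - z) * ?f (3 * x + 1) - ?pc * ?f (3 * x + 2)) = (1 - z) * (?pc * ?f (3 * x + 1)) - ?pc\<^sup>2 * ?f (3 * x + 2)"
      by (simp add: algebra_simps power2_eq_square)
    also have "?pc * ?f (3 * x + 1) = (1 - z) * ?f (3 * x + 2) - (1 - ?pc) * ?f (3 * (x + 1))" using b by simp
    finally show "?E * ?f (3 * x + 2) = of_real \<kappa> * ?f (3 * x) + (1 - z) * (1 - ?pc) * ?f (3 * (x + 1))"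
      by (simp add: algebra_simps power2_eq_square)
  qed
  \<comment> \<open>The diagonal coefficient left by the elimination is \<kappa> times
    \<open>1 - D z\<close>; this is how the cubic \<open>R_Delta p\<close> arises.\<close>
  have D1: "of_real \<kappa> * (1 - D z) = (1 - z) * (?E - (1 - ?pc))"
  proof -
    have "of_real \<kappa> * (1 - D z) = - ((z - 1) * ((z - 1)\<^sup>2 - 1 + of_real \<kappa>))" using k0 by (simp add: D_eq)
    also have "\<dots> = (1 - z) * (?E - (1 - ?pc))" by (simp add: \<kappa>_def power2_eq_square algebra_simps)
    finally show ?thesis .
  qed
  have "of_real (p_up p x) * ?f (3 * Suc x) = (of_real (lap_pot x) - D z) * ?f (3 * x) - of_real (p_down p x) * ?f (3 * (x - 1))" for x
  proof -
    have ud: "of_real (p_up p x) + of_real (p_down p x) = (1::complex)"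
      using p_up_plus_p_down[of p x] by (metis of_real_1 of_real_add)
    have "of_real (p_up p x) * ?f (3 * x + 1) + of_real (p_down p x) * ?f (3 * x - 1) = (1 - z) * ?f (3 * x)"
      using rec[of "3 * x"] unfolding p_up_triple p_down_triple by (simp add: algebra_simps)
    from arg_cong[OF this, of "\<lambda>v. ?E * v"]
    have e1: "of_real (p_up p x) * (?E * ?f (3 * x + 1)) + of_real (p_down p x) * (?E * ?f (3 * x - 1)) = ?E * ((1 - z) * ?f (3 * x))"
      by (simp only: distrib_left mult.left_commute[of ?E])
    have e2: "of_real (p_down p x) * (?E * ?f (3 * x - 1)) = of_real (p_down p x) * (of_real \<kappa> * ?f (3 * (x - 1)) + (1 - z) * (1 - ?pc) * ?f (3 * x))"
    proof (cases x)
      case (Suc y)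
      have s: "3 * x - 1 = 3 * y + 2" "x - 1 = y" "y + 1 = x" using Suc by simp_all
      show ?thesis using left[of y] unfolding s by simp
    qed simp
    from e1 have "of_real (p_up p x) * ((1 - z) * (1 - ?pc) * ?f (3 * x) + of_real \<kappa> * ?f (3 * (x + 1)))
        + of_real (p_down p x) * (of_real \<kappa> * ?f (3 * (x - 1)) + (1 - z) * (1 - ?pc) * ?f (3 * x)) = ?E * ((1 - z) * ?f (3 * x))"
      unfolding right e2 .
    then have "of_real \<kappa> * (of_real (p_up p x) * ?f (3 * (x + 1)) + of_real (p_down p x) * ?f (3 * (x - 1)))
        = ?E * ((1 - z) * ?f (3 * x)) - (of_real (p_up p x) + of_real (p_down p x)) * ((1 - z) * (1 - ?pc) * ?f (3 * x))"
      by (simp add: algebra_simps)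
    also have "\<dots> = of_real \<kappa> * ((1 - D z) * ?f (3 * x))"
      unfolding ud mult.assoc[symmetric] D1 by (simp add: algebra_simps)
    finally have "of_real (p_up p x) * ?f (3 * (x + 1)) + of_real (p_down p x) * ?f (3 * (x - 1)) = (1 - D z) * ?f (3 * x)"
      using k0 by (simp only: mult_cancel_left simp_thms)
    then show ?thesis by (simp add: lap_pot_def algebra_simps)
  qed
  from Lap.P_unique[of j "\<lambda>x. ?f (3 * x)" "D z" j, OF this] show ?thesis by simp
qed

lemma Q_pow3: "poly (Q (3 ^ j)) z = 1 - (D ^^ j) z"
proof (induction j arbitrary: z)
  case 0
  show ?case by (simp add: jpoly.simps(2) lap_pot_def)
next
  case (Suc j)
  then show ?case using Q_triple[of "3 ^ j" z] by (simp add: funpow_swap1)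
qed

text \<open>The map \<open>D ^^ m\<close> after \<open>R\<close>, kept as a polynomial so that its
  degree and its root multiset are available.\<close>

definition W :: "complex poly \<Rightarrow> nat \<Rightarrow> complex poly" where
  "W R m = ((\<lambda>r. pcompose (R_Delta p) r) ^^ m) R"

lemma W_0: "W R 0 = R" and W_Suc: "W R (Suc m) = pcompose (R_Delta p) (W R m)"
  by (simp_all add: W_def)

lemma poly_W: "poly (W R m) z = (D ^^ m) (poly R z)"
  by (induction m) (simp_all add: W_0 W_Suc poly_pcompose D_def)

lemma degree_R_Delta: "degree (R_Delta p) = 3"
proof -
  have c: "complex_of_real (1 / (p * (1 - p))) \<noteq> 0" using p_pos p_less by simp
  show ?thesis unfolding R_Delta_def degree_smult_eq using c by (simp add: degree_mult_eq)
qed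

lemma degree_W: "degree (W R m) = 3 ^ m * degree R"
  by (induction m) (simp_all add: W_0 W_Suc degree_R_Delta degree_pcompose)

end

section \<open>From the Schur complement identity to a polynomial identity\<close>

context walk
begin

text \<open>For a Dirichlet solution the imaginary Green identity equates \<open>Im z\<close> times
  the squared norm with a boundary term, which is zero since the last vertex is coarse.\<close>

lemma nonreal_dirichlet_regular:
  assumes "Im z \<noteq> 0" "n \<le> l"
  shows "dirichlet_regular p V n l z"
  unfolding dirichlet_regular_def
proof (intro allI impI, elim conjE)
  fix f :: "nat \<Rightarrow> complex" and y
  let ?M = "3 ^ l :: nat"
  assume out: "\<forall>x. x \<notin> non_coarse n l \<longrightarrow> f x = 0"
    and eq: "\<forall>x\<in>non_coarse n l. jac_trunc p V (3 ^ l) f x - z * f x = 0"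
  have "3 ^ l = 3 ^ n * (3::nat) ^ (l - n)" using assms(2) by (simp flip: power_add)
  then have M: "?M \<notin> non_coarse n l" by (auto simp: non_coarse_def coarse_def)
  have "w x * Im (cnj (f x) * (of_real (V x) * f x - of_real (p_down p x) * f (x - 1) - of_real (p_up p x) * f (x + 1)))
      = Im z * (w x * (cmod (f x))\<^sup>2)" for x
  proof (cases "x \<in> non_coarse n l")
    case True
    then have "x \<noteq> ?M" using M by blast
    then have "jac p V f x = z * f x" using bspec[OF eq True] by (simp add: jac_trunc_def)
    then show ?thesis unfolding jac_eq[symmetric] cmod_power2 by (simp add: power2_eq_square algebra_simps)
  qed (use out in simp)
  then have "(\<Sum>x\<le>?M. Im z * (w x * (cmod (f x))\<^sup>2)) = 0"
    using green_Im[of f ?M] out M by (simp only: complex_cnj_zero mult_zero_left zero_complex.simps mult_zero_right simp_thms)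
  then have "(\<Sum>x\<le>?M. w x * (cmod (f x))\<^sup>2) = 0"
    using assms(1) by (simp flip: sum_distrib_left)
  then have "\<forall>x\<in>{..?M}. w x * (cmod (f x))\<^sup>2 = 0"
    by (subst (asm) sum_nonneg_eq_0_iff) (auto simp: w_pos less_imp_le)
  then have "f x = 0" if "x \<le> ?M" for x using w_pos[of x] that by (metis atMost_iff less_irrefl mult_eq_0_iff norm_eq_zero zero_eq_power2)
  moreover have "f x = 0" if "\<not> x \<le> ?M" for x using out that by (auto simp: non_coarse_def)
  ultimately show "f y = 0" by blast
qed

text \<open>Insert the solution itself into the Schur identity: its coarse rows before the last one
  vanish, so where \<phi> is nonzero its restriction to the multiples of \<open>3 ^ n\<close> solves
  the Laplacian recurrence at \<open>poly R z\<close>. This determines the value at the last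
  vertex.\<close>

lemma spectral_decimation_P:
  assumes dec: "spectral_decimation_function p V n R"
  shows "P (3 ^ (n + m)) = 1 - W R m"
proof -
  from dec obtain \<phi> :: "complex \<Rightarrow> complex" where fin: "finite {z. \<phi> z = 0}"
    and \<phi>': "\<forall>l\<ge>n. \<forall>z. dirichlet_regular p V n l z \<longrightarrow>
      (\<forall>f. (\<forall>x>3 ^ l. f x = 0) \<and> (\<forall>x\<in>non_coarse n l. jac_trunc p V (3 ^ l) f x - z * f x = 0) \<longrightarrow>
        (\<forall>j\<le>3 ^ (l - n). jac_trunc p V (3 ^ l) f (3 ^ n * j) - z * f (3 ^ n * j)
        = \<phi> z * (jac_trunc p lap_pot (3 ^ (l - n)) (\<lambda>i. f (3 ^ n * i)) j - poly R z * f (3 ^ n * j))))"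
    unfolding spectral_decimation_function_def by (elim exE conjE)
  have \<phi>: "jac_trunc p V (3 ^ l) f (3 ^ n * j) - z * f (3 ^ n * j)
        = \<phi> z * (jac_trunc p lap_pot (3 ^ (l - n)) (\<lambda>i. f (3 ^ n * i)) j - poly R z * f (3 ^ n * j))"
    if "n \<le> l" "dirichlet_regular p V n l z" "\<forall>x>3 ^ l. f x = 0"
      "\<forall>x\<in>non_coarse n l. jac_trunc p V (3 ^ l) f x - z * f x = 0" "j \<le> 3 ^ (l - n)" for l z f j
    using \<phi>' that by simp
  let ?N = "3 ^ (n + m) :: nat"
  have "poly (P ?N) z = poly (1 - W R m) z" if z: "Im z \<noteq> 0" "\<phi> z \<noteq> 0" for z
  proof -
    \<comment> \<open>Cut off beyond the last vertex, as the identity demands; the rows at x <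
      \<open>?N\<close> do not see the cut.\<close>
    define f where "f x = (if x \<le> ?N then poly (P x) z else 0)" for x
    have sol: "jac_trunc p V ?N f x - z * f x = 0" if "x < ?N" for x
    proof -
      have "f (x - 1) = poly (P (x - 1)) z" "f x = poly (P x) z" "f (x + 1) = poly (P (Suc x)) z"
        using that by (auto simp: f_def)
      then show ?thesis using P_rec[of x z] that by (simp add: jac_trunc_def jac_eq algebra_simps)
    qed
    have nc: "x < ?N" if "x \<in> non_coarse n (n + m)" for x
    proof -
      have "?N \<in> coarse n (n + m)" by (auto simp: coarse_def power_add)
      then have "x \<noteq> ?N" "x \<le> ?N" using that by (auto simp: non_coarse_def)
      then show ?thesis by simp
    qed
    have 1: "\<forall>x>3 ^ (n + m). f x = 0" by (auto simp: f_def)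
    have 2: "\<forall>x\<in>non_coarse n (n + m). jac_trunc p V (3 ^ (n + m)) f x - z * f x = 0" using sol nc by blast
    have "of_real (p_up p j) * f (3 ^ n * Suc j) = (of_real (lap_pot j) - poly R z) * f (3 ^ n * j) - of_real (p_down p j) * f (3 ^ n * (j - 1))"
      if j: "j < 3 ^ m" for j
    proof -
      have "3 ^ n * j < ?N" using j by (simp add: power_add)
      then have "\<phi> z * (jac_trunc p lap_pot (3 ^ m) (\<lambda>i. f (3 ^ n * i)) j - poly R z * f (3 ^ n * j)) = 0"
        using \<phi>[of "n + m" z f j, OF _ nonreal_dirichlet_regular[OF z(1)] 1 2] j sol by simp
      then have "jac p lap_pot (\<lambda>i. f (3 ^ n * i)) j = poly R z * f (3 ^ n * j)"
        using z(2) j by (simp add: jac_trunc_def)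
      then show ?thesis unfolding Lap.jac_eq by (simp add: algebra_simps)
    qed
    from Lap.P_unique[of "3 ^ m" "\<lambda>j. f (3 ^ n * j)" "poly R z" "3 ^ m", OF this]
    have "f ?N = poly (Q (3 ^ m)) (poly R z)" by (simp add: power_add f_def)
    then show ?thesis by (simp add: f_def Q_pow3 poly_W)
  qed
  then have "- (\<real> \<union> {z. \<phi> z = 0}) \<subseteq> {z. poly (P ?N - (1 - W R m)) z = 0}"
    by (auto simp: complex_is_Real_iff)
  \<comment> \<open>The imaginary axis alone supplies infinitely many non-real points, and only
    finitely many of them are zeros of \<phi>.\<close>
  moreover have "infinite (- (\<real> \<union> {z. \<phi> z = 0}))"
  proof -
    have "infinite (range (\<lambda>t. Complex 0 (real (Suc t))))"
      by (rule range_inj_infinite) (auto simp: inj_on_def)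
    then have "infinite (range (\<lambda>t. Complex 0 (real (Suc t))) - {z. \<phi> z = 0})" using fin by simp
    then show ?thesis by (rule infinite_super[rotated]) (auto simp: complex_is_Real_iff)
  qed
  ultimately have "P ?N - (1 - W R m) = 0" using poly_roots_finite finite_subset by blast
  then show ?thesis by simp
qed

end

section \<open>Eigenvalues of the truncations\<close>

lemma le_prod_mset_image:
  fixes f :: "'a \<Rightarrow> real"
  assumes "0 \<le> a" "\<And>w. w \<in># M \<Longrightarrow> a \<le> f w"
  shows "a ^ size M \<le> (\<Prod>w\<in>#M. f w)"
  using assms(2)
proof (induction M)
  case (add x M)
  then have "a ^ size M \<le> (\<Prod>w\<in>#M. f w)" "a \<le> f x" by auto
  then show ?case using assms(1) by (auto intro!: mult_mono intro: order.trans)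
qed simp

lemma proots_image_cmod:
  "cmod (poly R c) = cmod (lead_coeff R) * (\<Prod>w\<in>#proots R. cmod (c - w))"
proof -
  have "poly R c = lead_coeff R * poly (\<Prod>w\<in>#proots R. [:-w, 1:]) c"
    by (subst complex_poly_decompose_multiset[symmetric]) (simp only: poly_smult)
  also have "poly (\<Prod>w\<in>#proots R. [:-w, 1:]) c = (\<Prod>w\<in>#proots R. c - w)"
    by (induction "proots R") (auto simp: poly_prod_mset image_mset.compositionality o_def)
  also have "cmod (lead_coeff R * (\<Prod>w\<in>#M. c - w)) = cmod (lead_coeff R) * (\<Prod>w\<in>#M. cmod (c - w))" for M
    by (induction M) (auto simp: norm_mult)
  finally show ?thesis .
qed

text \<open>The modulus of \<open>poly R c - x\<close> is that of the leading coefficient times the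
  product of the distances from c to the roots, and the smallest distance is at most their geometric
  mean. This is a quantitative continuity of roots.\<close>

lemma exists_close_root:
  fixes R :: "complex poly"
  assumes "0 < degree R"
  shows "\<exists>w. poly R w = x \<and> cmod (lead_coeff R) * cmod (c - w) ^ degree R \<le> cmod (poly R c - x)"
proof -
  let ?R = "R - [:x:]"
  have deg: "degree ?R = degree R" using degree_add_eq_left[of "- [:x:]" R] assms unfolding diff_conv_add_uminus by simp
  have lc: "lead_coeff ?R = lead_coeff R" unfolding deg using assms by (cases "degree R") (auto simp: coeff_pCons)
  have nz: "?R \<noteq> 0" using deg assms by auto
  have roots: "set_mset (proots ?R) = {w. poly R w = x}" using nz by simp
  have size: "size (proots ?R) = degree R" by (simp add: size_proots_complex deg)
  then have "proots ?R \<noteq> {#}" using assms by auto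
  then have ne: "set_mset (proots ?R) \<noteq> {}" by simp
  obtain w where w: "w \<in># proots ?R" "\<And>v. v \<in># proots ?R \<Longrightarrow> cmod (c - w) \<le> cmod (c - v)"
    using arg_min_if_finite[of "set_mset (proots ?R)" "\<lambda>v. cmod (c - v)"] ne by (metis finite_set_mset not_le)
  have "cmod (lead_coeff R) * cmod (c - w) ^ degree R \<le> cmod (lead_coeff R) * (\<Prod>v\<in>#proots ?R. cmod (c - v))"
    unfolding size[symmetric] using w(2) by (intro mult_left_mono le_prod_mset_image) auto
  also have "\<dots> = cmod (poly ?R c)" unfolding proots_image_cmod[of ?R c] lc ..
  finally show ?thesis using w(1) roots by (intro exI[of _ w]) auto
qed

text \<open>The potential enters through its period and its evenness about the multiples of
  \<open>3 ^ n\<close>, together with the outcome of decimation. The Laplacian fits as well, with n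
  = 0 and \<open>R\<close> the identity.\<close>

locale decimated = walk p V for p :: real and V :: "nat \<Rightarrow> real" +
  fixes n :: nat and R :: "complex poly"
  assumes V_shift: "V (3 ^ n * k + r) = V r"
    and V_reflect: "r \<le> 3 ^ n * k \<Longrightarrow> V (3 ^ n * k - r) = V r"
    and degree_R: "0 < degree R"
    and P_pow3: "P (3 ^ (n + m)) = 1 - W R m"
begin

definition F :: "complex set" where "F = {z. poly R z \<in> filled_julia (R_Delta p)}"

lemma poly_P_pow3: "poly (P (3 ^ (n + m))) z = 1 - (D ^^ m) (poly R z)"
  by (simp add: P_pow3 poly_W)

lemma closed_F: "closed F"
proof -
  have "F = poly R -` filled_julia (R_Delta p)" by (auto simp: F_def)
  then show ?thesis by (auto intro!: continuous_closed_vimage closed_filled_julia)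
qed

lemma F_iff_bounded: "z \<in> F \<longleftrightarrow> bounded (range (\<lambda>m. poly (P (3 ^ (n + m))) z))"
proof -
  have "bounded (range (\<lambda>m. poly (P (3 ^ (n + m))) z)) \<longleftrightarrow> bounded (range (\<lambda>m. (D ^^ m) (poly R z)))" (is "?l \<longleftrightarrow> ?r")
  proof -
    have l: "range (\<lambda>m. poly (P (3 ^ (n + m))) z) = (\<lambda>y. 1 - y) ` range (\<lambda>m. (D ^^ m) (poly R z))"
      by (auto simp: poly_P_pow3)
    have r: "range (\<lambda>m. (D ^^ m) (poly R z)) = (\<lambda>y. 1 - y) ` range (\<lambda>m. poly (P (3 ^ (n + m))) z)"
      by (auto simp: poly_P_pow3 image_image)
    have "bounded ((\<lambda>y. 1 - y) ` A)" if A: "bounded A" for A :: "complex set"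
    proof -
      obtain C where "\<forall>y\<in>A. cmod y \<le> C" using A by (auto simp: bounded_iff)
      then have "cmod (1 - y) \<le> 1 + C" if "y \<in> A" for y
        using norm_triangle_ineq4[of 1 y] that by fastforce
      then show ?thesis by (auto simp: bounded_iff)
    qed
    then show ?thesis using l r by metis
  qed
  then show ?thesis by (simp add: F_def filled_julia_def D_def)
qed

lemma bounded_F: "bounded F"
proof -
  obtain r where r: "\<And>z. r \<le> cmod z \<Longrightarrow> 3 \<le> cmod (poly R z)"
  proof (cases R)
    case (pCons a R')
    then have "R' \<noteq> 0" using degree_R by auto
    then show ?thesis using poly_infinity[of R' 3 a] pCons that by blast
  qed
  have "cmod z \<le> r" if z: "z \<in> F" for z
  proof (rule ccontr)
    assume "\<not> cmod z \<le> r"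
    then have "3 \<le> cmod (poly R z)" using r by simp
    moreover obtain x where "x \<in> {0..2}" "poly R z = of_real x"
      using z filled_julia_real[of "poly R z"] unfolding F_def by blast
    ultimately show False by simp
  qed
  then show ?thesis by (auto simp: bounded_iff)
qed

text \<open>Encodes the reflecting row: with both rates at N equal to 1, the eigenvalue equation at
  N says that the modified \<open>P (Suc N)\<close> vanishes, so the theory of zeros applies to the
  truncated operator.\<close>

lemma jacobi_trunc: "0 < N \<Longrightarrow> jacobi ((p_up p)(N := 1)) ((p_down p)(N := 1))"
  by unfold_locales (auto simp: p_up_pos p_down_pos)

lemma P_trunc: "x \<le> N \<Longrightarrow> jpoly ((p_up p)(N := 1)) ((p_down p)(N := 1)) V x = P x"
  by (rule jpoly_cong) auto

lemma trunc_spectrum_P: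
  assumes "0 < N"
  shows "trunc_spectrum p V N = {z. (of_real (V N) - z) * poly (P N) z = poly (P (N - 1)) z}"
proof (intro set_eqI iffI; clarsimp simp: trunc_spectrum_def)
  fix c :: complex and f x assume "x \<le> N" "f x \<noteq> 0" and eq: "\<forall>x\<le>N. jac_trunc p V N f x = c * f x"
  have f: "f y = f 0 * poly (P y) c" if "y \<le> N" for y
  proof (rule P_unique[OF _ that])
    show "of_real (p_up p x) * f (Suc x) = (of_real (V x) - c) * f x - of_real (p_down p x) * f (x - 1)" if "x < N" for x
      using spec[OF eq, of x] that by (simp add: jac_trunc_def jac_eq algebra_simps)
  qed
  have "f 0 \<noteq> 0" using f[OF \<open>x \<le> N\<close>] \<open>f x \<noteq> 0\<close> by auto
  moreover have "(of_real (V N) - c) * f N = f (N - 1)"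
    using spec[OF eq, of N] by (simp add: jac_trunc_def algebra_simps)
  ultimately show "(of_real (V N) - c) * poly (P N) c = poly (P (N - Suc 0)) c"
    using f[of N] f[of "N - 1"] by simp
next
  fix c :: complex assume c: "(of_real (V N) - c) * poly (P N) c = poly (P (N - Suc 0)) c"
  show "\<exists>f. (\<exists>x\<le>N. f x \<noteq> 0) \<and> (\<forall>x\<le>N. jac_trunc p V N f x = c * f x)"
  proof (intro exI[of _ "\<lambda>x. poly (P x) c"] conjI allI impI)
    show "\<exists>x\<le>N. poly (P x) c \<noteq> 0" by (rule exI[of _ 0]) simp
    fix x assume "x \<le> N"
    then show "jac_trunc p V N (\<lambda>x. poly (P x) c) x = c * poly (P x) c"
      using c P_rec[of x c] by (auto simp: jac_trunc_def jac_eq algebra_simps)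
  qed
qed

lemma trunc_spectrum_eq:
  assumes "0 < N"
  shows "trunc_spectrum p V N = {z. poly (jpoly ((p_up p)(N := 1)) ((p_down p)(N := 1)) V (Suc N)) z = 0}"
proof -
  interpret T: jacobi "(p_up p)(N := 1)" "(p_down p)(N := 1)" V by (rule jacobi_trunc[OF assms])
  show ?thesis unfolding trunc_spectrum_P[OF assms]
    using T.P_rec[of N, where 'a=complex] by (auto simp: P_trunc)
qed

text \<open>An eigenfunction of a truncation continues to the half-line by successive reflections at the
  multiples of \<open>N\<close>.\<close>

lemma trunc_eigenfunction_periodic:
  assumes c: "c \<in> trunc_spectrum p V (3 ^ l)" and "n \<le> l"
  defines "N \<equiv> 3 ^ l"
  shows "poly (P x) c = poly (P (if x mod (2 * N) \<le> N then x mod (2 * N) else 2 * N - x mod (2 * N))) c"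
proof -
  have N0: "0 < N" by (simp add: N_def)
  define \<rho> where "\<rho> x = (if x mod (2 * N) \<le> N then x mod (2 * N) else 2 * N - x mod (2 * N))" for x
  let ?f = "\<lambda>x. poly (P (\<rho> x)) c"
  have end_eq: "(of_real (V N) - c) * poly (P N) c = poly (P (N - 1)) c"
    using c N0 by (auto simp: trunc_spectrum_P N_def)
  have N: "N = 3 ^ n * 3 ^ (l - n)" using assms(2) by (simp add: N_def flip: power_add)
  have V1: "V (N * q + r) = V r" for q r
    using V_shift[of "3 ^ (l - n) * q" r] by (simp add: N mult.assoc)
  have V2: "V (N * q - r) = V r" if "r \<le> N * q" for q r
    using V_reflect[of r "3 ^ (l - n) * q"] that by (simp add: N mult.assoc)
  have "of_real (p_up p x) * ?f (Suc x) = (of_real (V x) - c) * ?f x - of_real (p_down p x) * ?f (x - 1)" for x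
  proof -
    define k where "k = x div (2 * N)"
    define r where "r = x mod (2 * N)"
    have x: "x = 2 * N * k + r" by (simp add: k_def r_def)
    have r: "r < 2 * N" using N0 by (simp add: r_def)
    have modeq: "(2 * N * k + s) mod (2 * N) = s" if "s < 2 * N" for k s using that by simp
    have \<rho>: "\<rho> (2 * N * k + s) = (if s \<le> N then s else 2 * N - s)" if "s < 2 * N" for s
      using modeq[OF that] by (simp add: \<rho>_def)
    have \<rho>2: "\<rho> (2 * N * k + s) = 2 * N - s" if "N \<le> s" "s \<le> 2 * N" for s
    proof (cases "s = 2 * N")
      case True
      have "2 * N * k + s = 2 * N * Suc k" using True by simp
      then have "(2 * N * k + s) mod (2 * N) = 0" by (metis mod_mult_self1_is_0)
      then show ?thesis using True by (simp add: \<rho>_def)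
    qed (use \<rho>[of s] that in auto)
    consider "r = 0" | "0 < r" "r < N" | "r = N" | "N < r" "r < 2 * N" using r by linarith
    then show ?thesis
    proof cases
      case 1
      have fx: "?f x = 1" using \<rho>[of 0] N0 1 x by simp
      have "\<rho> (Suc x) = 1" using \<rho>[of 1] N0 1 x by simp
      then have f1: "?f (Suc x) = poly (P 1) c" by simp
      have Vx: "V x = V 0" using V1[of "2 * k" 0] 1 x by (simp add: ac_simps)
      have P1: "poly (P 1) c = of_real (V 0) - c" using P_rec[of 0 c] by simp
      show ?thesis
      proof (cases "k = 0")
        case True
        then have "x = 0" using 1 x by simp
        then show ?thesis using fx f1 P1 by simp
      next
        \<comment> \<open>Both neighbours of a positive even multiple of N fold to the vertex 1, so
          the two rates enter only through their sum 1.\<close>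
        case False
        then obtain k' where k': "k = Suc k'" by (cases k) auto
        have "x - 1 = 2 * N * k' + (2 * N - 1)" using 1 N0 by (simp add: x k')
        moreover have "(2 * N * k' + (2 * N - 1)) mod (2 * N) = 2 * N - 1" using N0 by (intro modeq) simp
        ultimately have "\<rho> (x - 1) = 1" using N0 by (cases "N = 1") (auto simp: \<rho>_def)
        then have f2: "?f (x - 1) = poly (P 1) c" by simp
        have ud: "of_real (p_up p x) = 1 - complex_of_real (p_down p x)"
          using p_up_plus_p_down[of p x] by (metis of_real_1 of_real_diff add_diff_cancel_right')
        show ?thesis unfolding fx f1 f2 Vx P1 ud by (simp add: algebra_simps)
      qed
    next
      case 2
      have a: "\<rho> x = r" "\<rho> (Suc x) = Suc r" "\<rho> (x - 1) = r - 1"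
        using \<rho>[of r] \<rho>[of "Suc r"] \<rho>[of "r - 1"] 2 x by auto
      have e: "x = N * (2 * k) + r" using x by simp
      have b: "V x = V r" "p_up p x = p_up p r" "p_down p x = p_down p r"
        unfolding e V1 using p_up_shift[OF 2(1) 2(2)[unfolded N_def], of p "2 * k"]
          p_down_shift[OF 2(1) 2(2)[unfolded N_def], of p "2 * k"] by (simp_all add: N_def)
      show ?thesis unfolding a b by (rule P_rec)
    next
      \<comment> \<open>At an odd multiple of N both neighbours fold to N - 1, and the reflecting
        row of the truncation takes the place of row 0.\<close>
      case 3
      have a: "\<rho> x = N" "\<rho> (Suc x) = N - 1" "\<rho> (x - 1) = N - 1"
        using \<rho>[of N] \<rho>2[of "Suc N"] \<rho>[of "N - 1"] 3 x N0 by auto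
      have e: "x = N * (2 * k) + N" using x 3 by simp
      have b: "V x = V N" unfolding e by (rule V1)
      have ud: "of_real (p_up p x) = 1 - complex_of_real (p_down p x)"
        using p_up_plus_p_down[of p x] by (metis of_real_1 of_real_diff add_diff_cancel_right')
      show ?thesis unfolding a b ud end_eq by (simp add: algebra_simps)
    next
      case 4
      \<comment> \<open>On the way back the neighbours are interchanged; reflection also swaps
        \<open>p_up\<close> and \<open>p_down\<close>, which restores the recurrence at s.\<close>
      define s where "s = 2 * N - r"
      have s: "0 < s" "s < N" using 4 by (auto simp: s_def)
      have a: "\<rho> x = s" "\<rho> (Suc x) = s - 1" "\<rho> (x - 1) = Suc s"
        using \<rho>2[of r] \<rho>2[of "Suc r"] \<rho>2[of "r - 1"] 4 x by (auto simp: s_def)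
      have e: "x = N * (2 * k + 2) - s" using x 4 by (simp add: s_def algebra_simps)
      have le: "s \<le> N * (2 * k + 2)" using s by simp
      have b: "V x = V s" "p_up p x = p_down p s" "p_down p x = p_up p s"
        unfolding e V2[OF le] using p_up_reflect[OF s(1) s(2)[unfolded N_def], of "2 * k + 2" p]
          p_down_reflect[OF s(1) s(2)[unfolded N_def], of "2 * k + 2" p] by (simp_all add: N_def)
      show ?thesis unfolding a b using P_rec[of s c] by (simp add: algebra_simps)
    qed
  qed
  from P_unique[of x ?f c x, OF this] show ?thesis using N0 by (simp add: \<rho>_def)
qed

text \<open>\<open>3 ^ j\<close> is an odd multiple of \<open>3 ^ l\<close>, so folding sends it to
  \<open>3 ^ l\<close>.\<close>

lemma trunc_eigenfunction_pow3:
  assumes "c \<in> trunc_spectrum p V (3 ^ l)" "n \<le> l" "l \<le> j"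
  shows "poly (P (3 ^ j)) c = poly (P (3 ^ l)) c"
proof -
  have "odd (3 ^ (j - l) :: nat)" by simp
  then obtain e where e: "3 ^ (j - l) = 2 * e + (1::nat)" by (elim oddE)
  have "3 ^ j = (3::nat) ^ l * 3 ^ (j - l)" using assms(3) by (simp flip: power_add)
  also have "\<dots> = 2 * 3 ^ l * e + 3 ^ l" unfolding e by (simp add: algebra_simps)
  finally have "3 ^ j mod (2 * 3 ^ l) = (3 ^ l :: nat)" by simp
  then show ?thesis using trunc_eigenfunction_periodic[OF assms(1,2), of "3 ^ j"] by simp
qed

lemma trunc_eigenfunction_bounded:
  assumes "c \<in> trunc_spectrum p V (3 ^ l)" "n \<le> l"
  shows "\<exists>B. \<forall>x. cmod (poly (P x) c) \<le> B"
proof -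
  let ?B = "Max ((\<lambda>x. cmod (poly (P x) c)) ` {..3 ^ l})"
  have "cmod (poly (P x) c) \<le> ?B" for x
  proof -
    have "x mod (2 * 3 ^ l) < 2 * 3 ^ l" by simp
    then show ?thesis using trunc_eigenfunction_periodic[OF assms, of x] by (auto intro!: Max_ge)
  qed
  then show ?thesis by blast
qed

text \<open>Otherwise the last row also gives a zero at N - 1, and the recurrence run downwards
  reaches \<open>P 0 = 0\<close>.\<close>

lemma trunc_eigenfunction_nz:
  assumes "c \<in> trunc_spectrum p V N" "0 < N"
  shows "poly (P N) c \<noteq> 0"
proof
  assume 0: "poly (P N) c = 0"
  then have 1: "poly (P (N - 1)) c = 0" using assms by (auto simp: trunc_spectrum_P)
  have "poly (P (N - k)) c = 0 \<and> poly (P (N - Suc k)) c = 0" if "Suc k \<le> N" for k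
    using that
  proof (induction k)
    case 0 then show ?case using \<open>poly (P N) c = 0\<close> 1 by simp
  next
    case (Suc k)
    let ?x = "N - Suc k"
    have "0 < ?x" "Suc ?x = N - k" "?x - 1 = N - Suc (Suc k)" using Suc.prems by auto
    then show ?case using P_rec[of ?x c] Suc p_down_pos[of ?x] by auto
  qed
  from this[of "N - 1"] show False using assms(2) by simp
qed

lemma trunc_spectrum_subset_F:
  assumes "n \<le> l"
  shows "trunc_spectrum p V (3 ^ l) \<subseteq> F"
proof
  fix c assume "c \<in> trunc_spectrum p V (3 ^ l)"
  from trunc_eigenfunction_bounded[OF this assms] show "c \<in> F"
    unfolding F_iff_bounded by (auto simp: bounded_iff)
qed

text \<open>Changing the rates at N alters \<open>P (Suc N)\<close> but not \<open>P N\<close>: the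
  truncated eigenvalues interlace with the zeros of the original \<open>P N\<close>.\<close>

lemma trunc_interlacing:
  assumes N: "0 < N"
  obtains a b where "strict_mono_on {..N} a" "strict_mono_on {..<N} b"
    "trunc_spectrum p V N = (\<lambda>i. complex_of_real (a i)) ` {..N}"
    "proots (P N) = mset_set ((\<lambda>i. complex_of_real (b i)) ` {..<N})"
    "\<And>i. i < N \<Longrightarrow> a i < b i" "\<And>i. i < N \<Longrightarrow> b i < a (Suc i)"
proof -
  interpret T: jacobi "(p_up p)(N := 1)" "(p_down p)(N := 1)" V by (rule jacobi_trunc[OF N])
  obtain a b :: "nat \<Rightarrow> real" where ab: "strict_mono_on {..N} a" "strict_mono_on {..<N} b"
    "\<And>i. i \<le> N \<Longrightarrow> poly (T.P (Suc N)) (a i) = 0" "\<And>i. i < N \<Longrightarrow> poly (T.P N) (b i) = 0"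
    "\<And>i. i < N \<Longrightarrow> a i < b i" "\<And>i. i < N \<Longrightarrow> b i < a (Suc i)"
    by (rule T.interlacing[of N]) blast
  have "trunc_spectrum p V N = (\<lambda>i. complex_of_real (a i)) ` {..N}"
    unfolding trunc_spectrum_eq[OF N] by (rule T.real_zeros[OF ab(1,3)])
  moreover have "proots (P N) = mset_set ((\<lambda>i. complex_of_real (b i)) ` {..<N})"
    using T.proots_P[OF ab(2,4)] by (simp only: P_trunc[OF order_refl])
  ultimately show thesis using that ab by blast
qed

lemma root_near:
  assumes "0 < \<epsilon>"
  shows "\<exists>\<delta>>0. \<forall>x. cmod (poly R c - x) < \<delta> \<longrightarrow> (\<exists>w. dist c w < \<epsilon> \<and> poly R w = x)"
proof (intro exI[of _ "cmod (lead_coeff R) * \<epsilon> ^ degree R"] conjI allI impI)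
  have lc: "0 < cmod (lead_coeff R)" using degree_R by auto
  then show "0 < cmod (lead_coeff R) * \<epsilon> ^ degree R" using assms by simp
  fix x assume x: "cmod (poly R c - x) < cmod (lead_coeff R) * \<epsilon> ^ degree R"
  obtain w where w: "poly R w = x" "cmod (lead_coeff R) * cmod (c - w) ^ degree R \<le> cmod (poly R c - x)"
    using exists_close_root[OF degree_R] by blast
  have "cmod (lead_coeff R) * cmod (c - w) ^ degree R < cmod (lead_coeff R) * \<epsilon> ^ degree R"
    using w(2) x by linarith
  then have "cmod (c - w) ^ degree R < \<epsilon> ^ degree R"
    unfolding mult_less_cancel_left_pos[OF lc] .
  then have "cmod (c - w) < \<epsilon>" using assms by (rule power_less_imp_less_base[OF _ less_imp_le])
  then show "\<exists>w. dist c w < \<epsilon> \<and> poly R w = x" using w(1) by (auto simp: dist_norm)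
qed

lemma trunc_spectrum_dense:
  assumes c: "c \<in> F" and \<epsilon>: "0 < \<epsilon>"
  shows "\<exists>l\<ge>n. \<exists>z\<in>trunc_spectrum p V (3 ^ l). dist c z < \<epsilon>"
proof -
  obtain y where y: "poly R c = of_real y" "of_real y \<in> filled_julia (R_Delta p)" "y \<in> {0..2}"
    using c filled_julia_real[of "poly R c"] unfolding F_def by (metis mem_Collect_eq)
  obtain \<delta> where \<delta>: "0 < \<delta>" "\<And>x. cmod (poly R c - x) < \<delta> \<Longrightarrow> \<exists>w. dist c w < \<epsilon> \<and> poly R w = x"
    using root_near[OF \<epsilon>] by blast
  obtain m where "pi / \<delta> < 3 ^ m" using real_arch_pow[of 3 "pi / \<delta>"] by auto
  then have m: "pi / 3 ^ m < \<delta>" using \<delta>(1) by (simp add: field_simps)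
  have near: "\<exists>w. dist c w < \<epsilon> \<and> poly R w = of_real x" if "x \<in> {0..2}" "\<bar>\<theta> x - \<theta> y\<bar> \<le> pi / 3 ^ m" for x
  proof (rule \<delta>(2))
    have "cmod (poly R c - of_real x) = \<bar>y - x\<bar>" unfolding y(1) by (simp flip: of_real_diff)
    also have "\<dots> < \<delta>" using dist_le_\<theta>[OF that(1) y(3)] that(2) m by (simp add: abs_minus_commute)
    finally show "cmod (poly R c - of_real x) < \<delta>" .
  qed
  \<comment> \<open>\<open>P (3 ^ (n + Suc m))\<close> vanishes at w exactly when
    \<open>(D ^^ Suc m) (poly R w) = 1\<close>. Two preimages of 1 in the disjoint outer laps,
    pulled back m times towards y, give two different zeros near c.\<close>
  have "(0, q) \<in> laps" "(2 - q, 2) \<in> laps" by (auto simp: laps_def)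
  then obtain t1 t2 where t: "t1 \<in> {0..q}" "Dr t1 = 1" "t2 \<in> {2-q..2}" "Dr t2 = 1"
    using Dr_lap_surj[of _ _ 1] by (metis atLeastAtMost_iff zero_le_one one_le_numeral)
  have t12: "t1 \<in> {0..2}" "t2 \<in> {0..2}" "t1 \<noteq> t2" using t q_pos q_le by auto
  obtain x1 where x1: "x1 \<in> {0..2}" "(Dr ^^ m) x1 = t1" "\<bar>\<theta> x1 - \<theta> y\<bar> \<le> pi / 3 ^ m"
    using julia_approx[OF y(2) t12(1), of m] by blast
  obtain x2 where x2: "x2 \<in> {0..2}" "(Dr ^^ m) x2 = t2" "\<bar>\<theta> x2 - \<theta> y\<bar> \<le> pi / 3 ^ m"
    using julia_approx[OF y(2) t12(2), of m] by blast
  obtain w1 w2 where w: "dist c w1 < \<epsilon>" "poly R w1 = of_real x1" "dist c w2 < \<epsilon>" "poly R w2 = of_real x2"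
    using near[OF x1(1,3)] near[OF x2(1,3)] by blast
  have "w1 \<noteq> w2" using w x1(2) x2(2) t12(3) by auto
  let ?N = "3 ^ (n + Suc m) :: nat"
  have zero: "poly (P ?N) w1 = 0" "poly (P ?N) w2 = 0"
    unfolding poly_P_pow3 w using x1(2) x2(2) t by (simp_all add: D_funpow_of_real D_of_real)
  obtain a b where ab: "strict_mono_on {..?N} a" "strict_mono_on {..<?N} b"
    "trunc_spectrum p V ?N = (\<lambda>i. complex_of_real (a i)) ` {..?N}"
    "proots (P ?N) = mset_set ((\<lambda>i. complex_of_real (b i)) ` {..<?N})"
    "\<And>i. i < ?N \<Longrightarrow> a i < b i" "\<And>i. i < ?N \<Longrightarrow> b i < a (Suc i)"
    by (rule trunc_interlacing[of ?N]) (simp, blast)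
  have "set_mset (proots (P ?N)) = (\<lambda>i. complex_of_real (b i)) ` {..<?N}"
    unfolding ab(4) by simp
  then have "{w. poly (P ?N) w = 0} = (\<lambda>i. complex_of_real (b i)) ` {..<?N}"
    by (simp only: set_count_proots P_neq_0 not_False_eq_True)
  then obtain i j where ij: "i < ?N" "w1 = of_real (b i)" "j < ?N" "w2 = of_real (b j)"
    using zero by blast
  have key: "\<exists>z\<in>trunc_spectrum p V ?N. dist c z < \<epsilon>"
    if "i < j" "j < ?N" "dist c (of_real (b i)) < \<epsilon>" "dist c (of_real (b j)) < \<epsilon>" for i j
  proof -
    have "b i < a (Suc i)" using ab(6)[of i] that by simp
    moreover have "a (Suc i) < b j"
    proof -
      have "a (Suc i) < b (Suc i)" using ab(5)[of "Suc i"] that by simp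
      also have "\<dots> \<le> b j" using ab(2) that by (cases "Suc i = j") (auto simp: strict_mono_on_def less_imp_le)
      finally show ?thesis .
    qed
    ultimately have "complex_of_real (a (Suc i)) \<in> closed_segment (of_real (b i)) (of_real (b j))"
      by (auto simp: closed_segment_of_real closed_segment_eq_real_ivl)
    \<comment> \<open>Balls are convex, so the enclosed eigenvalue is within \<epsilon> of c like
      the two zeros.\<close>
    moreover have "closed_segment (complex_of_real (b i)) (of_real (b j)) \<subseteq> ball c \<epsilon>"
      using that by (intro closed_segment_subset) auto
    ultimately have "of_real (a (Suc i)) \<in> ball c \<epsilon>" by blast
    moreover have "of_real (a (Suc i)) \<in> trunc_spectrum p V ?N" unfolding ab(3) using that by auto
    ultimately show ?thesis by auto
  qed
  have "i \<noteq> j" using ij \<open>w1 \<noteq> w2\<close> by auto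
  then have "\<exists>z\<in>trunc_spectrum p V ?N. dist c z < \<epsilon>"
    using key[of i j] key[of j i] ij w by (metis linorder_neqE_nat)
  then show ?thesis by (intro exI[of _ "n + Suc m"]) auto
qed

text \<open>Elements of \<open>F\<close> are limits of truncated eigenvalues, which are real; from
  \<open>R\<close> alone this is not visible.\<close>

lemma F_real: "F \<subseteq> \<real>"
proof
  fix c assume c: "c \<in> F"
  have "c \<in> closure \<real>"
    unfolding closure_approachable
  proof (intro allI impI)
    fix e :: real assume "0 < e"
    from trunc_spectrum_dense[OF c this] obtain l z where z: "z \<in> trunc_spectrum p V (3 ^ l)" "dist c z < e" by blast
    obtain a :: "nat \<Rightarrow> real" where "trunc_spectrum p V (3 ^ l) = (\<lambda>i. complex_of_real (a i)) ` {..3 ^ l}"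
      by (rule trunc_interlacing[of "3 ^ l"]) (simp, blast)
    then have "z \<in> \<real>" using z by auto
    then show "\<exists>y\<in>\<real>. dist y c < e" using z by (auto simp: dist_commute)
  qed
  then show "c \<in> \<real>" using closed_complex_Reals by simp
qed

end

section \<open>The spectrum on the half-line\<close>

lemma l2_cong_bound:
  assumes "f \<in> l2 p" "\<And>x. 0 \<le> revm p x" "\<And>x. cmod (g x) \<le> C * cmod (f x)"
  shows "g \<in> l2 p"
proof -
  have "summable (\<lambda>x. C\<^sup>2 * (revm p x * (cmod (f x))\<^sup>2))"
    using assms(1) by (auto simp: l2_def)
  then show ?thesis unfolding l2_def mem_Collect_eq
  proof (rule summable_comparison_test'[where N = 0])
    fix x
    have "(cmod (g x))\<^sup>2 \<le> (C * cmod (f x))\<^sup>2" using assms(3) by (intro power_mono) auto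
    then have "revm p x * (cmod (g x))\<^sup>2 \<le> revm p x * (C * cmod (f x))\<^sup>2"
      using assms(2) by (rule mult_left_mono)
    then show "norm (revm p x * (cmod (g x))\<^sup>2) \<le> C\<^sup>2 * (revm p x * (cmod (f x))\<^sup>2)"
      using assms(2)[of x] by (simp add: power_mult_distrib mult_ac)
  qed
qed

lemma cmod_add_square_le: "(cmod (a + b))\<^sup>2 \<le> 2 * (cmod a)\<^sup>2 + 2 * (cmod b)\<^sup>2"
proof -
  have "(cmod (a + b))\<^sup>2 \<le> (cmod a + cmod b)\<^sup>2" by (intro power_mono norm_triangle_ineq) auto
  also have "\<dots> \<le> 2 * (cmod a)\<^sup>2 + 2 * (cmod b)\<^sup>2"
    using zero_le_power2[of "cmod a - cmod b"] by (simp add: power2_eq_square algebra_simps)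
  finally show ?thesis .
qed

lemma l2_add:
  assumes "f \<in> l2 p" "g \<in> l2 p" "\<And>x. 0 \<le> revm p x"
  shows "(\<lambda>x. f x + g x) \<in> l2 p"
proof -
  have "summable (\<lambda>x. 2 * (revm p x * (cmod (f x))\<^sup>2) + 2 * (revm p x * (cmod (g x))\<^sup>2))"
    using assms(1,2) by (auto simp: l2_def intro!: summable_add)
  then show ?thesis unfolding l2_def mem_Collect_eq
  proof (rule summable_comparison_test'[where N = 0])
    fix x
    have "revm p x * (cmod (f x + g x))\<^sup>2 \<le> revm p x * (2 * (cmod (f x))\<^sup>2 + 2 * (cmod (g x))\<^sup>2)"
      using assms(3) cmod_add_square_le by (intro mult_left_mono)
    then show "norm (revm p x * (cmod (f x + g x))\<^sup>2) \<le> 2 * (revm p x * (cmod (f x))\<^sup>2) + 2 * (revm p x * (cmod (g x))\<^sup>2)"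
      using assms(3)[of x] by (simp add: algebra_simps)
  qed
qed

context walk
begin

lemma revm_nonneg: "0 \<le> revm p x"
  using revm_pos[of x] by simp

definition L :: "complex \<Rightarrow> (nat \<Rightarrow> complex) \<Rightarrow> nat \<Rightarrow> complex" where
  "L c f x = jac p V f x - c * f x"

lemma L_eq: "L c f x = (of_real (V x) - c) * f x - of_real (p_down p x) * f (x - 1) - of_real (p_up p x) * f (Suc x)"
  by (simp add: L_def jac_eq algebra_simps)

lemma L_diff: "L c (\<lambda>x. f x - g x) x = L c f x - L c g x"
  by (simp add: L_eq algebra_simps)

lemma L_P: "L c (\<lambda>x. poly (P x) c) x = 0"
  using P_rec[of x c] by (simp add: L_eq algebra_simps)

lemma L_eq_0: "(\<And>x. L c f x = 0) \<Longrightarrow> f x = f 0 * poly (P x) c"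
  by (rule P_unique[where M = x]) (auto simp: L_eq algebra_simps)

lemma op_spectrum_iff: "c \<in> op_spectrum p (jac p V) \<longleftrightarrow> \<not> bij_betw (L c) (l2 p) (l2 p)"
  by (simp add: op_spectrum_def L_def[abs_def])

text \<open>Detailed balance trades \<open>revm p x * p_up p x\<close> for
  \<open>revm p (Suc x) * p_down p (Suc x)\<close>, and rates at most 1 make the weighted shift a
  contraction.\<close>

lemma l2_shift_up: "f \<in> l2 p \<Longrightarrow> (\<lambda>x. of_real (p_up p x) * f (Suc x)) \<in> l2 p"
  unfolding l2_def mem_Collect_eq
proof (rule summable_comparison_test'[where N = 0])
  assume "summable (\<lambda>x. revm p x * (cmod (f x))\<^sup>2)"
  then show "summable (\<lambda>x. revm p (Suc x) * (cmod (f (Suc x)))\<^sup>2)"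
    by (subst summable_Suc_iff)
  fix x
  have "revm p x * (p_up p x * p_up p x) = revm p (Suc x) * (p_down p (Suc x) * p_up p x)"
    using revm_Suc[of x] by (simp add: mult.assoc[symmetric])
  also have "\<dots> \<le> revm p (Suc x) * (1 * 1)"
    using p_up_le_1 p_down_le_1 p_up_pos[of x] revm_pos[of "Suc x"]
    by (intro mult_left_mono mult_mono) (auto simp: less_imp_le)
  finally have "revm p x * (p_up p x * p_up p x) * (cmod (f (Suc x)))\<^sup>2 \<le> revm p (Suc x) * (cmod (f (Suc x)))\<^sup>2"
    by (intro mult_right_mono) auto
  then show "norm (revm p x * (cmod (of_real (p_up p x) * f (Suc x)))\<^sup>2) \<le> revm p (Suc x) * (cmod (f (Suc x)))\<^sup>2"
    using revm_pos[of x] p_up_pos[of x] by (simp add: norm_mult power2_eq_square mult_ac)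
qed

lemma l2_shift_down: "f \<in> l2 p \<Longrightarrow> (\<lambda>x. of_real (p_down p x) * f (x - 1)) \<in> l2 p"
proof -
  assume "f \<in> l2 p"
  then have "summable (\<lambda>x. revm p x * (cmod (f x))\<^sup>2)" by (simp add: l2_def)
  then have "summable (\<lambda>x. revm p (Suc x) * (cmod (of_real (p_down p (Suc x)) * f x))\<^sup>2)"
  proof (rule summable_comparison_test'[where N = 0])
    fix x
    have "revm p (Suc x) * p_down p (Suc x) * p_down p (Suc x) \<le> revm p x * 1"
      unfolding revm_Suc mult.assoc using p_up_le_1[of x] p_down_le_1[of "Suc x"] p_up_pos[of x] p_down_pos[of "Suc x"] revm_pos[of x]
      by (intro mult_left_mono) (auto intro!: mult_le_one simp: less_imp_le)
    then have "revm p (Suc x) * p_down p (Suc x) * p_down p (Suc x) * (cmod (f x))\<^sup>2 \<le> revm p x * 1 * (cmod (f x))\<^sup>2"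
      by (intro mult_right_mono) auto
    then show "norm (revm p (Suc x) * (cmod (of_real (p_down p (Suc x)) * f x))\<^sup>2) \<le> revm p x * (cmod (f x))\<^sup>2"
      using revm_pos[of "Suc x"] p_down_pos[of "Suc x"] by (simp add: norm_mult power2_eq_square mult_ac)
  qed
  then show ?thesis unfolding l2_def mem_Collect_eq by (subst summable_Suc_iff[symmetric]) simp
qed

text \<open>The converse of boundedness below: since the kernel of \<open>L c\<close> is at most one-dimensional, two
  non-square-summable superpositions of approximate eigenvectors with disjoint supports cannot both
  be corrected by kernel elements. This replaces the bounded inverse theorem.\<close>

lemma op_spectrum_approx_eigenvectors:
  assumes approx: "\<And>M \<epsilon>. 0 < \<epsilon> \<Longrightarrow> \<exists>f b. (\<forall>x\<le>M. f x = 0) \<and> (\<forall>x>b. f x = 0) \<and>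
      (\<Sum>x\<le>b. revm p x * (cmod (f x))\<^sup>2) = 1 \<and> (\<Sum>x\<le>Suc b. revm p x * (cmod (L c f x))\<^sup>2) \<le> \<epsilon>"
  shows "c \<in> op_spectrum p (jac p V)"
  unfolding op_spectrum_iff
proof
  assume bij: "bij_betw (L c) (l2 p) (l2 p)"
  let ?S = "\<lambda>f b. \<Sum>x\<le>b. revm p x * (cmod (f x))\<^sup>2"
  define good where "good k fb M \<longleftrightarrow> (\<forall>x\<le>M. fst fb x = 0) \<and> (\<forall>x>snd fb. fst fb x = 0) \<and>
      ?S (fst fb) (snd fb) = 1 \<and> ?S (L c (fst fb)) (Suc (snd fb)) \<le> (1/2) ^ k"
    for k :: nat and fb :: "(nat \<Rightarrow> complex) \<times> nat" and M :: nat
  have ex: "\<exists>fb. good k fb M" for k M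
    using approx[of "(1/2) ^ k" M] by (auto simp: good_def)
  \<comment> \<open>Each function vanishes up to two vertices beyond the end of its predecessor.
    \<open>L c\<close> spreads supports by one vertex on either side, so the images have disjoint
    supports too.\<close>
  have "\<exists>g. \<forall>k. good k (g k) (case k of 0 \<Rightarrow> 0 | Suc j \<Rightarrow> snd (g j) + 2)"
  proof -
    define g where "g = rec_nat (SOME fb. good 0 fb 0) (\<lambda>k fb. SOME fb'. good (Suc k) fb' (snd fb + 2))"
    have "good k (g k) (case k of 0 \<Rightarrow> 0 | Suc j \<Rightarrow> snd (g j) + 2)" for k
      by (cases k) (auto simp: g_def intro: someI_ex[OF ex])
    then show ?thesis by blast
  qed
  then obtain g where g: "\<And>k. good k (g k) (case k of 0 \<Rightarrow> 0 | Suc j \<Rightarrow> snd (g j) + 2)" by blast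
  define f where "f k = fst (g k)" for k
  define b where "b k = snd (g k)" for k
  define s where "s k = (case k of 0 \<Rightarrow> 0 | Suc j \<Rightarrow> b j + 2)" for k
  have s_alt: "s k = (case k of 0 \<Rightarrow> 0 | Suc j \<Rightarrow> snd (g j) + 2)" for k by (cases k) (simp_all add: s_def b_def)
  have f1: "f k x = 0" if "x \<le> s k" for k x using g[of k] that unfolding good_def s_alt f_def by blast
  have f2: "f k x = 0" if "b k < x" for k x using g[of k] that unfolding good_def f_def b_def by blast
  have f3: "?S (f k) (b k) = 1" for k using g[of k] unfolding good_def f_def b_def by blast
  have f4: "?S (L c (f k)) (Suc (b k)) \<le> (1/2) ^ k" for k using g[of k] unfolding good_def f_def b_def by blast
  have sb: "s k < b k" for k
  proof (rule ccontr)
    assume "\<not> s k < b k"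
    then have "f k x = 0" for x using f1[of x k] f2[of k x] by (cases "x \<le> s k") auto
    then show False using f3[of k] by simp
  qed
  have ss: "b j + 2 \<le> s k" if "j < k" for j k
    using that
  proof (induction k)
    case (Suc k)
    show ?case
    proof (cases "j = k")
      case True then show ?thesis by (simp add: s_def)
    next
      case False
      then have "b j + 2 \<le> s k" using Suc by simp
      also have "\<dots> \<le> s (Suc k)" using sb[of k] by (simp add: s_def)
      finally show ?thesis .
    qed
  qed simp
  have bk: "k \<le> b k" for k
  proof (induction k)
    case (Suc k) then show ?case using ss[of k "Suc k"] sb[of "Suc k"] by simp
  qed simp
  \<comment> \<open>The infinite superposition over A as a finite sum at each vertex:
    \<open>f k\<close> vanishes below k.\<close>
  define h where "h A x = (\<Sum>k\<le>x. if k \<in> A then f k x else 0)" for A :: "nat set" and x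
  have far: "f k x = 0" if "x < k" for k x
  proof (rule f1)
    have "k \<le> s k" using that bk[of "k - 1"] by (cases k) (auto simp: s_def)
    then show "x \<le> s k" using that by simp
  qed
  have h_at: "h A x = (if k \<in> A then f k x else 0)" if "s k \<le> x + 1" "x \<le> b k + 1" for A k x
  proof -
    have z: "f j x = 0" if "j \<noteq> k" for j
      using f1[of x j] f2[of j x] ss[of j k] ss[of k j] that \<open>s k \<le> x + 1\<close> \<open>x \<le> b k + 1\<close>
      by (cases "j < k") auto
    show ?thesis
    proof (cases "k \<le> x")
      case True
      have "h A x = (\<Sum>j\<in>{k}. if j \<in> A then f j x else 0)"
        unfolding h_def by (rule sum.mono_neutral_right) (use True z in auto)
      then show ?thesis by simp
    next
      case False
      then have "f k x = 0" by (intro far) simp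
      moreover have "h A x = 0" unfolding h_def by (rule sum.neutral) (use z False in auto)
      ultimately show ?thesis by simp
    qed
  qed
  have h_out: "h A x = 0" if "\<And>k. \<not> (s k < x \<and> x \<le> b k)" for A x
    unfolding h_def using f1 f2 that by (intro sum.neutral) (metis not_le)
  have L_at: "L c (h A) x = (if k \<in> A then L c (f k) x else 0)" if "s k \<le> x" "x \<le> b k + 1" for A k x
  proof (cases "x = b k + 1")
    case True
    have "h A (Suc x) = 0"
    proof (rule h_out)
      fix j show "\<not> (s j < Suc x \<and> Suc x \<le> b j)"
        using True ss[of j k] ss[of k j] sb[of k] sb[of j] by (cases "j < k"; cases "j = k") auto
    qed
    moreover have "f k (Suc x) = 0" using True by (intro f2) simp
    ultimately show ?thesis using h_at[of k x A] h_at[of k "x - 1" A] that sb[of k] by (simp add: L_eq)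
  next
    case False
    then show ?thesis using h_at[of k x A] h_at[of k "x - 1" A] h_at[of k "Suc x" A] that by (simp add: L_eq)
  qed
  have L_out: "L c (h A) x = 0" if "\<And>k. \<not> (s k \<le> x \<and> x \<le> b k + 1)" for A x
  proof -
    have "h A x = 0" using that by (intro h_out) (meson le_add1 less_imp_le order_trans)
    moreover have "h A (x - 1) = 0"
      by (rule h_out) (use that in \<open>metis le_diff_conv less_imp_le add.commute diff_le_self order_trans\<close>)
    moreover have "h A (Suc x) = 0"
      by (rule h_out) (use that in \<open>metis Suc_leD less_Suc_eq_le trans_le_add1\<close>)
    ultimately show ?thesis by (simp add: L_eq)
  qed
  \<comment> \<open>The images have squared norms at most \<open>(1/2) ^ k\<close> on disjoint
    supports, so they sum to a square-summable function.\<close>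
  have Lh: "L c (h A) \<in> l2 p" for A
    unfolding l2_def mem_Collect_eq
  proof (rule summableI_nonneg_bounded)
    fix m
    have pt: "revm p x * (cmod (L c (h A) x))\<^sup>2 \<le> (\<Sum>k\<le>m. if x \<le> Suc (b k) then revm p x * (cmod (L c (f k) x))\<^sup>2 else 0)"
      if "x < m" for x
    proof (cases "\<exists>k. s k \<le> x \<and> x \<le> b k + 1")
      case True
      then obtain k where k: "s k \<le> x" "x \<le> b k + 1" by blast
      have "k \<le> m" using k(1) bk[of "k - 1"] that by (cases k) (auto simp: s_def)
      have "revm p x * (cmod (L c (h A) x))\<^sup>2 \<le> (if x \<le> Suc (b k) then revm p x * (cmod (L c (f k) x))\<^sup>2 else 0)"
        using L_at[OF k, of A] k revm_nonneg by auto
      also have "\<dots> \<le> (\<Sum>k\<le>m. if x \<le> Suc (b k) then revm p x * (cmod (L c (f k) x))\<^sup>2 else 0)"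
        by (rule member_le_sum) (use \<open>k \<le> m\<close> revm_nonneg in auto)
      finally show ?thesis .
    next
      case False
      then have "L c (h A) x = 0" by (intro L_out) blast
      then show ?thesis using revm_nonneg by (auto intro!: sum_nonneg)
    qed
    have "(\<Sum>x<m. revm p x * (cmod (L c (h A) x))\<^sup>2)
      \<le> (\<Sum>x<m. \<Sum>k\<le>m. if x \<le> Suc (b k) then revm p x * (cmod (L c (f k) x))\<^sup>2 else 0)"
      using pt by (intro sum_mono) auto
    also have "\<dots> = (\<Sum>k\<le>m. \<Sum>x<m. if x \<le> Suc (b k) then revm p x * (cmod (L c (f k) x))\<^sup>2 else 0)"
      by (rule sum.swap)
    also have "\<dots> \<le> (\<Sum>k\<le>m. (1/2) ^ k)"
    proof (rule sum_mono)
      fix k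
      have "(\<Sum>x<m. if x \<le> Suc (b k) then revm p x * (cmod (L c (f k) x))\<^sup>2 else 0)
        = (\<Sum>x\<in>{..<m} \<inter> {..Suc (b k)}. revm p x * (cmod (L c (f k) x))\<^sup>2)"
        by (subst sum.inter_restrict) auto
      also have "\<dots> \<le> ?S (L c (f k)) (Suc (b k))"
        by (rule sum_mono2) (auto simp: revm_nonneg)
      finally show "(\<Sum>x<m. if x \<le> Suc (b k) then revm p x * (cmod (L c (f k) x))\<^sup>2 else 0) \<le> (1/2) ^ k"
        using f4[of k] by simp
    qed
    also have "\<dots> \<le> 2" by (simp add: sum_gp0)
    finally show "(\<Sum>x<m. revm p x * (cmod (L c (h A) x))\<^sup>2) \<le> 2" .
  qed (simp add: revm_nonneg)
  \<comment> \<open>Every index in A contributes a block of squared norm 1, so the tails do not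
    become small.\<close>
  have not_l2: "h A \<notin> l2 p" if inf: "infinite A" for A
  proof
    assume "h A \<in> l2 p"
    then have "summable (\<lambda>x. revm p x * (cmod (h A x))\<^sup>2)" by (simp add: l2_def)
    from summable_Cauchy[THEN iffD1, OF this]
    obtain N where N: "\<And>m n. m \<ge> N \<Longrightarrow> norm (\<Sum>x=m..<n. revm p x * (cmod (h A x))\<^sup>2) < 1/2"
      by (meson half_gt_zero_iff zero_less_one)
    obtain k where k: "k \<in> A" "k > N" using inf by (meson infinite_nat_iff_unbounded)
    have sk: "N \<le> s k" using k(2) bk[of "k - 1"] by (cases k) (auto simp: s_def)
    have "1 = ?S (f k) (b k)" using f3 by simp
    also have "\<dots> = (\<Sum>x=s k..<Suc (b k). revm p x * (cmod (h A x))\<^sup>2)"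
    proof (rule sum.mono_neutral_cong_right)
      show "\<forall>x\<in>{..b k} - {s k..<Suc (b k)}. revm p x * (cmod (f k x))\<^sup>2 = 0" using f1[of _ k] by auto
      show "revm p x * (cmod (f k x))\<^sup>2 = revm p x * (cmod (h A x))\<^sup>2" if "x \<in> {s k..<Suc (b k)}" for x
        using h_at[of k x A] that k(1) by auto
    qed auto
    also have "\<dots> \<le> norm (\<Sum>x=s k..<Suc (b k). revm p x * (cmod (h A x))\<^sup>2)" by simp
    also have "\<dots> < 1/2" by (rule N[OF sk])
    finally show False by simp
  qed
  \<comment> \<open>Surjectivity gives a square-summable \<open>h'\<close> with the same image; the
    difference lies in the kernel, spanned by the solution \<open>P\<close>, and cannot be
    zero.\<close>
  have corr: "\<exists>t h'. t \<noteq> 0 \<and> h' \<in> l2 p \<and> (\<forall>x. h A x = h' x + t * poly (P x) c)" if inf: "infinite A" for A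
  proof -
    have "L c ` l2 p = l2 p" using bij by (simp add: bij_betw_def)
    then obtain h' where h': "h' \<in> l2 p" "L c h' = L c (h A)" using Lh[of A] by (metis imageE)
    define t where "t = h A 0 - h' 0"
    have "L c (\<lambda>x. h A x - h' x) x = 0" for x using h'(2) by (simp add: L_diff)
    from L_eq_0[OF this] have eq: "h A x = h' x + t * poly (P x) c" for x
      by (simp add: t_def algebra_simps)
    have "t \<noteq> 0"
    proof
      assume "t = 0"
      then have "h A = h'" using eq by auto
      then show False using not_l2[OF inf] h'(1) by simp
    qed
    then show ?thesis using h'(1) eq by blast
  qed
  have inf: "infinite {k::nat. even k}" "infinite {k::nat. odd k}"
    by (auto simp: infinite_nat_iff_unbounded_le) (metis even_Suc le_Suc_eq order_refl even_Suc_Suc_iff)+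
  obtain t1 h1 where 1: "t1 \<noteq> 0" "h1 \<in> l2 p" "\<And>x. h {k. even k} x = h1 x + t1 * poly (P x) c"
    using corr[OF inf(1)] by blast
  obtain t2 h2 where 2: "t2 \<noteq> 0" "h2 \<in> l2 p" "\<And>x. h {k. odd k} x = h2 x + t2 * poly (P x) c"
    using corr[OF inf(2)] by blast
  \<comment> \<open>At every vertex one of the two superpositions vanishes, so \<open>P x\<close> is
    a fixed multiple of \<open>h1 x\<close> or of \<open>h2 x\<close>. Hence the solution
    \<open>P\<close> is square-summable, against injectivity.\<close>
  have disj: "h {k. even k} x = 0 \<or> h {k. odd k} x = 0" for x
  proof (cases "\<exists>k. s k < x \<and> x \<le> b k")
    case True
    then obtain k where "s k < x" "x \<le> b k" by blast
    then show ?thesis using h_at[of k x "{k. even k}"] h_at[of k x "{k. odd k}"] by (cases "even k") auto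
  qed (use h_out in blast)
  have "(\<lambda>x. of_real (cmod (h1 x / t1)) + of_real (cmod (h2 x / t2)) :: complex) \<in> l2 p"
  proof (rule l2_add[OF _ _ revm_nonneg])
    show "(\<lambda>x. of_real (cmod (h1 x / t1)) :: complex) \<in> l2 p"
      by (rule l2_cong_bound[OF 1(2) revm_nonneg, of _ "inverse (cmod t1)"]) (simp add: divide_inverse norm_mult norm_inverse mult.commute)
    show "(\<lambda>x. of_real (cmod (h2 x / t2)) :: complex) \<in> l2 p"
      by (rule l2_cong_bound[OF 2(2) revm_nonneg, of _ "inverse (cmod t2)"]) (simp add: divide_inverse norm_mult norm_inverse mult.commute)
  qed
  then have PL: "(\<lambda>x. poly (P x) c) \<in> l2 p"
  proof (rule l2_cong_bound[OF _ revm_nonneg, of _ _ 1])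
    fix x
    have "poly (P x) c = - h1 x / t1 \<or> poly (P x) c = - h2 x / t2"
      using disj[of x] 1(1,3) 2(1,3) by (auto simp: field_simps add_eq_0_iff)
    then have "cmod (poly (P x) c) \<le> cmod (h1 x / t1) + cmod (h2 x / t2)" by auto
    then show "cmod (poly (P x) c) \<le> 1 * cmod (of_real (cmod (h1 x / t1)) + of_real (cmod (h2 x / t2)) :: complex)"
      by (simp flip: of_real_add)
  qed
  have "(\<lambda>x. 0) \<in> l2 p" by (simp add: l2_def)
  moreover have "L c (\<lambda>x. poly (P x) c) = L c (\<lambda>x. 0)" using L_P[of c] by (auto simp: L_eq)
  ultimately have "(\<lambda>x. poly (P x) c) = (\<lambda>x. 0)" using bij PL by (auto simp: bij_betw_def inj_on_def)
  from fun_cong[OF this, of 0] show False by simp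
qed

end

section \<open>The spectrum equals \<open>F\<close>\<close>

context decimated
begin

lemma V_bounded: "\<exists>B. \<forall>x. \<bar>V x\<bar> \<le> B"
proof -
  have "\<bar>V x\<bar> \<le> Max ((\<lambda>x. \<bar>V x\<bar>) ` {..3 ^ n})" for x
  proof -
    have "V x = V (x mod 3 ^ n)" using V_shift[of "x div 3 ^ n" "x mod 3 ^ n"] by simp
    moreover have "x mod 3 ^ n \<le> 3 ^ n" by (simp add: less_imp_le)
    ultimately show ?thesis by (auto intro!: Max_ge)
  qed
  then show ?thesis by blast
qed

lemma L_in_l2:
  assumes f: "f \<in> l2 p"
  shows "L c f \<in> l2 p"
proof -
  obtain B where B: "\<And>x. \<bar>V x\<bar> \<le> B" using V_bounded by blast
  have 1: "(\<lambda>x. (of_real (V x) - c) * f x) \<in> l2 p"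
  proof (rule l2_cong_bound[OF f revm_nonneg])
    fix x
    have "cmod (of_real (V x) - c) \<le> B + cmod c"
      using norm_triangle_ineq4[of "of_real (V x)" c] B[of x] by simp
    then show "cmod ((of_real (V x) - c) * f x) \<le> (B + cmod c) * cmod (f x)"
      unfolding norm_mult by (rule mult_right_mono) simp
  qed
  have neg: "(\<lambda>x. - h x) \<in> l2 p" if "h \<in> l2 p" for h
    by (rule l2_cong_bound[OF that revm_nonneg, of _ 1]) simp
  have "(\<lambda>x. ((of_real (V x) - c) * f x + - (of_real (p_down p x) * f (x - 1))) + - (of_real (p_up p x) * f (Suc x))) \<in> l2 p"
    by (intro l2_add revm_nonneg 1 neg l2_shift_up l2_shift_down f)
  also have "(\<lambda>x. ((of_real (V x) - c) * f x + - (of_real (p_down p x) * f (x - 1))) + - (of_real (p_up p x) * f (Suc x))) = L c f"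
    by (simp add: L_eq fun_eq_iff)
  finally show ?thesis .
qed

text \<open>A kernel element is a multiple of the solution \<open>P\<close>. Constant weights at the
  powers of 3 turn square-summability into boundedness of \<open>P (3 ^ (n + m))\<close> at c, which
  means c \<in> \<open>F\<close>.\<close>

lemma kernel_trivial:
  assumes c: "c \<notin> F" and f: "f \<in> l2 p" and ker: "\<And>x. L c f x = 0"
  shows "f x = 0"
proof -
  have eq: "f x = f 0 * poly (P x) c" for x by (rule L_eq_0[OF ker])
  have "f 0 = 0"
  proof (rule ccontr)
    assume f0: "f 0 \<noteq> 0"
    have "(\<lambda>x. revm p x * (cmod (f x))\<^sup>2) \<longlonglongrightarrow> 0"
      using f by (intro summable_LIMSEQ_zero) (simp add: l2_def)
    then have "((\<lambda>x. revm p x * (cmod (f x))\<^sup>2) \<circ> (\<lambda>m. 3 ^ (n + m))) \<longlonglongrightarrow> 0"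
      by (rule LIMSEQ_subseq_LIMSEQ) (simp add: strict_mono_def)
    then have "Bseq (\<lambda>m. revm p (3 ^ (n + m)) * (cmod (f (3 ^ (n + m))))\<^sup>2)"
      by (intro convergent_imp_Bseq) (auto simp: convergent_def o_def)
    then obtain C where C: "\<And>m. 1 / (1 - p) * (cmod (f (3 ^ (n + m))))\<^sup>2 \<le> C"
      unfolding revm_pow3 Bseq_def using p_less by (auto simp: abs_mult)
    have "cmod (poly (P (3 ^ (n + m))) c) \<le> sqrt (C * (1 - p)) / cmod (f 0)" for m
    proof -
      have "(cmod (f (3 ^ (n + m))))\<^sup>2 \<le> C * (1 - p)" using C[of m] p_less by (simp add: field_simps)
      then have "cmod (f (3 ^ (n + m))) \<le> sqrt (C * (1 - p))" by (rule real_le_rsqrt)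
      then show ?thesis using f0 unfolding eq[of "3 ^ (n + m)"] norm_mult by (simp add: field_simps)
    qed
    then have "c \<in> F" unfolding F_iff_bounded bounded_iff by blast
    then show False using c by simp
  qed
  then show ?thesis by (subst eq) simp
qed

lemma resolvent_surj:
  assumes c: "c \<notin> F" and g: "g \<in> l2 p"
  shows "\<exists>f\<in>l2 p. L c f = g"
proof -
  have "open (- F)" using closed_F by (simp add: open_Compl)
  then obtain \<epsilon> where \<epsilon>: "0 < \<epsilon>" "ball c \<epsilon> \<subseteq> - F" using c by (meson ComplI open_contains_ball)
  have dist: "\<epsilon> \<le> cmod (z - c)" if "z \<in> F" for z
    using \<epsilon>(2) that by (force simp: dist_norm norm_minus_commute)
  define G where "G = (\<Sum>x. revm p x * (cmod (g x))\<^sup>2)"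
  have sg: "summable (\<lambda>x. revm p x * (cmod (g x))\<^sup>2)" using g by (simp add: l2_def)
  have ex: "\<exists>f. (\<forall>x<3 ^ (n + k). L c f x = g x) \<and> (\<forall>X\<le>3 ^ (n + k). \<epsilon>\<^sup>2 * (\<Sum>x<X. revm p x * (cmod (f x))\<^sup>2) \<le> G)" for k
  proof -
    let ?N = "3 ^ (n + k) :: nat"
    interpret T: jacobi "(p_up p)(?N := 1)" "(p_down p)(?N := 1)" V by (rule jacobi_trunc) simp
    have wN: "T.w x = revm p x" if "x < ?N" for x
      using that by (induction x) (simp_all add: jweight.simps(2) revm.simps(2))
    \<comment> \<open>The truncated weight equals \<open>revm\<close> before \<open>?N\<close>; at
      \<open>?N\<close> it acquires the factor \<open>p_down\<close> \<le> 1, because that rate was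
      set to 1. A smaller weight is harmless for the norm of g.\<close>
    have "T.w ?N \<le> revm p ?N"
    proof -
      obtain M where M: "?N = Suc M" by (metis gr0_implies_Suc zero_less_power zero_less_numeral)
      have "T.w ?N = T.w M * p_up p M" using M by (simp add: jweight.simps(2))
      also have "\<dots> = revm p ?N * p_down p ?N" using wN[of M] M by (simp add: revm_Suc)
      also have "\<dots> \<le> revm p ?N * 1" by (intro mult_left_mono p_down_le_1 revm_nonneg)
      finally show ?thesis by simp
    qed
    then have w_le: "T.w x \<le> revm p x" if "x \<le> ?N" for x using wN[of x] that by (cases "x = ?N") auto
    have "\<epsilon> \<le> cmod (z - c)" if "poly (T.P (Suc ?N)) z = 0" for z
      using that trunc_spectrum_eq[of ?N] trunc_spectrum_subset_F[of "n + k"] dist by auto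
    from T.trunc_resolvent[OF \<epsilon>(1) this, where g = g] obtain f where f:
      "\<And>x. x \<le> ?N \<Longrightarrow> of_real (V x) * f x - of_real (((p_down p)(?N := 1)) x) * f (x - 1) - of_real (((p_up p)(?N := 1)) x) * f (Suc x) - c * f x = g x"
      "\<epsilon>\<^sup>2 * (\<Sum>x\<le>?N. T.w x * (cmod (f x))\<^sup>2) \<le> (\<Sum>x\<le>?N. T.w x * (cmod (g x))\<^sup>2)"
      by blast
    have "L c f x = g x" if "x < ?N" for x using f(1)[of x] that by (simp add: L_eq algebra_simps)
    moreover have "\<epsilon>\<^sup>2 * (\<Sum>x<X. revm p x * (cmod (f x))\<^sup>2) \<le> G" if X: "X \<le> ?N" for X
    proof -
      have "(\<Sum>x<X. revm p x * (cmod (f x))\<^sup>2) = (\<Sum>x<X. T.w x * (cmod (f x))\<^sup>2)"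
        using X wN by (intro sum.cong) auto
      also have "\<dots> \<le> (\<Sum>x\<le>?N. T.w x * (cmod (f x))\<^sup>2)"
        using X T.w_pos by (intro sum_mono2) (auto intro!: mult_nonneg_nonneg less_imp_le[OF T.w_pos])
      finally have "\<epsilon>\<^sup>2 * (\<Sum>x<X. revm p x * (cmod (f x))\<^sup>2) \<le> \<epsilon>\<^sup>2 * (\<Sum>x\<le>?N. T.w x * (cmod (f x))\<^sup>2)"
        by (intro mult_left_mono) auto
      also note f(2)
      also have "(\<Sum>x\<le>?N. T.w x * (cmod (g x))\<^sup>2) \<le> (\<Sum>x\<le>?N. revm p x * (cmod (g x))\<^sup>2)"
        using w_le by (intro sum_mono mult_right_mono) auto
      also have "\<dots> \<le> G" unfolding G_def by (rule sum_le_suminf[OF sg]) (auto simp: revm_nonneg)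
      finally show ?thesis .
    qed
    ultimately show ?thesis by blast
  qed
  then obtain h where h: "\<And>k x. x < 3 ^ (n + k) \<Longrightarrow> L c (h k) x = g x"
    "\<And>k X. X \<le> 3 ^ (n + k) \<Longrightarrow> \<epsilon>\<^sup>2 * (\<Sum>x<X. revm p x * (cmod (h k x))\<^sup>2) \<le> G"
    by metis
  have "cmod (h k 0) \<le> sqrt (G / \<epsilon>\<^sup>2)" for k
    using h(2)[of 1 k] \<epsilon>(1) by (intro real_le_rsqrt) (simp add: field_simps Suc_leI)
  then have "bounded (range (\<lambda>k. h k 0))" by (auto simp: bounded_iff)
  then obtain s r where r: "strict_mono r" "((\<lambda>k. h k 0) \<circ> r) \<longlonglongrightarrow> s"
    using bounded_imp_convergent_subsequence by blast
  have ev: "\<forall>\<^sub>F k in sequentially. X < 3 ^ (n + r k)" for X :: nat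
  proof (rule eventually_mono[OF eventually_ge_at_top[of X]])
    fix k assume "X \<le> k"
    have "k \<le> r k" using r(1) by (rule seq_suble)
    then have "X \<le> n + r k" using \<open>X \<le> k\<close> by simp
    also have "\<dots> < 3 ^ (n + r k)" by (induction "n + r k") (auto simp: power_gt_expt)
    finally show "X < 3 ^ (n + r k)" .
  qed
  \<comment> \<open>Convergence at the vertex 0 suffices: the recurrence propagates it to every
    vertex, in place of a diagonal argument.\<close>
  have "\<exists>t. (\<lambda>k. h (r k) x) \<longlonglongrightarrow> t" for x
  proof (induction x rule: less_induct)
    case (less x)
    show ?case
    proof (cases x)
      case 0 then show ?thesis using r(2) by (auto simp: o_def)
    next
      case (Suc y)
      obtain t1 t2 where t: "(\<lambda>k. h (r k) y) \<longlonglongrightarrow> t1" "(\<lambda>k. h (r k) (y - 1)) \<longlonglongrightarrow> t2"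
        using less.IH[of y] less.IH[of "y - 1"] Suc by (metis diff_le_self le_imp_less_Suc lessI)
      have u0: "complex_of_real (p_up p y) \<noteq> 0" using p_up_pos[of y] by simp
      have "(\<lambda>k. ((of_real (V y) - c) * h (r k) y - of_real (p_down p y) * h (r k) (y - 1) - g y) / of_real (p_up p y))
        \<longlonglongrightarrow> ((of_real (V y) - c) * t1 - of_real (p_down p y) * t2 - g y) / of_real (p_up p y)"
        using u0 by (intro tendsto_intros t)
      moreover have "\<forall>\<^sub>F k in sequentially. ((of_real (V y) - c) * h (r k) y - of_real (p_down p y) * h (r k) (y - 1) - g y) / of_real (p_up p y) = h (r k) x"
        using ev[of y]
      proof (rule eventually_mono)
        fix k assume "y < 3 ^ (n + r k)"
        from h(1)[OF this] show "((of_real (V y) - c) * h (r k) y - of_real (p_down p y) * h (r k) (y - 1) - g y) / of_real (p_up p y) = h (r k) x"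
          using u0 Suc by (simp add: L_eq field_simps)
      qed
      ultimately show ?thesis by (intro exI, rule Lim_transform_eventually)
    qed
  qed
  then obtain f where f: "\<And>x. (\<lambda>k. h (r k) x) \<longlonglongrightarrow> f x" by metis
  have "L c f x = g x" for x
  proof (rule LIMSEQ_unique)
    show "(\<lambda>k. L c (h (r k)) x) \<longlonglongrightarrow> L c f x" unfolding L_eq by (intro tendsto_intros f)
    show "(\<lambda>k. L c (h (r k)) x) \<longlonglongrightarrow> g x"
      by (rule tendsto_eventually, rule eventually_mono[OF ev[of x]]) (rule h(1))
  qed
  moreover have "f \<in> l2 p"
    unfolding l2_def mem_Collect_eq
  proof (rule summableI_nonneg_bounded)
    fix X
    have "(\<lambda>k. \<epsilon>\<^sup>2 * (\<Sum>x<X. revm p x * (cmod (h (r k) x))\<^sup>2)) \<longlonglongrightarrow> \<epsilon>\<^sup>2 * (\<Sum>x<X. revm p x * (cmod (f x))\<^sup>2)"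
      by (intro tendsto_intros f)
    moreover have "\<forall>\<^sub>F k in sequentially. \<epsilon>\<^sup>2 * (\<Sum>x<X. revm p x * (cmod (h (r k) x))\<^sup>2) \<le> G"
      by (rule eventually_mono[OF ev[of X]]) (use h(2) in auto)
    ultimately have "\<epsilon>\<^sup>2 * (\<Sum>x<X. revm p x * (cmod (f x))\<^sup>2) \<le> G"
      by (rule tendsto_upperbound) simp
    then show "(\<Sum>x<X. revm p x * (cmod (f x))\<^sup>2) \<le> G / \<epsilon>\<^sup>2" using \<epsilon>(1) by (simp add: field_simps)
  qed (simp add: revm_nonneg)
  ultimately show ?thesis by blast
qed

lemma op_spectrum_subset_F: "op_spectrum p (jac p V) \<subseteq> F"
proof
  fix c assume "c \<in> op_spectrum p (jac p V)"
  show "c \<in> F"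
  proof (rule ccontr)
    assume c: "c \<notin> F"
    have "bij_betw (L c) (l2 p) (l2 p)"
      unfolding bij_betw_def
    proof
      show "inj_on (L c) (l2 p)"
      proof (rule inj_onI)
        fix f g assume fg: "f \<in> l2 p" "g \<in> l2 p" "L c f = L c g"
        have "(\<lambda>x. - g x) \<in> l2 p" by (rule l2_cong_bound[OF fg(2) revm_nonneg, of _ 1]) simp
        then have "(\<lambda>x. f x + - g x) \<in> l2 p" by (rule l2_add[OF fg(1) _ revm_nonneg])
        then have "(\<lambda>x. f x - g x) \<in> l2 p" by simp
        then have "f x - g x = 0" for x by (rule kernel_trivial[OF c]) (simp add: L_diff fg(3))
        then show "f = g" by auto
      qed
      show "L c ` l2 p = l2 p" using L_in_l2 resolvent_surj[OF c] by force
    qed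
    then show False using \<open>c \<in> op_spectrum p (jac p V)\<close> by (simp add: op_spectrum_iff)
  qed
qed

text \<open>The solution at a truncated eigenvalue z near c is cut off to [a, b]. It takes the same
  nonzero value at all large powers of 3, so its mass grows linearly with their number, while the
  defect of the cut sits at four vertices with a bound independent of K.\<close>

lemma F_subset_op_spectrum: "F \<subseteq> op_spectrum p (jac p V)"
proof
  fix c assume c: "c \<in> F"
  show "c \<in> op_spectrum p (jac p V)"
  proof (rule op_spectrum_approx_eigenvectors)
    fix M :: nat and \<epsilon> :: real assume \<epsilon>: "0 < \<epsilon>"
    obtain l z where lz: "n \<le> l" "z \<in> trunc_spectrum p V (3 ^ l)" "dist c z < sqrt \<epsilon> / 2"
      using trunc_spectrum_dense[OF c, of "sqrt \<epsilon> / 2"] \<epsilon> by auto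
    obtain B where B: "\<And>x. cmod (poly (P x) z) \<le> B" using trunc_eigenfunction_bounded[OF lz(2,1)] by blast
    have B0: "0 \<le> B" using B[of 0] norm_ge_zero by (meson order_trans)
    define \<rho> where "\<rho> = (cmod (poly (P (3 ^ l)) z))\<^sup>2 / (1 - p)"
    have \<rho>: "0 < \<rho>" using trunc_eigenfunction_nz[OF lz(2)] p_less by (simp add: \<rho>_def)
    define E where "E = 4 * (B\<^sup>2 / (1 - p))"
    have E: "0 \<le> E" using p_less by (simp add: E_def)
    \<comment> \<open>With this K, twice the defect \<open>E\<close> is at most \<epsilon> / 2 times
      the mass \<open>S\<close>; the other half of \<epsilon> absorbs the distance from z to
      c.\<close>
    obtain K :: nat where K: "4 * E / (\<epsilon> * \<rho>) < real K" using reals_Archimedean2 by blast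
    define i where "i = Suc (max l M)"
    define a where "a = (3::nat) ^ i"
    define b where "b = (3::nat) ^ (i + Suc K)"
    have Ma: "M < a" and la: "l \<le> i"
    proof -
      have "M < i" by (simp add: i_def)
      also have "i < 3 ^ i" by (simp add: power_gt_expt)
      finally show "M < a" by (simp add: a_def)
    qed (simp add: i_def)
    have ab: "a < b" unfolding a_def b_def by (rule power_strict_increasing) auto
    have a0: "0 < a" by (simp add: a_def)
    have ra: "revm p a = 1 / (1 - p)" and rb: "revm p b = 1 / (1 - p)" unfolding a_def b_def by (rule revm_pow3)+
    define f where "f x = (if a \<le> x \<and> x \<le> b then poly (P x) z else 0)" for x
    define S where "S = (\<Sum>x\<le>b. revm p x * (cmod (f x))\<^sup>2)"
    have S: "real (Suc (Suc K)) * \<rho> \<le> S"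
    proof -
      have inj: "inj_on (\<lambda>j. (3::nat) ^ j) {i..i + Suc K}" by (simp add: inj_on_def)
      have "real (Suc (Suc K)) * \<rho> = (\<Sum>j\<in>{i..i + Suc K}. \<rho>)" by simp
      also have "\<dots> = (\<Sum>j\<in>{i..i + Suc K}. revm p (3 ^ j) * (cmod (f (3 ^ j)))\<^sup>2)"
      proof (rule sum.cong[OF refl])
        fix j assume j: "j \<in> {i..i + Suc K}"
        have "3 ^ i \<le> (3::nat) ^ j" "(3::nat) ^ j \<le> 3 ^ (i + Suc K)"
          using j by (auto intro!: power_increasing simp del: power_Suc)
        then have "f (3 ^ j) = poly (P (3 ^ j)) z" by (simp only: f_def a_def b_def simp_thms if_True)
        also have "\<dots> = poly (P (3 ^ l)) z" using j la by (intro trunc_eigenfunction_pow3[OF lz(2,1)]) auto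
        finally show "\<rho> = revm p (3 ^ j) * (cmod (f (3 ^ j)))\<^sup>2" by (simp add: revm_pow3 \<rho>_def)
      qed
      also have "\<dots> = (\<Sum>x\<in>(\<lambda>j. 3 ^ j) ` {i..i + Suc K}. revm p x * (cmod (f x))\<^sup>2)"
        by (simp only: sum.reindex[OF inj] o_def)
      also have "\<dots> \<le> S" unfolding S_def
        by (rule sum_mono2) (auto simp: revm_nonneg b_def simp del: power_Suc intro!: power_increasing)
      finally show ?thesis .
    qed
    have S0: "0 < S" using S \<rho> by (smt (verit) mult_pos_pos of_nat_0_less_iff zero_less_Suc)
    have SSuc: "(\<Sum>x\<le>Suc b. revm p x * (cmod (f x))\<^sup>2) = S" by (simp add: S_def f_def)
    let ?e = "L z f"
    have Lcz: "L c f x = (z - c) * f x + ?e x" for x by (simp add: L_eq algebra_simps)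
    have LP: "(of_real (V x) - z) * poly (P x) z - of_real (p_down p x) * poly (P (x - 1)) z - of_real (p_up p x) * poly (P (Suc x)) z = 0" for x
      using L_P[of z x] by (simp add: L_eq)
    \<comment> \<open>At a - 1 and b + 1 no value of the weight is at hand; detailed balance
      compares it with the weight at the adjacent power of 3.\<close>
    have u1: "revm p x * (p_up p x * p_up p x) \<le> revm p (Suc x)" "revm p (Suc x) * (p_down p (Suc x) * p_down p (Suc x)) \<le> revm p x" for x
    proof -
      have "revm p x * p_up p x * p_up p x \<le> revm p (Suc x) * p_down p (Suc x) * 1"
        unfolding revm_Suc using p_up_le_1[of x] revm_nonneg[of x] p_up_pos[of x] by (intro mult_left_mono) (auto simp: less_imp_le)
      also have "\<dots> \<le> revm p (Suc x)" using p_down_le_1[of "Suc x"] revm_nonneg[of "Suc x"] by (simp add: mult_left_le)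
      finally show "revm p x * (p_up p x * p_up p x) \<le> revm p (Suc x)" by (simp add: mult.assoc)
      have "revm p (Suc x) * p_down p (Suc x) * p_down p (Suc x) \<le> revm p x * p_up p x * 1"
        unfolding revm_Suc using p_down_le_1[of "Suc x"] revm_nonneg[of x] p_up_pos[of x] by (intro mult_left_mono) (auto simp: less_imp_le)
      also have "\<dots> \<le> revm p x" using p_up_le_1[of x] revm_nonneg[of x] by (simp add: mult_left_le)
      finally show "revm p (Suc x) * (p_down p (Suc x) * p_down p (Suc x)) \<le> revm p x" by (simp add: mult.assoc)
    qed
    have e_zero: "?e x = 0" if "x \<notin> {a - 1, a, b, Suc b}" for x
    proof (cases "a < x \<and> x < b")
      case True
      then show ?thesis using LP[of x] by (auto simp: L_eq f_def)
    next
      case False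
      then have "x < a - 1 \<or> Suc b < x" using that a0 by auto
      then show ?thesis using ab by (auto simp: L_eq f_def)
    qed
    have e_bound: "revm p x * (cmod (?e x))\<^sup>2 \<le> B\<^sup>2 / (1 - p)" if "x \<in> {a - 1, a, b, Suc b}" for x
    proof -
      have gen: "revm p x * (cmod (of_real t * poly (P y) z))\<^sup>2 \<le> B\<^sup>2 / (1 - p)"
        if "revm p x * (t * t) \<le> 1 / (1 - p)" for x y t
      proof -
        have "(cmod (poly (P y) z))\<^sup>2 \<le> B\<^sup>2" using B by (intro power_mono) auto
        then have "(revm p x * (t * t)) * (cmod (poly (P y) z))\<^sup>2 \<le> 1 / (1 - p) * B\<^sup>2"
          using that p_less revm_nonneg[of x] by (intro mult_mono) auto
        then show ?thesis by (simp add: norm_mult power_mult_distrib power2_eq_square mult_ac)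
      qed
      have le1: "revm p x * (t * t) \<le> 1 / (1 - p)" if "revm p x = 1 / (1 - p)" "0 < t" "t \<le> 1" for x t
        using that p_less mult_le_one[of t t] mult_left_le[of "t * t" "1 / (1 - p)"] by simp
      from that consider "x = a - 1" | "x = a" | "x = b" | "x = Suc b" by auto
      then show ?thesis
      proof cases
        case 1
        have "?e x = - (of_real (p_up p x) * poly (P a) z)" using 1 a0 ab by (auto simp: L_eq f_def)
        moreover have "revm p x * (p_up p x * p_up p x) \<le> 1 / (1 - p)" using u1(1)[of x] 1 a0 ra by simp
        ultimately show ?thesis using gen[of x "p_up p x" a] by (simp only: norm_minus_cancel)
      next
        case 2
        have "?e x = of_real (p_down p a) * poly (P (a - 1)) z" using 2 a0 ab LP[of a] by (auto simp: L_eq f_def algebra_simps)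
        moreover have "revm p x * (p_down p a * p_down p a) \<le> 1 / (1 - p)"
          using le1[OF ra p_down_pos[OF a0] p_down_le_1] 2 by simp
        ultimately show ?thesis using gen[of x "p_down p a" "a - 1"] by (simp only:)
      next
        case 3
        have "?e x = of_real (p_up p b) * poly (P (Suc b)) z" using 3 ab LP[of b] by (auto simp: L_eq f_def algebra_simps)
        moreover have "revm p x * (p_up p b * p_up p b) \<le> 1 / (1 - p)"
          using le1[OF rb p_up_pos p_up_le_1] 3 by simp
        ultimately show ?thesis using gen[of x "p_up p b" "Suc b"] by (simp only:)
      next
        case 4
        have "?e x = - (of_real (p_down p x) * poly (P b) z)" using 4 ab by (auto simp: L_eq f_def)
        moreover have "revm p x * (p_down p x * p_down p x) \<le> 1 / (1 - p)" using u1(2)[of b] 4 rb by simp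
        ultimately show ?thesis using gen[of x "p_down p x" b] by (simp only: norm_minus_cancel)
      qed
    qed
    have e_sum: "(\<Sum>x\<le>Suc b. revm p x * (cmod (?e x))\<^sup>2) \<le> E"
    proof -
      have "(\<Sum>x\<le>Suc b. revm p x * (cmod (?e x))\<^sup>2) = (\<Sum>x\<in>{a - 1, a, b, Suc b}. revm p x * (cmod (?e x))\<^sup>2)"
        by (rule sum.mono_neutral_right) (use ab e_zero in auto)
      also have "\<dots> \<le> real (card {a - 1, a, b, Suc b}) * (B\<^sup>2 / (1 - p))"
        by (rule sum_bounded_above) (rule e_bound)
      also have "\<dots> \<le> 4 * (B\<^sup>2 / (1 - p))"
        using p_less by (intro mult_right_mono) (auto simp: card_insert_if)
      finally show ?thesis by (simp add: E_def)
    qed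
    have zc: "(cmod (z - c))\<^sup>2 \<le> \<epsilon> / 4"
    proof -
      have "(cmod (z - c))\<^sup>2 \<le> (sqrt \<epsilon> / 2)\<^sup>2" using lz(3) by (intro power_mono) (auto simp: dist_norm norm_minus_commute)
      then show ?thesis using \<epsilon> by (simp add: power_divide)
    qed
    have E2: "2 * E \<le> \<epsilon> / 2 * S"
    proof -
      have "4 * E \<le> \<epsilon> * (real K * \<rho>)" using K \<epsilon> \<rho> by (simp add: field_simps)
      also have "\<dots> \<le> \<epsilon> * S"
      proof (rule mult_left_mono)
        show "real K * \<rho> \<le> S" using S \<rho> by (simp add: algebra_simps)
      qed (use \<epsilon> in simp)
      finally show ?thesis by simp
    qed
    have Lsum: "(\<Sum>x\<le>Suc b. revm p x * (cmod (L c f x))\<^sup>2) \<le> \<epsilon> * S"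
    proof -
      have "(\<Sum>x\<le>Suc b. revm p x * (cmod (L c f x))\<^sup>2) \<le> (\<Sum>x\<le>Suc b. \<epsilon> / 2 * (revm p x * (cmod (f x))\<^sup>2) + 2 * (revm p x * (cmod (?e x))\<^sup>2))"
      proof (rule sum_mono)
        fix x
        have "(cmod (L c f x))\<^sup>2 \<le> 2 * (cmod ((z - c) * f x))\<^sup>2 + 2 * (cmod (?e x))\<^sup>2"
          unfolding Lcz by (rule cmod_add_square_le)
        also have "(cmod ((z - c) * f x))\<^sup>2 \<le> \<epsilon> / 4 * (cmod (f x))\<^sup>2"
          unfolding norm_mult power_mult_distrib using zc by (intro mult_right_mono) auto
        finally have "(cmod (L c f x))\<^sup>2 \<le> \<epsilon> / 2 * (cmod (f x))\<^sup>2 + 2 * (cmod (?e x))\<^sup>2" by simp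
        from mult_left_mono[OF this revm_nonneg[of x]]
        show "revm p x * (cmod (L c f x))\<^sup>2 \<le> \<epsilon> / 2 * (revm p x * (cmod (f x))\<^sup>2) + 2 * (revm p x * (cmod (?e x))\<^sup>2)"
          by (simp add: algebra_simps)
      qed
      also have "\<dots> = \<epsilon> / 2 * (\<Sum>x\<le>Suc b. revm p x * (cmod (f x))\<^sup>2) + 2 * (\<Sum>x\<le>Suc b. revm p x * (cmod (?e x))\<^sup>2)"
        by (simp only: sum.distrib sum_distrib_left)
      also have "\<dots> \<le> \<epsilon> / 2 * S + 2 * E" unfolding SSuc using e_sum by simp
      also have "\<dots> \<le> \<epsilon> / 2 * S + \<epsilon> / 2 * S" by (intro add_left_mono E2)
      finally show ?thesis by (simp add: field_simps)
    qed
    let ?f = "\<lambda>x. of_real (1 / sqrt S) * f x"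
    have sq: "(1 / sqrt S)\<^sup>2 = 1 / S" using S0 by (simp add: power_divide)
    have n1: "(\<Sum>x\<le>b. revm p x * (cmod (?f x))\<^sup>2) = 1"
    proof -
      have "(\<Sum>x\<le>b. revm p x * (cmod (?f x))\<^sup>2) = 1 / S * S"
        unfolding S_def sum_distrib_left norm_mult power_mult_distrib norm_of_real power2_abs sq[unfolded S_def]
        by (simp add: mult_ac)
      then show ?thesis using S0 by simp
    qed
    have n2: "(\<Sum>x\<le>Suc b. revm p x * (cmod (L c ?f x))\<^sup>2) \<le> \<epsilon>"
    proof -
      have "L c ?f x = of_real (1 / sqrt S) * L c f x" for x by (simp add: L_eq algebra_simps diff_divide_distrib)
      then have "(\<Sum>x\<le>Suc b. revm p x * (cmod (L c ?f x))\<^sup>2) = 1 / S * (\<Sum>x\<le>Suc b. revm p x * (cmod (L c f x))\<^sup>2)"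
        unfolding sum_distrib_left by (simp only: norm_mult power_mult_distrib norm_of_real power2_abs sq mult.left_commute)
      also have "\<dots> \<le> 1 / S * (\<epsilon> * S)" using Lsum S0 by (intro mult_left_mono) auto
      finally show ?thesis using S0 by simp
    qed
    show "\<exists>f b. (\<forall>x\<le>M. f x = 0) \<and> (\<forall>x>b. f x = 0) \<and>
      (\<Sum>x\<le>b. revm p x * (cmod (f x))\<^sup>2) = 1 \<and> (\<Sum>x\<le>Suc b. revm p x * (cmod (L c f x))\<^sup>2) \<le> \<epsilon>"
      using n1 n2 Ma by (intro exI[of _ ?f] exI[of _ b]) (auto simp: f_def)
  qed
qed

theorem op_spectrum_eq: "op_spectrum p (jac p V) = F"
  using op_spectrum_subset_F F_subset_op_spectrum by blast

end

text \<open>The Laplacian is decimated by itself, and \<open>F\<close> becomes the filled Julia set;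
  the spectrum of the Laplacian is then an instance of \<open>op_spectrum_eq\<close>.\<close>

sublocale delta_map \<subseteq> DLap: decimated p lap_pot 0 "[:0, 1:]"
proof unfold_locales
  fix m
  have "poly (Q (3 ^ (0 + m))) z = poly (1 - W [:0, 1:] m) z" for z
    by (simp add: Q_pow3 poly_W)
  then show "Q (3 ^ (0 + m)) = 1 - W [:0, 1:] m" by (simp add: poly_eq_poly_eq_iff[symmetric] fun_eq_iff)
qed (simp_all add: lap_pot_def)

context delta_map
begin

theorem op_spectrum_lap: "op_spectrum p (jac p lap_pot) = filled_julia (R_Delta p)"
  unfolding DLap.op_spectrum_eq DLap.F_def by simp

end

section \<open>Averages over roots\<close>

text \<open>The averaging (transfer) operator of A. Roots count with multiplicity, so critical
  values need no exception.\<close>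

definition root_mean :: "complex poly \<Rightarrow> (complex \<Rightarrow> complex) \<Rightarrow> complex \<Rightarrow> complex" where
  "root_mean A f x = (\<Sum>w\<in>#proots (A - [:x:]). f w) / of_nat (degree A)"

text \<open>In the expansion of \<open>f * pderiv A / A\<close> at infinity the coefficient of 1/z
  is the sum of f over the roots; it is the coefficient of degree \<open>size M - 1\<close> of the
  remainder. \<open>pCons 0 H\<close> shifts the index so that the empty multiset fits.\<close>

lemma sum_roots_remainder:
  fixes M :: "'a::idom multiset" and f :: "'a poly"
  defines "A \<equiv> \<Prod>w\<in>#M. [:-w, 1:]"
  shows "\<exists>G H. f * pderiv A = A * G + H \<and> (\<forall>i\<ge>size M. coeff H i = 0)
    \<and> coeff (pCons 0 H) (size M) = (\<Sum>w\<in>#M. poly f w)"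
  unfolding A_def
proof (induction M)
  case empty
  show ?case by (intro exI[of _ 0]) simp
next
  case (add v M)
  let ?A = "\<Prod>w\<in>#M. [:-w, 1:]"
  obtain G H where GH: "f * pderiv ?A = ?A * G + H" "\<And>i. i \<ge> size M \<Longrightarrow> coeff H i = 0"
    "coeff (pCons 0 H) (size M) = (\<Sum>w\<in>#M. poly f w)"
    using add.IH by blast
  have A: "degree ?A = size M" "lead_coeff ?A = 1"
  proof -
    have nz: "(\<Prod>w\<in>#M. [:-w, 1:]) \<noteq> 0" for M :: "'a multiset" by (induction M) (simp_all del: mult_pCons_left)
    show "degree ?A = size M"
    proof (induction M)
      case (add x M)
      have "degree ([:- x, 1:] * (\<Prod>w\<in>#M. [:-w, 1:])) = degree [:- x, 1:] + degree (\<Prod>w\<in>#M. [:-w, 1:])"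
        by (rule degree_mult_eq[OF _ nz]) simp
      then show ?case using add.IH by (simp del: mult_pCons_left)
    qed simp
    show "lead_coeff ?A = 1" by (induction M) (auto simp: lead_coeff_mult simp del: mult_pCons_left)
  qed
  have "[:-v, 1:] dvd f - [:poly f v:]" by (simp add: poly_eq_0_iff_dvd[symmetric])
  \<comment> \<open>Splitting f at the new root v makes the rest a multiple of the enlarged product;
    only \<open>poly f v\<close> times the old product joins the remainder.\<close>
  then obtain f1 where f1: "f = [:poly f v:] + [:-v, 1:] * f1" by (metis dvdE diff_add_cancel add.commute)
  let ?H = "[:-v, 1:] * H + smult (poly f v) ?A"
  have pd: "pderiv ([:-v, 1:] * ?A) = ?A + [:-v, 1:] * pderiv ?A"
    by (simp add: pderiv_mult pderiv_pCons del: mult_pCons_left)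
  have "f * pderiv ([:-v, 1:] * ?A) = f * ?A + [:-v, 1:] * (f * pderiv ?A)"
    unfolding pd by (simp only: distrib_left mult.left_commute)
  also have "\<dots> = ([:poly f v:] + [:-v, 1:] * f1) * ?A + [:-v, 1:] * (?A * G + H)"
    unfolding GH(1) using f1 by simp
  also have "\<dots> = ([:-v, 1:] * ?A) * (G + f1) + ?H"
  proof -
    have "[:poly f v:] * ?A = smult (poly f v) ?A" by simp
    then show ?thesis by (simp only: distrib_left distrib_right mult_ac add_ac)
  qed
  finally have "f * pderiv ([:-v, 1:] * ?A) = ([:-v, 1:] * ?A) * (G + f1) + ?H" .
  moreover have "coeff ?H i = 0" if "i \<ge> Suc (size M)" for i
  proof -
    have "coeff H i = 0" "coeff H (i - 1) = 0" using GH(2)[of i] GH(2)[of "i - 1"] that by auto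
    moreover have "coeff ?A i = 0" using A(1) that by (intro coeff_eq_0) simp
    ultimately show ?thesis using that by (cases i) (auto simp: coeff_pCons)
  qed
  moreover have "coeff (pCons 0 ?H) (Suc (size M)) = poly f v + (\<Sum>w\<in>#M. poly f w)"
    using GH(2)[of "size M"] A GH(3) by (simp add: coeff_pCons)
  ultimately show ?case
    by (intro exI[of _ "G + f1"] exI[of _ ?H]) (simp del: mult_pCons_left)
qed

context
  fixes A :: "complex poly"
  assumes deg_pos: "0 < degree A"
begin

lemma degree_diff_const: "degree (A - [:x:]) = degree A"
  using degree_add_eq_left[of "- [:x:]" A] deg_pos unfolding diff_conv_add_uminus by simp

lemma diff_const_neq_0: "A - [:x:] \<noteq> 0"
  using degree_diff_const[of x] deg_pos by auto

lemma lead_coeff_diff_const: "lead_coeff (A - [:x:]) = lead_coeff A"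
  unfolding degree_diff_const using deg_pos by (cases "degree A") (auto simp: coeff_pCons)

lemma size_proots_diff_const: "size (proots (A - [:x:])) = degree A"
  by (simp add: size_proots_complex degree_diff_const)

lemma diff_const_eq_prod: "A - [:x:] = smult (lead_coeff A) (\<Prod>w\<in>#proots (A - [:x:]). [:-w, 1:])"
  using complex_poly_decompose_multiset[of "A - [:x:]"] by (simp only: lead_coeff_diff_const)

text \<open>Subtracting \<open>x\<close> from \<open>A\<close> changes the remainder of \<open>f * pderiv A\<close> by \<open>x\<close> times the quotient, whose
  degree is too small to affect the coefficient that encodes the sum over the roots.\<close>

lemma sum_roots_low_degree:
  assumes "degree f < degree A"
  shows "(\<Sum>w\<in>#proots (A - [:x:]). poly f w) = (\<Sum>w\<in>#proots (A - [:0:]). poly f w)"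
proof -
  let ?d = "degree A" and ?c = "lead_coeff A"
  have c0: "?c \<noteq> 0" using deg_pos by auto
  have rem: "\<exists>G H. f * pderiv A = (A - [:x:]) * G + H \<and> (\<forall>i\<ge>?d. coeff H i = 0)
      \<and> coeff H (?d - 1) = ?c * (\<Sum>w\<in>#proots (A - [:x:]). poly f w)" for x
  proof -
    let ?B = "\<Prod>w\<in>#proots (A - [:x:]). [:-w, 1:]"
    obtain G H where GH: "f * pderiv ?B = ?B * G + H" "\<forall>i\<ge>?d. coeff H i = 0"
      "coeff (pCons 0 H) ?d = (\<Sum>w\<in>#proots (A - [:x:]). poly f w)"
      using sum_roots_remainder[of f "proots (A - [:x:])"] unfolding size_proots_diff_const by blast
    have "pderiv A = pderiv (A - [:x:])" by (simp add: pderiv_diff pderiv_pCons)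
    also have "\<dots> = smult ?c (pderiv ?B)" by (subst diff_const_eq_prod) (rule pderiv_smult)
    finally have "f * pderiv A = smult ?c (f * pderiv ?B)" by simp
    also have "\<dots> = smult ?c ?B * G + smult ?c H" unfolding GH(1) by (simp add: smult_add_right)
    also have "smult ?c ?B = A - [:x:]" by (rule diff_const_eq_prod[symmetric])
    finally show ?thesis
      using GH(2,3) deg_pos by (intro exI[of _ G] exI[of _ "smult ?c H"]) (cases ?d, auto)
  qed
  obtain G H where GH: "f * pderiv A = (A - [:x:]) * G + H" "\<forall>i\<ge>?d. coeff H i = 0"
    "coeff H (?d - 1) = ?c * (\<Sum>w\<in>#proots (A - [:x:]). poly f w)" using rem by blast
  obtain G0 H0 where GH0: "f * pderiv A = (A - [:0:]) * G0 + H0" "\<forall>i\<ge>?d. coeff H0 i = 0"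
    "coeff H0 (?d - 1) = ?c * (\<Sum>w\<in>#proots (A - [:0:]). poly f w)" using rem by blast
  have degH: "degree H < ?d" "degree H0 < ?d"
    using GH(2) GH0(2) deg_pos by (auto intro!: degree_lessI)
  \<comment> \<open>The degree bound on f keeps the quotient below degree d - 1, the index of the
    coefficient in question.\<close>
  have G0: "coeff G0 i = 0" if "i \<ge> ?d - 1" for i
  proof (cases "G0 = 0")
    case False
    have A0: "A \<noteq> 0" using deg_pos by auto
    have "A * G0 = f * pderiv A - H0" using GH0(1) by simp
    then have "degree A + degree G0 = degree (f * pderiv A - H0)" using degree_mult_eq[OF A0 False] by simp
    also have "\<dots> \<le> max (degree f + degree (pderiv A)) (degree H0)"
      by (rule order.trans[OF degree_diff_le_max]) (meson degree_mult_le max.mono order_refl)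
    also have "\<dots> < ?d + (?d - 1)" using assms degH(2) deg_pos by (simp add: degree_pderiv)
    finally have "degree G0 < ?d - 1" by simp
    then show ?thesis using that by (intro coeff_eq_0) simp
  qed simp
  let ?E = "smult x G0 + H0 - H"
  have E: "(A - [:x:]) * (G - G0) = ?E"
  proof -
    have "(A - [:x:]) * G = A * G0 + H0 - H" using GH(1) GH0(1) by (simp add: algebra_simps)
    moreover have "(A - [:x:]) * G0 = A * G0 - smult x G0" by (simp add: left_diff_distrib)
    ultimately show ?thesis by (simp only: right_diff_distrib) simp
  qed
  have "degree ?E < ?d"
  proof (rule degree_lessI)
    show "\<forall>k\<ge>?d. coeff ?E k = 0" using GH(2) GH0(2) G0 by simp
  qed (use deg_pos in auto)
  then have "G = G0"
    using E degree_mult_eq[OF diff_const_neq_0[of x], of "G - G0"] degree_diff_const[of x] by (cases "G = G0") auto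
  then have "?E = 0" using E by simp
  then have "coeff ?E (?d - 1) = 0" by (metis coeff_0)
  then have "coeff H (?d - 1) = coeff H0 (?d - 1)" using G0[of "?d - 1"] by simp
  then show ?thesis using GH(3) GH0(3) c0 by simp
qed

text \<open>Divide with remainder by A: on the roots of \<open>A - [:x:]\<close> the factor A equals
  x, and the remainder has a constant mean. Each division costs f \<open>degree A\<close> degrees
  and gives g one.\<close>

lemma root_mean_poly:
  "\<exists>g. degree g * degree A \<le> degree f \<and> (\<forall>x. root_mean A (poly f) x = poly g x)"
proof (induction "degree f" arbitrary: f rule: less_induct)
  case less
  show ?case
  proof (cases "degree f < degree A")
    case True
    then show ?thesis
      by (intro exI[of _ "[:root_mean A (poly f) 0:]"]) (auto simp: root_mean_def sum_roots_low_degree[OF True])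
  next
    case False
    have A0: "A \<noteq> 0" using deg_pos by auto
    let ?q = "f div A" and ?r = "f mod A"
    have f: "f = ?q * A + ?r" by simp
    have degr: "degree ?r < degree A" using A0 deg_pos degree_mod_less'[OF A0, of f] by (cases "?r = 0") auto
    have q0: "?q \<noteq> 0" using f degr False by (metis add_0 mult_zero_left)
    have degq: "degree ?q + degree A = degree f"
    proof -
      have "degree (?q * A) = degree ?q + degree A" by (rule degree_mult_eq[OF q0 A0])
      moreover have "degree (?q * A + ?r) = degree (?q * A)"
        by (rule degree_add_eq_left) (use calculation degr in linarith)
      ultimately show ?thesis using f by simp
    qed
    obtain g where g: "degree g * degree A \<le> degree ?q" "\<And>x. root_mean A (poly ?q) x = poly g x"
      using less[of ?q] degq deg_pos by auto
    have "root_mean A (poly f) x = poly (pCons (root_mean A (poly ?r) 0) g) x" for x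
    proof -
      have "poly f w = x * poly ?q w + poly ?r w" if "w \<in># proots (A - [:x:])" for w
      proof -
        have "poly A w = x" using that diff_const_neq_0[of x] by simp
        then show ?thesis using arg_cong[OF f, of "\<lambda>r. poly r w"] by (simp only: poly_add poly_mult mult.commute)
      qed
      then have "image_mset (poly f) (proots (A - [:x:])) = image_mset (\<lambda>w. x * poly ?q w + poly ?r w) (proots (A - [:x:]))"
        by (rule image_mset_cong)
      then have "(\<Sum>w\<in>#proots (A - [:x:]). poly f w) = (\<Sum>w\<in>#proots (A - [:x:]). x * poly ?q w + poly ?r w)"
        by (simp only:)
      also have "\<dots> = x * (\<Sum>w\<in>#proots (A - [:x:]). poly ?q w) + (\<Sum>w\<in>#proots (A - [:0:]). poly ?r w)"
        unfolding sum_roots_low_degree[OF degr, of x, symmetric] sum_mset.distrib sum_mset_distrib_left ..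
      finally have "root_mean A (poly f) x = x * root_mean A (poly ?q) x + root_mean A (poly ?r) 0"
        by (simp only: root_mean_def add_divide_distrib times_divide_eq_right)
      then show ?thesis by (simp add: g(2) add.commute)
    qed
    moreover have "degree (pCons (root_mean A (poly ?r) 0) g) * degree A \<le> degree f"
    proof -
      have "degree (pCons (root_mean A (poly ?r) 0) g) * degree A \<le> Suc (degree g) * degree A"
        by (intro mult_right_mono degree_pCons_le) simp
      also have "\<dots> \<le> degree f" using g(1) degq by simp
      finally show ?thesis .
    qed
    ultimately show ?thesis by blast
  qed
qed

lemma root_mean_pcompose:
  assumes B: "0 < degree B"
  shows "root_mean (pcompose A B) f x = root_mean A (root_mean B f) x"
proof -
  have Bn: "B - [:y:] \<noteq> 0" for y
    using degree_add_eq_left[of "- [:y:]" B] B by auto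
  have comp: "pcompose (\<Prod>w\<in>#M. [:-w, 1:]) B = (\<Prod>w\<in>#M. B - [:w:])" for M
    by (induction M) (simp_all add: pcompose_mult pcompose_pCons one_pCons pcompose_const del: mult_pCons_left)
  have "pcompose A B - [:x:] = pcompose (A - [:x:]) B" by (simp add: pcompose_diff pcompose_const)
  also have "\<dots> = smult (lead_coeff A) (\<Prod>y\<in>#proots (A - [:x:]). B - [:y:])"
    by (subst diff_const_eq_prod) (simp only: pcompose_smult comp)
  finally have "proots (pcompose A B - [:x:]) = proots (\<Prod>y\<in>#proots (A - [:x:]). B - [:y:])"
    using deg_pos by (metis degree_0 leading_coeff_0_iff less_irrefl proots_smult)
  also have "\<dots> = (\<Sum>y\<in>#proots (A - [:x:]). proots (B - [:y:]))"
  proof -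
    have "0 \<notin># image_mset (\<lambda>y. B - [:y:]) (proots (A - [:x:]))" using Bn by (metis (no_types, lifting) image_iff set_image_mset)
    from proots_prod_mset[OF this] show ?thesis by (simp add: image_mset.compositionality o_def)
  qed
  finally have eq: "proots (pcompose A B - [:x:]) = (\<Sum>y\<in>#proots (A - [:x:]). proots (B - [:y:]))" .
  have "(\<Sum>w\<in>#(\<Sum>y\<in>#M. proots (B - [:y:])). f w) = (\<Sum>y\<in>#M. \<Sum>w\<in>#proots (B - [:y:]). f w)" for M
    by (induction M) auto
  moreover have "(\<Sum>y\<in>#M. g y / c) = (\<Sum>y\<in>#M. g y) / c" for M :: "complex multiset" and g :: "complex \<Rightarrow> complex" and c
    by (induction M) (auto simp: add_divide_distrib)
  ultimately show ?thesis by (simp add: root_mean_def eq degree_pcompose mult.commute)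
qed

end

section \<open>Balanced measures\<close>

lemma of_real_interval_borel: "complex_of_real ` {a<..<b} \<in> sets borel"
proof -
  have "complex_of_real ` {a<..<b} = {z. a < Re z} \<inter> {z. Re z < b} \<inter> {z. Im z = 0}"
    by (auto simp: image_iff complex_eq_iff intro!: bexI[of _ "Re _"])
  moreover have "open {z. a < Re z}" "open {z. Re z < b}" "closed {z. Im z = 0}"
    by (auto intro!: open_Collect_less closed_Collect_eq continuous_intros)
  ultimately show ?thesis by auto
qed

locale balanced = delta_map p for p :: real +
  fixes \<nu> :: "complex measure"
  assumes bal: "balanced_invariant_measure (R_Delta p) \<nu>"
begin

lemma sets_\<nu> [measurable_cong, simp]: "sets \<nu> = sets borel"
  using bal by (simp add: balanced_invariant_measure_def)

lemma space_\<nu> [simp]: "space \<nu> = UNIV"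
  using sets_eq_imp_space_eq[OF sets_\<nu>] by simp

lemma prob_space_\<nu>: "prob_space \<nu>"
  using bal by (simp add: balanced_invariant_measure_def)

sublocale \<nu>: prob_space \<nu>
  by (rule prob_space_\<nu>)

abbreviation "J \<equiv> filled_julia (R_Delta p)"

lemma D_measurable [measurable]: "D \<in> borel_measurable borel"
  unfolding D_def by (intro borel_measurable_continuous_onI continuous_intros)

lemma distr_D: "distr \<nu> borel D = \<nu>"
  using bal by (simp add: balanced_invariant_measure_def D_def)

lemma balanced_image:
  assumes "A \<in> sets borel" "inj_on D A"
  shows "emeasure \<nu> (D ` A) = 3 * emeasure \<nu> A"
  using bal assms by (simp add: balanced_invariant_measure_def D_def degree_R_Delta)

lemma AE_J: "AE z in \<nu>. z \<in> J"
proof (rule AE_I)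
  show "{z \<in> space \<nu>. z \<notin> J} \<subseteq> - julia (R_Delta p)" using julia_subset by auto
  show "emeasure \<nu> (- julia (R_Delta p)) = 0"
    using bal by (simp add: balanced_invariant_measure_def)
  show "- julia (R_Delta p) \<in> sets \<nu>" by (auto simp: julia_def)
qed

text \<open>D is injective on a singleton, so balance makes the mass at a fixed point equal to three
  times itself.\<close>

lemma fixpoint_null:
  assumes "D a = a"
  shows "AE z in \<nu>. z \<noteq> a"
proof (rule AE_I[where N = "{a}"])
  have "emeasure \<nu> {a} = 3 * emeasure \<nu> {a}" using balanced_image[of "{a}"] assms by simp
  moreover obtain r where r: "emeasure \<nu> {a} = ennreal r" "0 \<le> r"
    using \<nu>.emeasure_finite[of "{a}"] by (cases "emeasure \<nu> {a}") auto
  ultimately have "ennreal r = ennreal (3 * r)" by (simp add: ennreal_mult')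
  then have "r = 0" using r(2) by (subst (asm) ennreal_inj) auto
  then show "emeasure \<nu> {a} = 0" using r by simp
qed auto

text \<open>The endpoints 0 and 2 are fixed points and carry no mass. Without them every open lap is
  mapped bijectively onto \<open>I\<close>, also when the closed laps touch.\<close>

definition I :: "complex set" where "I = of_real ` {0<..<2}"

lemma I_borel: "I \<in> sets borel"
  unfolding I_def by (rule of_real_interval_borel)

lemma AE_I_set: "AE z in \<nu>. z \<in> I"
proof -
  have fp: "D 0 = 0" "D 2 = 2"
    using D_of_real[of 0] D_of_real[of 2] \<kappa>_pos by (simp_all add: Dr_def)
  show ?thesis
    using AE_J fixpoint_null[OF fp(1)] fixpoint_null[OF fp(2)]
  proof eventually_elim
    case (elim z)
    then obtain x where x: "x \<in> {0..2}" "z = of_real x" using filled_julia_real by blast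
    then have "x \<noteq> 0" "x \<noteq> 2" using elim by auto
    then show ?case using x by (auto simp: I_def)
  qed
qed

lemma emeasure_Int_I: "E \<in> sets borel \<Longrightarrow> emeasure \<nu> (E \<inter> I) = emeasure \<nu> E"
  using AE_I_set I_borel by (intro emeasure_eq_AE) auto

definition clap :: "real \<times> real \<Rightarrow> complex set" where
  "clap l = of_real ` {fst l<..<snd l}"

lemma clap_borel [measurable]: "clap l \<in> sets borel"
  unfolding clap_def by (rule of_real_interval_borel)

lemma Dr_eq_end:
  assumes "(a, b) \<in> laps" "x \<in> {a..b}" "Dr x \<in> {0<..<2}"
  shows "x \<in> {a<..<b}"
  using Dr_ends[OF assms(1)] assms(2,3) by (cases "x = a"; cases "x = b") auto

lemma D_image_clap:
  assumes "l \<in> laps"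
  shows "D ` (clap l \<inter> D -` E) = E \<inter> I"
proof -
  obtain a b where l: "l = (a, b)" by (cases l)
  show ?thesis
  proof
    show "D ` (clap l \<inter> D -` E) \<subseteq> E \<inter> I"
      using Dr_open_lap(1)[of a b] assms l by (auto simp: clap_def D_of_real I_def)
    show "E \<inter> I \<subseteq> D ` (clap l \<inter> D -` E)"
    proof
      fix z assume z: "z \<in> E \<inter> I"
      then obtain y where y: "z = of_real y" "y \<in> {0<..<2}" by (auto simp: I_def)
      then obtain x where x: "x \<in> {a..b}" "Dr x = y" using Dr_lap_surj[of a b y] assms l by auto
      then have "x \<in> {a<..<b}" using Dr_eq_end[of a b x] assms l y by auto
      then have "of_real x \<in> clap l \<inter> D -` E" "D (of_real x) = z"
        using x y z l by (auto simp: clap_def D_of_real)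
      then show "z \<in> D ` (clap l \<inter> D -` E)" by (metis imageI)
    qed
  qed
qed

lemma inj_on_clap:
  assumes "l \<in> laps"
  shows "inj_on D (clap l)"
  using Dr_lap_inj[of "fst l" "snd l"] assms by (auto simp: clap_def D_of_real inj_on_def)

text \<open>On the part of a lap above E the map is injective with image
  \<open>E \<inter> I\<close>, so balance gives each lap one third of the mass.\<close>

lemma emeasure_clap_vimage:
  assumes "l \<in> laps" "E \<in> sets borel"
  shows "3 * emeasure \<nu> (clap l \<inter> D -` E) = emeasure \<nu> E"
proof -
  have "clap l \<inter> D -` E \<in> sets borel"
    using measurable_sets[OF D_measurable assms(2)] by auto
  moreover have "inj_on D (clap l \<inter> D -` E)" using inj_on_clap[OF assms(1)] by (rule inj_on_subset) auto
  ultimately have "emeasure \<nu> (D ` (clap l \<inter> D -` E)) = 3 * emeasure \<nu> (clap l \<inter> D -` E)"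
    by (rule balanced_image)
  then show ?thesis by (simp add: D_image_clap[OF assms(1)] emeasure_Int_I[OF assms(2)])
qed

lemma distr_clap:
  assumes "l \<in> laps"
  shows "distr (density \<nu> (\<lambda>z. ennreal (indicator (clap l) z))) borel D = density \<nu> (\<lambda>_. ennreal (1/3))"
proof (rule measure_eqI)
  fix E assume "E \<in> sets (distr (density \<nu> (\<lambda>z. ennreal (indicator (clap l) z))) borel D)"
  then have E [measurable]: "E \<in> sets borel" by simp
  have DE: "D -` E \<in> sets borel" using measurable_sets[OF D_measurable E] by simp
  have "emeasure (distr (density \<nu> (\<lambda>z. ennreal (indicator (clap l) z))) borel D) E
    = emeasure (density \<nu> (\<lambda>z. ennreal (indicator (clap l) z))) (D -` E)"
    by (subst emeasure_distr) auto
  also have "\<dots> = (\<integral>\<^sup>+ z. ennreal (indicator (clap l) z) * indicator (D -` E) z \<partial>\<nu>)"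
    using DE by (subst emeasure_density) auto
  also have "\<dots> = (\<integral>\<^sup>+ z. indicator (clap l \<inter> D -` E) z \<partial>\<nu>)"
    by (intro nn_integral_cong) (auto simp: indicator_def)
  also have "\<dots> = emeasure \<nu> (clap l \<inter> D -` E)"
    using DE by (intro nn_integral_indicator) auto
  finally have "3 * emeasure (distr (density \<nu> (\<lambda>z. ennreal (indicator (clap l) z))) borel D) E = emeasure \<nu> E"
    using emeasure_clap_vimage[OF assms E] by simp
  moreover have "emeasure (density \<nu> (\<lambda>_. ennreal (1/3))) E = ennreal (1/3) * emeasure \<nu> E"
    by (subst emeasure_density_const) auto
  ultimately have "emeasure (density \<nu> (\<lambda>_. ennreal (1/3))) E
      = (ennreal (1/3) * 3) * emeasure (distr (density \<nu> (\<lambda>z. ennreal (indicator (clap l) z))) borel D) E"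
    by (simp only: mult.assoc)
  also have "ennreal (1/3) * 3 = 1"
    by (metis ennreal_1 ennreal_mult ennreal_numeral nonzero_eq_divide_eq zero_le_divide_1_iff zero_le_numeral zero_neq_numeral)
  finally show "emeasure (distr (density \<nu> (\<lambda>z. ennreal (indicator (clap l) z))) borel D) E = emeasure (density \<nu> (\<lambda>_. ennreal (1/3))) E"
    by simp
qed simp

lemma integral_clap:
  fixes g :: "complex \<Rightarrow> complex"
  assumes "l \<in> laps" and [measurable]: "g \<in> borel_measurable borel"
  shows "(\<integral>z. indicator (clap l) z *\<^sub>R g (D z) \<partial>\<nu>) = (1/3) *\<^sub>R (\<integral>z. g z \<partial>\<nu>)"
proof -
  have "(\<integral>z. indicator (clap l) z *\<^sub>R g (D z) \<partial>\<nu>) = (\<integral>z. g (D z) \<partial>density \<nu> (\<lambda>z. ennreal (indicator (clap l) z)))"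
    by (subst integral_density) auto
  also have "\<dots> = (\<integral>z. g z \<partial>distr (density \<nu> (\<lambda>z. ennreal (indicator (clap l) z))) borel D)"
    by (subst integral_distr) auto
  also have "\<dots> = (1/3) *\<^sub>R (\<integral>z. g z \<partial>\<nu>)"
    unfolding distr_clap[OF assms(1)] by (subst integral_density) auto
  finally show ?thesis .
qed

text \<open>Clamping the real part to [0, 2] makes the inverse of \<open>Dr\<close> on a lap
  continuous on the whole plane, which settles measurability.\<close>

definition branch :: "real \<times> real \<Rightarrow> complex \<Rightarrow> complex" where
  "branch l z = of_real (the_inv_into {fst l..snd l} Dr (max 0 (min 2 (Re z))))"

lemma Dr_image_lap: "(a, b) \<in> laps \<Longrightarrow> Dr ` {a..b} = {0..2}"
  using Dr_lap Dr_lap_surj by blast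

lemma continuous_branch:
  assumes "l \<in> laps"
  shows "continuous_on UNIV (branch l)"
proof -
  obtain a b where l: "l = (a, b)" by (cases l)
  have "continuous_on (Dr ` {a..b}) (the_inv_into {a..b} Dr)"
    by (rule continuous_on_inv)
       (use Dr_lap_inj[of a b] assms l in \<open>auto intro!: continuous_Dr continuous_intros simp: the_inv_into_f_f\<close>)
  then have "continuous_on {0..2} (the_inv_into {a..b} Dr)" using Dr_image_lap assms l by simp
  then have "continuous_on UNIV (\<lambda>z. the_inv_into {a..b} Dr (max 0 (min 2 (Re z))))"
    by (rule continuous_on_compose2) (auto intro!: continuous_intros)
  then show ?thesis unfolding branch_def l by (auto intro!: continuous_intros)
qed

lemma branch_range:
  assumes "l \<in> laps"
  shows "\<exists>x\<in>{0..2}. branch l z = of_real x"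
proof -
  obtain a b where l: "l = (a, b)" by (cases l)
  have "max 0 (min 2 (Re z)) \<in> Dr ` {a..b}" using Dr_image_lap assms l by simp
  then have "the_inv_into {a..b} Dr (max 0 (min 2 (Re z))) \<in> {a..b}"
    using Dr_lap_inj assms l by (intro the_inv_into_into) auto
  then show ?thesis using lap_bounds[of a b] assms l by (auto simp: branch_def)
qed

lemma branch_D:
  assumes "l \<in> laps" "z \<in> clap l"
  shows "branch l (D z) = z"
proof -
  obtain a b where l: "l = (a, b)" by (cases l)
  obtain x where x: "x \<in> {a<..<b}" "z = of_real x" using assms l by (auto simp: clap_def)
  have "Dr x \<in> {0<..<2}" using Dr_open_lap(1) assms l x by auto
  then have "max 0 (min 2 (Dr x)) = Dr x" by auto
  then show ?thesis using x Dr_lap_inj[of a b] assms l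
    by (simp add: branch_def D_of_real the_inv_into_f_f)
qed

lemma branch_in_clap:
  assumes "l \<in> laps" "z \<in> I"
  shows "branch l z \<in> clap l" "D (branch l z) = z"
proof -
  have "z \<in> D ` (clap l \<inter> D -` UNIV)" unfolding D_image_clap[OF assms(1)] using assms(2) by simp
  then show "branch l z \<in> clap l" "D (branch l z) = z" using branch_D[OF assms(1)] by auto
qed

lemma clap_disjoint: "l \<in> laps \<Longrightarrow> l' \<in> laps \<Longrightarrow> z \<in> clap l \<Longrightarrow> z \<in> clap l' \<Longrightarrow> l = l'"
  using q_pos q_le by (auto simp: laps_def clap_def)

lemma card_laps: "card laps = 3"
  using q_pos q_le by (auto simp: laps_def card_insert_if)

lemma root_mean_R_Delta:
  assumes "z \<in> I"
  shows "root_mean (R_Delta p) f z = (\<Sum>l\<in>laps. f (branch l z)) / 3"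
proof -
  have inj: "inj_on (\<lambda>l. branch l z) laps"
    by (rule inj_onI) (metis branch_in_clap(1)[OF _ assms] clap_disjoint)
  have "proots (R_Delta p - [:z:]) = mset_set ((\<lambda>l. branch l z) ` laps)"
  proof (rule proots_eq_mset_set)
    show "card ((\<lambda>l. branch l z) ` laps) = degree (R_Delta p - [:z:])"
      using degree_diff_const[of "R_Delta p" z] by (simp add: card_image[OF inj] card_laps degree_R_Delta)
    show "R_Delta p - [:z:] \<noteq> 0" using diff_const_neq_0[of "R_Delta p" z] by (simp add: degree_R_Delta)
    show "poly (R_Delta p - [:z:]) x = 0" if "x \<in> (\<lambda>l. branch l z) ` laps" for x
      using that branch_in_clap(2)[OF _ assms] by (auto simp: D_def)
  qed (simp add: finite_laps)
  then show ?thesis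
    by (simp add: root_mean_def degree_R_Delta sum_unfold_sum_mset[symmetric] sum.reindex[OF inj])
qed

text \<open>Invariance transfers \<open>AE_I_set\<close> to \<open>D z\<close>, and a point of
  [0, 2] whose image lies in the open interval is inside a lap.\<close>

lemma AE_unique_lap: "AE z in \<nu>. \<exists>l\<in>laps. z \<in> clap l"
proof -
  have "AE z in distr \<nu> borel D. z \<in> I" unfolding distr_D by (rule AE_I_set)
  then have "AE z in \<nu>. D z \<in> I" using I_borel by (subst (asm) AE_distr_iff) auto
  then show ?thesis using AE_J
  proof eventually_elim
    case (elim z)
    obtain x where x: "x \<in> {0..2}" "z = of_real x" using filled_julia_real elim by blast
    have Dx: "Dr x \<in> {0<..<2}" using elim x by (auto simp: D_of_real I_def)
    then obtain a b where ab: "(a, b) \<in> laps" "x \<in> {a..b}" using in_lap_if_Dr_mem[of x] x by auto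
    have "x \<in> {a<..<b}" by (rule Dr_eq_end[OF ab Dx])
    then show ?case using x ab by (intro bexI[of _ "(a, b)"]) (auto simp: clap_def)
  qed
qed

text \<open>Almost every z is the branch of \<open>D z\<close> on its own lap. Splitting over the
  laps, each piece is one third of the integral of f along that branch.\<close>

lemma integral_root_mean:
  fixes f :: "complex \<Rightarrow> complex"
  assumes f: "continuous_on UNIV f" and mean: "root_mean (R_Delta p) f \<in> borel_measurable borel"
  shows "(\<integral>z. f z \<partial>\<nu>) = (\<integral>z. root_mean (R_Delta p) f z \<partial>\<nu>)"
proof -
  have [measurable]: "f \<in> borel_measurable borel" using f by (rule borel_measurable_continuous_onI)
  have [measurable]: "branch l \<in> borel_measurable borel" if "l \<in> laps" for l
    using continuous_branch[OF that] by (rule borel_measurable_continuous_onI)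
  \<comment> \<open>f may be unbounded, but the branches take values in the compact segment
    [0, 2].\<close>
  have comp: "compact (f ` complex_of_real ` {0..2})"
    by (intro compact_continuous_image) (auto intro!: continuous_intros continuous_on_subset[OF f])
  then obtain B where B: "\<And>x. x \<in> {0..2} \<Longrightarrow> cmod (f (of_real x)) \<le> B"
    using compact_imp_bounded bounded_iff by (metis image_eqI)
  have hm: "(\<lambda>z. f (branch l z)) \<in> borel_measurable borel" if "l \<in> laps" for l
    using that by measurable
  have hint: "integrable \<nu> (\<lambda>z. f (branch l z))" if l: "l \<in> laps" for l
  proof (rule \<nu>.integrable_const_bound)
    show "AE z in \<nu>. cmod (f (branch l z)) \<le> B"
      using branch_range[OF l] B by (intro AE_I2) metis
  qed (use hm[OF l] in simp)
  have iint: "integrable \<nu> (\<lambda>z. indicator (clap l) z *\<^sub>R f (branch l (D z)))" if l: "l \<in> laps" for l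
  proof (rule \<nu>.integrable_const_bound)
    have B0: "0 \<le> B" using B[of 0] norm_ge_zero by (meson atLeastAtMost_iff order_refl order_trans zero_le_numeral)
    show "AE z in \<nu>. cmod (indicator (clap l) z *\<^sub>R f (branch l (D z))) \<le> B"
      using branch_range[OF l] B B0 by (intro AE_I2) (metis norm_scaleR abs_indicator indicator_simps mult_1 mult_zero_left)
  qed (use l in measurable)
  have "(\<integral>z. f z \<partial>\<nu>) = (\<integral>z. (\<Sum>l\<in>laps. indicator (clap l) z *\<^sub>R f (branch l (D z))) \<partial>\<nu>)"
  proof (rule integral_cong_AE)
    show "(\<lambda>z. \<Sum>l\<in>laps. indicator (clap l) z *\<^sub>R f (branch l (D z))) \<in> borel_measurable \<nu>"
      using iint by (intro borel_measurable_sum) auto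
    show "AE z in \<nu>. f z = (\<Sum>l\<in>laps. indicator (clap l) z *\<^sub>R f (branch l (D z)))"
      using AE_unique_lap
    proof eventually_elim
      case (elim z)
      then obtain l where l: "l \<in> laps" "z \<in> clap l" by blast
      have "(\<Sum>l\<in>laps. indicator (clap l) z *\<^sub>R f (branch l (D z))) = (\<Sum>l\<in>{l}. indicator (clap l) z *\<^sub>R f (branch l (D z)))"
      proof (rule sum.mono_neutral_right)
        have "z \<notin> clap l'" if "l' \<in> laps - {l}" for l' using clap_disjoint[OF _ l(1) _ l(2)] that by blast
        then show "\<forall>l'\<in>laps - {l}. indicator (clap l') z *\<^sub>R f (branch l' (D z)) = 0"
          by (simp add: indicator_def)
      qed (use l finite_laps in auto)
      then show ?case using branch_D[OF l] l by simp
    qed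
  qed simp
  also have "\<dots> = (\<Sum>l\<in>laps. (\<integral>z. indicator (clap l) z *\<^sub>R f (branch l (D z)) \<partial>\<nu>))"
    by (rule Bochner_Integration.integral_sum) (rule iint)
  also have "\<dots> = (\<Sum>l\<in>laps. (1/3) *\<^sub>R (\<integral>z. f (branch l z) \<partial>\<nu>))"
    by (intro sum.cong refl integral_clap hm)
  also have "\<dots> = (\<integral>z. (\<Sum>l\<in>laps. f (branch l z)) / 3 \<partial>\<nu>)"
  proof -
    have "(\<integral>z. (\<Sum>l\<in>laps. f (branch l z)) / 3 \<partial>\<nu>) = (\<Sum>l\<in>laps. (\<integral>z. f (branch l z) \<partial>\<nu>)) / 3"
      by (simp add: Bochner_Integration.integral_sum[OF hint])
    then show ?thesis by (simp add: sum_divide_distrib scaleR_conv_of_real)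
  qed
  also have "\<dots> = (\<integral>z. root_mean (R_Delta p) f z \<partial>\<nu>)"
  proof (rule integral_cong_AE)
    show "(\<lambda>z. (\<Sum>l\<in>laps. f (branch l z)) / 3) \<in> borel_measurable \<nu>"
      using hint by (intro borel_measurable_divide borel_measurable_sum) auto
    show "root_mean (R_Delta p) f \<in> borel_measurable \<nu>" using mean by simp
    show "AE z in \<nu>. (\<Sum>l\<in>laps. f (branch l z)) / 3 = root_mean (R_Delta p) f z"
      using AE_I_set by eventually_elim (simp add: root_mean_R_Delta)
  qed
  finally show ?thesis .
qed

text \<open>The pull-back of \<open>julia_approx\<close> with sets in place of points: each step
  divides mass and radius by 3, so positivity survives at every scale.\<close>

lemma \<nu>_near_pos:
  assumes "of_real y \<in> J" "pi / 3 ^ m < r"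
  shows "\<exists>A\<in>sets borel. A \<subseteq> of_real ` {x\<in>{0..2}. \<bar>\<theta> x - \<theta> y\<bar> < r} \<and> 0 < emeasure \<nu> A"
  using assms
proof (induction m arbitrary: y r)
  case 0
  have y: "y \<in> {0..2}" using 0(1) of_real_filled_julia[of y] by (auto dest: spec[of _ 0])
  have "emeasure \<nu> I = 1" by (rule \<nu>.emeasure_eq_1_AE[OF _ AE_I_set]) (simp add: I_borel)
  moreover have "I \<subseteq> of_real ` {x\<in>{0..2}. \<bar>\<theta> x - \<theta> y\<bar> < r}"
  proof
    fix z assume "z \<in> I"
    then obtain x where x: "x \<in> {0..2}" "z = of_real x" by (auto simp: I_def)
    then have "\<bar>\<theta> x - \<theta> y\<bar> < r" using \<theta>_dist_le_pi[OF x(1) y] 0(2) by simp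
    then show "z \<in> of_real ` {x\<in>{0..2}. \<bar>\<theta> x - \<theta> y\<bar> < r}" using x by blast
  qed
  ultimately show ?case using I_borel by (intro bexI[of _ I]) auto
next
  case (Suc m)
  have y: "y \<in> {0..2}" "Dr y \<in> {0..2}"
    using Suc.prems spec[of "\<lambda>m. (Dr ^^ m) y \<in> {0..2}" 0] spec[of "\<lambda>m. (Dr ^^ m) y \<in> {0..2}" 1]
    by (auto simp: of_real_filled_julia)
  obtain a b where ab: "(a, b) \<in> laps" "y \<in> {a..b}" using in_lap_if_Dr_mem[OF y] by auto
  have "of_real (Dr y) \<in> J" using D_filled_julia[OF Suc.prems(1)] by (simp add: D_of_real)
  moreover have "pi / 3 ^ m < 3 * r" using Suc.prems(2) by (simp add: field_simps)
  ultimately obtain A where A: "A \<in> sets borel" "A \<subseteq> of_real ` {x\<in>{0..2}. \<bar>\<theta> x - \<theta> (Dr y)\<bar> < 3 * r}" "0 < emeasure \<nu> A"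
    using Suc.IH by blast
  let ?A = "clap (a, b) \<inter> D -` A"
  have "?A \<in> sets borel" using measurable_sets[OF D_measurable A(1)] by auto
  moreover have "0 < emeasure \<nu> ?A" using emeasure_clap_vimage[OF ab(1) A(1)] A(3) by (metis mult_zero_right zero_less_iff_neq_zero)
  moreover have "?A \<subseteq> of_real ` {x\<in>{0..2}. \<bar>\<theta> x - \<theta> y\<bar> < r}"
  proof
    fix z assume z: "z \<in> ?A"
    then obtain x where x: "x \<in> {a<..<b}" "z = of_real x" by (auto simp: clap_def)
    have "of_real (Dr x) \<in> A" using z x by (simp add: D_of_real)
    then have "\<bar>\<theta> (Dr x) - \<theta> (Dr y)\<bar> < 3 * r" using A(2) by auto
    then have "\<bar>\<theta> x - \<theta> y\<bar> < r" using lap_expansion[OF ab(1) _ ab(2), of x] x by auto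
    then show "z \<in> of_real ` {x\<in>{0..2}. \<bar>\<theta> x - \<theta> y\<bar> < r}" using x lap_bounds[OF ab(1)] by auto
  qed
  ultimately show ?case by blast
qed

lemma integral_root_mean_W:
  assumes "0 < degree R"
  shows "(\<integral>z. root_mean (W R m) (poly f) z \<partial>\<nu>) = (\<integral>z. root_mean R (poly f) z \<partial>\<nu>)"
proof (induction m)
  case (Suc m)
  have dW: "0 < degree (W R m)" using assms by (simp add: degree_W)
  obtain g where g: "\<And>x. root_mean (W R m) (poly f) x = poly g x" using root_mean_poly[OF dW] by blast
  have gg: "root_mean (W R m) (poly f) = poly g" using g by auto
  have "root_mean (W R (Suc m)) (poly f) z = root_mean (R_Delta p) (poly g) z" for z
    unfolding W_Suc gg[symmetric] by (rule root_mean_pcompose) (simp_all add: degree_R_Delta dW)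
  note this
  moreover have "(\<integral>z. root_mean (W R (Suc m)) (poly f) z \<partial>\<nu>) = (\<integral>z. poly g z \<partial>\<nu>)"
    if "\<And>z. root_mean (W R (Suc m)) (poly f) z = root_mean (R_Delta p) (poly g) z"
  proof -
    obtain g' where "\<And>x. root_mean (R_Delta p) (poly g) x = poly g' x"
      using root_mean_poly[of "R_Delta p" g] by (auto simp: degree_R_Delta)
    then have "root_mean (R_Delta p) (poly g) = poly g'" by auto
    then have "root_mean (R_Delta p) (poly g) \<in> borel_measurable borel"
      by (auto intro!: borel_measurable_continuous_onI continuous_intros)
    then show ?thesis using integral_root_mean[of "poly g"] that by (simp add: continuous_intros)
  qed
  ultimately show ?case using Suc gg by simp
qed (simp add: W_0)

text \<open>The mean is a polynomial of degree 0 in x; its value is found by integrating, since the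
  integral of the mean does not depend on m.\<close>

lemma root_mean_W_eq_integral:
  assumes "0 < degree R" "degree f < degree (W R m)"
  shows "root_mean (W R m) (poly f) x = (\<integral>z. root_mean R (poly f) z \<partial>\<nu>)"
proof -
  have dW: "0 < degree (W R m)" using assms by simp
  obtain g where g: "degree g * degree (W R m) \<le> degree f" "\<And>x. root_mean (W R m) (poly f) x = poly g x"
    using root_mean_poly[OF dW] by blast
  have "degree g = 0" using g(1) assms(2) by (cases "degree g") auto
  then obtain c where c: "g = [:c:]" by (elim degree_eq_zeroE)
  have "(\<integral>z. root_mean R (poly f) z \<partial>\<nu>) = c"
    unfolding integral_root_mean_W[OF assms(1), of m, symmetric] g(2) c using \<nu>.prob_space by simp
  then show ?thesis unfolding g(2) c by simp
qed

end

section \<open>The density of states\<close>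

text \<open>\<open>measure_of\<close> returns the given set function only if that is countably
  additive; agreement with a genuine measure on Borel sets settles this for \<open>dos_trunc\<close>
  and \<open>limit_dos\<close>.\<close>

lemma measure_of_borel_eqI:
  fixes M :: "complex measure"
  assumes "sets M = sets borel" "\<And>E. E \<in> sets borel \<Longrightarrow> \<mu> E = emeasure M E"
  shows "measure_of UNIV (sets borel) \<mu> = M"
proof -
  have sp: "space M = UNIV" using sets_eq_imp_space_eq[OF assms(1)] by simp
  have "measure_of UNIV (sets borel) \<mu> = measure_of UNIV (sets borel) (emeasure M)"
  proof (rule measure_of_eq)
    fix a :: "complex set" assume "a \<in> sigma_sets UNIV (sets borel)"
    then have "a \<in> sets borel" by (metis sets.sigma_sets_eq space_borel)
    then show "\<mu> a = emeasure M a" by (rule assms(2))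
  qed simp
  also have "\<dots> = M" using measure_of_of_measure[of M] by (simp add: sp assms(1))
  finally show ?thesis .
qed

lemma dos_trunc_eq_distr:
  assumes "finite (trunc_spectrum p V N)" "card (trunc_spectrum p V N) = Suc N"
  shows "dos_trunc p V N = distr (measure_pmf (pmf_of_set (trunc_spectrum p V N))) borel (\<lambda>z. z)"
  unfolding dos_trunc_def
proof (rule measure_of_borel_eqI)
  have ne: "trunc_spectrum p V N \<noteq> {}" using assms(2) by auto
  fix E :: "complex set" assume E: "E \<in> sets borel"
  have "emeasure (distr (measure_pmf (pmf_of_set (trunc_spectrum p V N))) borel (\<lambda>z. z)) E
    = emeasure (measure_pmf (pmf_of_set (trunc_spectrum p V N))) E"
    using E by (subst emeasure_distr) auto
  also have "\<dots> = ennreal (real (card (trunc_spectrum p V N \<inter> E)) / real (card (trunc_spectrum p V N)))"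
    by (rule emeasure_pmf_of_set[OF ne assms(1)])
  finally show "ennreal (real (card (E \<inter> trunc_spectrum p V N)) / (real N + 1))
    = emeasure (distr (measure_pmf (pmf_of_set (trunc_spectrum p V N))) borel (\<lambda>z. z)) E"
    by (simp add: assms(2) Int_commute add.commute)
qed simp

lemma integral_dos_trunc:
  fixes f :: "complex \<Rightarrow> real"
  assumes "finite (trunc_spectrum p V N)" "card (trunc_spectrum p V N) = Suc N" "f \<in> borel_measurable borel"
  shows "integral\<^sup>L (dos_trunc p V N) f = (\<Sum>z\<in>trunc_spectrum p V N. f z) / (real N + 1)"
proof -
  have ne: "trunc_spectrum p V N \<noteq> {}" using assms(2) by auto
  have "integral\<^sup>L (dos_trunc p V N) f = integral\<^sup>L (measure_pmf (pmf_of_set (trunc_spectrum p V N))) f"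
    unfolding dos_trunc_eq_distr[OF assms(1,2)] using assms(3) by (subst integral_distr) auto
  also have "\<dots> = (\<Sum>z\<in>trunc_spectrum p V N. f z) / real (card (trunc_spectrum p V N))"
    by (rule integral_pmf_of_set[OF ne assms(1)])
  finally show ?thesis by (simp add: assms(2) add.commute)
qed

lemma poly_map_poly_complex_of_real:
  "poly (map_poly complex_of_real r) (of_real t) = of_real (poly r t)"
  by (induction r) (auto simp: map_poly_pCons)

locale decimated_dos = decimated p V n R + balanced p \<nu>
  for p :: real and V :: "nat \<Rightarrow> real" and n :: nat and R :: "complex poly" and \<nu> :: "complex measure" +
  fixes S :: "nat \<Rightarrow> complex \<Rightarrow> complex"
  assumes branches: "inverse_branches R (degree R) (filled_julia (R_Delta p)) S"
begin

definition "B = {1..degree R}"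

lemma B_finite_ne: "finite B" "B \<noteq> {}" "card B = degree R"
  using degree_R by (auto simp: B_def)

lemma S_measurable: "i \<in> B \<Longrightarrow> S i \<in> borel_measurable borel"
  using branches by (simp add: inverse_branches_def B_def)

lemma S_proots:
  assumes "x \<in> J"
  shows "image_mset (\<lambda>i. S i x) (mset_set B) = proots (R - [:x:])"
proof (rule multiset_eqI)
  fix w
  show "count (image_mset (\<lambda>i. S i x) (mset_set B)) w = count (proots (R - [:x:])) w"
    using branches assms diff_const_neq_0[OF degree_R] by (simp add: inverse_branches_def B_def)
qed

lemma sum_S:
  assumes "x \<in> J"
  shows "(\<Sum>i\<in>B. f (S i x)) / of_nat (degree R) = root_mean R f x"
proof -
  have "(\<Sum>i\<in>B. f (S i x)) = (\<Sum>w\<in>#image_mset (\<lambda>i. S i x) (mset_set B). f w)"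
    by (simp add: sum_unfold_sum_mset image_mset.compositionality o_def)
  then show ?thesis by (simp add: S_proots[OF assms] root_mean_def)
qed

lemma S_image: "x \<in> J \<Longrightarrow> (\<lambda>i. S i x) ` B = {w. poly R w = x}"
  using arg_cong[OF S_proots, of x set_mset] diff_const_neq_0[OF degree_R] B_finite_ne(1) by simp

lemma S_in_F:
  assumes "x \<in> J" "i \<in> B"
  shows "S i x \<in> F"
proof -
  have "poly R (S i x) = x" using S_image[OF assms(1)] assms(2) by blast
  then show ?thesis using assms(1) by (simp add: F_def)
qed

definition \<mu> :: "complex measure" where
  "\<mu> = limit_dos (degree R) S \<nu> J"

text \<open>A uniformly chosen branch index with an independent \<nu>-distributed point; \<mu> is
  the law of the value of the chosen branch.\<close>

definition pr :: "(nat \<times> complex) measure" where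
  "pr = measure_pmf (pmf_of_set B) \<Otimes>\<^sub>M \<nu>"

text \<open>Nothing is known of \<open>S i\<close> for i outside \<open>B\<close>; the value 0 makes
  the map measurable on the whole product.\<close>

definition S' :: "nat \<times> complex \<Rightarrow> complex" where
  "S' = (\<lambda>(i, x). if i \<in> B then S i x else 0)"

lemma S'_measurable: "S' \<in> borel_measurable pr"
proof -
  have "S' \<in> borel_measurable (count_space UNIV \<Otimes>\<^sub>M \<nu>)"
  proof (rule measurable_pair_measure_countable1)
    show "(\<lambda>y. S' (i, y)) \<in> borel_measurable \<nu>" for i
      using S_measurable[of i] by (cases "i \<in> B") (simp_all add: S'_def)
  qed simp
  moreover have "sets pr = sets (count_space UNIV \<Otimes>\<^sub>M \<nu>)"
    unfolding pr_def by (rule sets_pair_measure_cong) simp_all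
  ultimately show ?thesis by (simp cong: measurable_cong_sets)
qed

lemma emeasure_distr_S':
  assumes E: "E \<in> sets borel"
  shows "emeasure (distr pr borel S') E = ennreal (1 / real (degree R)) * (\<Sum>i\<in>B. emeasure \<nu> (S i -` E))"
proof -
  have sp: "space pr = UNIV" by (simp add: pr_def space_pair_measure)
  have m: "S' -` E \<in> sets pr" using measurable_sets[OF S'_measurable E] sp by simp
  have "emeasure (distr pr borel S') E = emeasure pr (S' -` E)"
    using E S'_measurable sp by (subst emeasure_distr) auto
  also have "\<dots> = (\<integral>\<^sup>+ i. emeasure \<nu> (Pair i -` (S' -` E)) \<partial>measure_pmf (pmf_of_set B))"
    unfolding pr_def by (rule \<nu>.emeasure_pair_measure_alt) (use m in \<open>simp add: pr_def\<close>)
  also have "\<dots> = (\<Sum>i\<in>B. emeasure \<nu> (Pair i -` (S' -` E))) / ennreal (real (degree R))"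
    using nn_integral_pmf_of_set[OF B_finite_ne(2,1)] B_finite_ne(3) by (simp add: ennreal_of_nat_eq_real_of_nat)
  also have "(\<Sum>i\<in>B. emeasure \<nu> (Pair i -` (S' -` E))) = (\<Sum>i\<in>B. emeasure \<nu> (S i -` E))"
    by (intro sum.cong refl arg_cong[of _ _ "emeasure \<nu>"]) (auto simp: S'_def)
  also have "X / ennreal (real (degree R)) = ennreal (1 / real (degree R)) * X" for X
  proof -
    have "ennreal (1 / real (degree R)) = inverse (ennreal (real (degree R)))"
      using degree_R by (simp add: inverse_ennreal inverse_eq_divide)
    then show ?thesis by (simp add: divide_ennreal_def mult.commute)
  qed
  finally show ?thesis .
qed

lemma \<mu>_eq_distr: "\<mu> = distr pr borel S'"
  unfolding \<mu>_def limit_dos_def B_def[symmetric]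
proof (rule measure_of_borel_eqI)
  fix E :: "complex set" assume E: "E \<in> sets borel"
  have "(\<integral>\<^sup>+ x. indicator E (S i x) * indicator J x \<partial>\<nu>) = emeasure \<nu> (S i -` E)" if i: "i \<in> B" for i
  proof -
    have "(\<integral>\<^sup>+ x. indicator E (S i x) * indicator J x \<partial>\<nu>) = (\<integral>\<^sup>+ x. indicator (S i -` E) x \<partial>\<nu>)"
    proof (rule nn_integral_cong_AE)
      show "AE x in \<nu>. indicator E (S i x) * indicator J x = (indicator (S i -` E) x :: ennreal)"
        using AE_J by eventually_elim (simp add: indicator_def)
    qed
    also have "\<dots> = emeasure \<nu> (S i -` E)"
      using measurable_sets[OF S_measurable[OF i] E] by simp
    finally show ?thesis .
  qed
  then show "ennreal (1 / real (degree R)) * (\<Sum>i\<in>B. \<integral>\<^sup>+ x. indicator E (S i x) * indicator J x \<partial>\<nu>)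
    = emeasure (distr pr borel S') E"
    unfolding emeasure_distr_S'[OF E] by simp
qed simp

lemma emeasure_\<mu>:
  "E \<in> sets borel \<Longrightarrow> emeasure \<mu> E = ennreal (1 / real (degree R)) * (\<Sum>i\<in>B. emeasure \<nu> (S i -` E))"
  unfolding \<mu>_eq_distr by (rule emeasure_distr_S')

lemma integral_\<mu>:
  fixes f :: "complex \<Rightarrow> 'b::{banach, second_countable_topology}"
  assumes f [measurable]: "f \<in> borel_measurable borel" and bd: "\<And>z. norm (f z) \<le> C"
  shows "integral\<^sup>L \<mu> f = (1 / real (degree R)) *\<^sub>R (\<Sum>i\<in>B. \<integral>x. f (S i x) \<partial>\<nu>)"
proof -
  interpret pp: pair_prob_space "measure_pmf (pmf_of_set B)" \<nu>
    by unfold_locales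
  note S'_measurable [measurable]
  have int: "integrable pr (\<lambda>y. f (S' y))"
    unfolding pr_def
    by (rule pp.integrable_const_bound[where B = C])
       (use bd in \<open>auto simp flip: pr_def intro!: measurable_compose[OF S'_measurable f]\<close>)
  have "integral\<^sup>L \<mu> f = (\<integral>y. f (S' y) \<partial>pr)"
    unfolding \<mu>_eq_distr by (rule integral_distr[OF S'_measurable f])
  also have "\<dots> = (\<integral>i. (\<integral>x. f (S' (i, x)) \<partial>\<nu>) \<partial>measure_pmf (pmf_of_set B))"
    unfolding pr_def by (rule pp.integral_fst'[symmetric]) (use int in \<open>simp add: pr_def\<close>)
  also have "\<dots> = (\<Sum>i\<in>B. pmf (pmf_of_set B) i *\<^sub>R (\<integral>x. f (S' (i, x)) \<partial>\<nu>))"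
    by (rule integral_measure_pmf) (use B_finite_ne in auto)
  also have "\<dots> = (\<Sum>i\<in>B. (1 / real (degree R)) *\<^sub>R (\<integral>x. f (S i x) \<partial>\<nu>))"
    using B_finite_ne by (intro sum.cong refl) (simp add: S'_def)
  finally show ?thesis by (simp only: scaleR_sum_right)
qed

text \<open>Almost every branch value lies in the closed set \<open>F\<close>, which gives one
  inclusion. Conversely, the points near \<open>poly R c\<close> have positive mass, and each has a
  root near c that some branch hits; so one branch hits U with positive mass.\<close>

lemma measure_support_\<mu>: "measure_support \<mu> = F"
proof
  show "measure_support \<mu> \<subseteq> F"
  proof
    fix c assume c: "c \<in> measure_support \<mu>"
    show "c \<in> F"
    proof (rule ccontr)
      assume "c \<notin> F"
      have U: "open (- F)" using closed_F by (simp add: open_Compl)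
      have "emeasure \<nu> (S i -` (- F)) = 0" if i: "i \<in> B" for i
      proof -
        have "AE x in \<nu>. x \<notin> S i -` (- F)" using AE_J by eventually_elim (use S_in_F i in auto)
        moreover have "S i -` (- F) \<in> sets \<nu>" using measurable_sets[OF S_measurable[OF i], of "- F"] U by simp
        moreover have "{x \<in> space \<nu>. \<not> x \<notin> S i -` (- F)} = S i -` (- F)" by auto
        ultimately show ?thesis using AE_iff_measurable[of "S i -` (- F)" \<nu> "\<lambda>x. x \<notin> S i -` (- F)"] by blast
      qed
      then have "emeasure \<mu> (- F) = 0" using U by (subst emeasure_\<mu>) auto
      then show False using c U \<open>c \<notin> F\<close> by (auto simp: measure_support_def)
    qed
  qed
  show "F \<subseteq> measure_support \<mu>"
  proof
    fix c assume c: "c \<in> F"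
    have "0 < emeasure \<mu> U" if U: "open U" "c \<in> U" for U
    proof -
      obtain y where y: "poly R c = of_real y" "of_real y \<in> J" "y \<in> {0..2}"
        using c filled_julia_real[of "poly R c"] unfolding F_def by (metis mem_Collect_eq)
      obtain \<epsilon> where \<epsilon>: "0 < \<epsilon>" "ball c \<epsilon> \<subseteq> U" using U open_contains_ball by blast
      obtain \<delta> where \<delta>: "0 < \<delta>" "\<And>x. cmod (poly R c - x) < \<delta> \<Longrightarrow> \<exists>w. dist c w < \<epsilon> \<and> poly R w = x"
        using root_near[OF \<epsilon>(1)] by blast
      obtain m where "pi / \<delta> < 3 ^ m" using real_arch_pow[of 3 "pi / \<delta>"] by auto
      then have "pi / 3 ^ m < \<delta>" using \<delta>(1) by (simp add: field_simps)
      from \<nu>_near_pos[OF y(2) this] obtain A where A: "A \<in> sets borel"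
        "A \<subseteq> of_real ` {x\<in>{0..2}. \<bar>\<theta> x - \<theta> y\<bar> < \<delta>}" "0 < emeasure \<nu> A" by blast
      have Sm: "S i -` U \<in> sets \<nu>" if "i \<in> B" for i
        using measurable_sets[OF S_measurable[OF that], of U] U(1) by simp
      have "AE x in \<nu>. x \<in> A \<longrightarrow> x \<in> (\<Union>i\<in>B. S i -` U)"
        using AE_J
      proof eventually_elim
        case (elim x)
        show ?case
        proof
          assume "x \<in> A"
          then obtain t where t: "x = of_real t" "t \<in> {0..2}" "\<bar>\<theta> t - \<theta> y\<bar> < \<delta>" using A(2) by auto
          have "cmod (poly R c - x) = \<bar>y - t\<bar>" unfolding y(1) t(1) by (simp flip: of_real_diff)
          also have "\<dots> < \<delta>" using dist_le_\<theta>[OF t(2) y(3)] t(3) by (simp add: abs_minus_commute)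
          finally obtain w where w: "dist c w < \<epsilon>" "poly R w = x" using \<delta>(2) by blast
          then obtain i where "i \<in> B" "w = S i x" using S_image[OF elim] by blast
          then show "x \<in> (\<Union>i\<in>B. S i -` U)" using w \<epsilon>(2) by auto
        qed
      qed
      then have "emeasure \<nu> A \<le> emeasure \<nu> (\<Union>i\<in>B. S i -` U)"
        using Sm B_finite_ne(1) by (intro emeasure_mono_AE sets.finite_UN) auto
      also have "\<dots> \<le> (\<Sum>i\<in>B. emeasure \<nu> (S i -` U))"
        using Sm B_finite_ne(1) by (intro emeasure_subadditive_finite) auto
      finally have pos: "0 < (\<Sum>i\<in>B. emeasure \<nu> (S i -` U))" using A(3) by (rule less_le_trans[rotated])
      have "0 < ennreal (1 / real (degree R))" using degree_R by simp
      then show ?thesis using pos U(1) by (subst emeasure_\<mu>) (auto simp: ennreal_zero_less_mult_iff)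
    qed
    then show "c \<in> measure_support \<mu>" by (simp add: measure_support_def)
  qed
qed

lemma F_interval: obtains C where "0 < C" "\<And>z. z \<in> F \<Longrightarrow> z = of_real (Re z) \<and> \<bar>Re z\<bar> \<le> C"
proof -
  obtain C where C: "0 < C" "\<And>z. z \<in> F \<Longrightarrow> cmod z \<le> C" using bounded_F by (auto simp: bounded_pos)
  have "z = of_real (Re z) \<and> \<bar>Re z\<bar> \<le> C" if "z \<in> F" for z
    using C(2)[OF that] abs_Re_le_cmod[of z] F_real that by (auto simp: complex_is_Real_iff complex_eq_iff)
  then show thesis using that C(1) by blast
qed

lemma AE_S_F: "i \<in> B \<Longrightarrow> AE x in \<nu>. S i x \<in> F"
  using AE_J by eventually_elim (rule S_in_F)

lemma trunc_card:
  assumes "0 < N"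
  shows "finite (trunc_spectrum p V N)" "card (trunc_spectrum p V N) = Suc N"
proof -
  obtain a :: "nat \<Rightarrow> real" where a: "strict_mono_on {..N} a" "trunc_spectrum p V N = (\<lambda>i. complex_of_real (a i)) ` {..N}"
    by (rule trunc_interlacing[OF assms]) blast
  have "inj_on (\<lambda>i. complex_of_real (a i)) {..N}"
    using strict_mono_on_imp_inj_on[OF a(1)] by (auto simp: inj_on_def)
  then show "finite (trunc_spectrum p V N)" "card (trunc_spectrum p V N) = Suc N"
    unfolding a(2) by (simp_all add: card_image)
qed

lemma degree_W_eq: "degree (W R m) = 3 ^ (n + m)"
proof -
  have d: "0 < degree (W R m)" using degree_R by (simp add: degree_W)
  have "degree (P (3 ^ (n + m)) :: complex poly) = degree (W R m - [:1:])"
    unfolding P_pow3 by (metis degree_minus minus_diff_eq one_pCons)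
  then show ?thesis using degree_diff_const[OF d, of 1] by simp
qed

text \<open>Over the zeros \<open>b i\<close> the average of r is exactly \<open>avg\<close>.
  Passing to the eigenvalue \<open>a i\<close> costs at most K times \<open>a (Suc i) - a i\<close>,
  and these gaps sum to at most 2 C. The last eigenvalue, which has no partner, and the
  normalisation cost at most M each.\<close>

lemma dos_polynomial_bound:
  fixes r :: "real poly"
  assumes C: "0 < C" "\<And>z. z \<in> F \<Longrightarrow> z = of_real (Re z) \<and> \<bar>Re z\<bar> \<le> C"
    and deg: "degree r < 3 ^ (n + m)"
    and M: "\<And>t. \<bar>t\<bar> \<le> C \<Longrightarrow> \<bar>poly r t\<bar> \<le> M" "\<And>t. \<bar>t\<bar> \<le> C \<Longrightarrow> \<bar>poly (pderiv r) t\<bar> \<le> K"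
    and avg: "complex_of_real avg = (\<integral>z. root_mean R (poly (map_poly of_real r)) z \<partial>\<nu>)"
  shows "\<bar>(\<Sum>z\<in>trunc_spectrum p V (3 ^ (n + m)). poly r (Re z)) / (3 ^ (n + m) + 1) - avg\<bar>
    \<le> (2 * C * K + 2 * M) / (3 ^ (n + m) + 1)"
proof -
  let ?N = "3 ^ (n + m) :: nat"
  have N0: "0 < ?N" by simp
  obtain a b :: "nat \<Rightarrow> real" where ab: "strict_mono_on {..?N} a" "strict_mono_on {..<?N} b"
    "trunc_spectrum p V ?N = (\<lambda>i. complex_of_real (a i)) ` {..?N}"
    "proots (P ?N) = mset_set ((\<lambda>i. complex_of_real (b i)) ` {..<?N})"
    "\<And>i. i < ?N \<Longrightarrow> a i < b i" "\<And>i. i < ?N \<Longrightarrow> b i < a (Suc i)"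
    by (rule trunc_interlacing[OF N0]) blast
  have a_bd: "\<bar>a i\<bar> \<le> C" if "i \<le> ?N" for i
  proof -
    have "of_real (a i) \<in> F" using trunc_spectrum_subset_F[of "n + m"] ab(3) that by auto
    then show ?thesis using C(2)[of "of_real (a i)"] by simp
  qed
  have b_bd: "\<bar>b i\<bar> \<le> C" if "i < ?N" for i
    using a_bd[of i] a_bd[of "Suc i"] ab(5,6)[of i] that by (simp add: abs_le_iff)
  have inja: "inj_on (\<lambda>i. complex_of_real (a i)) {..?N}"
    using strict_mono_on_imp_inj_on[OF ab(1)] by (auto simp: inj_on_def)
  have injb: "inj_on (\<lambda>i. complex_of_real (b i)) {..<?N}"
    using strict_mono_on_imp_inj_on[OF ab(2)] by (auto simp: inj_on_def)
  let ?rc = "map_poly complex_of_real r"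
  have rc: "poly ?rc (of_real t) = of_real (poly r t)" for t
    by (rule poly_map_poly_complex_of_real)
  \<comment> \<open>The zeros of \<open>1 - W R m\<close> are the roots of \<open>W R m\<close> over
    the value 1, so \<open>root_mean\<close> at 1 averages over them.\<close>
  have "proots (W R m - [:1:]) = proots (P ?N)"
    unfolding P_pow3 by (metis minus_diff_eq one_pCons proots_uminus)
  then have "root_mean (W R m) (poly ?rc) 1 = (\<Sum>i<?N. of_real (poly r (b i))) / of_nat ?N"
    by (simp add: rc root_mean_def ab(4) degree_W_eq sum_unfold_sum_mset[symmetric] sum.reindex[OF injb])
  moreover have "root_mean (W R m) (poly ?rc) 1 = (\<integral>z. root_mean R (poly ?rc) z \<partial>\<nu>)"
    by (rule root_mean_W_eq_integral[OF degree_R]) (use deg in \<open>simp add: degree_W_eq degree_map_poly\<close>)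
  ultimately have "complex_of_real avg = of_real ((\<Sum>i<?N. poly r (b i)) / real ?N)" using avg by simp
  then have Ib: "real ?N * avg = (\<Sum>i<?N. poly r (b i))" by (simp only: of_real_eq_iff) simp
  have I_bd: "\<bar>avg\<bar> \<le> M"
  proof -
    have "real ?N * \<bar>avg\<bar> = \<bar>\<Sum>i<?N. poly r (b i)\<bar>" unfolding Ib[symmetric] by (simp add: abs_mult)
    also have "\<dots> \<le> (\<Sum>i<?N. \<bar>poly r (b i)\<bar>)" by (rule sum_abs)
    also have "\<dots> \<le> (\<Sum>i<?N. M)" using M(1) b_bd by (intro sum_mono) auto
    finally have "real ?N * \<bar>avg\<bar> \<le> real ?N * M" by simp
    then show ?thesis using N0 by (simp only: mult_le_cancel_left_pos of_nat_0_less_iff)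
  qed
  have lip: "\<bar>poly r (a i) - poly r (b i)\<bar> \<le> K * (a (Suc i) - a i)" if i: "i < ?N" for i
  proof -
    obtain t where t: "a i < t" "t < b i" "poly r (b i) - poly r (a i) = (b i - a i) * poly (pderiv r) t"
      using poly_MVT[OF ab(5)[OF i]] by blast
    have "\<bar>t\<bar> \<le> C" using t a_bd[of i] b_bd[of i] i by (auto simp: abs_le_iff)
    then have K: "\<bar>poly (pderiv r) t\<bar> \<le> K" by (rule M(2))
    have "\<bar>poly r (a i) - poly r (b i)\<bar> = (b i - a i) * \<bar>poly (pderiv r) t\<bar>"
      unfolding abs_minus_commute[of "poly r (a i)"] t(3) abs_mult using ab(5)[OF i] by simp
    also have "\<dots> \<le> (a (Suc i) - a i) * K"
      using ab(5,6)[OF i] K by (intro mult_mono) auto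
    finally show ?thesis by (simp add: mult.commute)
  qed
  have K0: "0 \<le> K" using M(2)[of 0] C(1) by simp
  have "(\<Sum>z\<in>trunc_spectrum p V ?N. poly r (Re z)) = (\<Sum>i\<le>?N. poly r (a i))"
    unfolding ab(3) by (simp add: sum.reindex[OF inja])
  also have "\<dots> = (\<Sum>i<?N. poly r (a i)) + poly r (a ?N)"
    by (simp add: lessThan_Suc_atMost[symmetric])
  finally have "(\<Sum>z\<in>trunc_spectrum p V ?N. poly r (Re z)) - (real ?N + 1) * avg
     = (\<Sum>i<?N. poly r (a i) - poly r (b i)) + poly r (a ?N) - avg"
    by (simp only: distrib_right Ib sum_subtractf)
  also have "\<bar>\<dots>\<bar> \<le> (\<Sum>i<?N. \<bar>poly r (a i) - poly r (b i)\<bar>) + M + M"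
    using sum_abs[of "\<lambda>i. poly r (a i) - poly r (b i)" "{..<?N}"] M(1)[OF a_bd[of ?N]] I_bd by linarith
  also have "(\<Sum>i<?N. \<bar>poly r (a i) - poly r (b i)\<bar>) \<le> (\<Sum>i<?N. K * (a (Suc i) - a i))"
    using lip by (intro sum_mono) auto
  also have "\<dots> = K * (a ?N - a 0)" by (simp only: sum_distrib_left[symmetric] sum_lessThan_telescope)
  also have "\<dots> \<le> K * (2 * C)" using a_bd[of 0] a_bd[of ?N] K0 by (intro mult_left_mono) (auto simp: abs_le_iff)
  finally have "\<bar>(\<Sum>z\<in>trunc_spectrum p V ?N. poly r (Re z)) - (real ?N + 1) * avg\<bar> \<le> 2 * C * K + 2 * M"
    by (simp add: mult_ac)
  then have "\<bar>(\<Sum>z\<in>trunc_spectrum p V ?N. poly r (Re z)) - (real ?N + 1) * avg\<bar> / (real ?N + 1) \<le> (2 * C * K + 2 * M) / (real ?N + 1)"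
    by (rule divide_right_mono) simp
  moreover have "\<bar>X - (real ?N + 1) * avg\<bar> / (real ?N + 1) = \<bar>X / (real ?N + 1) - avg\<bar>" for X
  proof -
    have pos: "0 < real ?N + 1" by linarith
    then have "X / (real ?N + 1) - avg = (X - (real ?N + 1) * avg) / (real ?N + 1)"
      unfolding diff_divide_distrib by (metis less_irrefl nonzero_mult_div_cancel_left)
    then show ?thesis by (simp only: abs_divide abs_of_pos[OF pos])
  qed
  ultimately show ?thesis by simp
qed

text \<open>g may be an unbounded polynomial; f is a bounded substitute equal to it on
  \<open>F\<close>, where \<mu> is concentrated.\<close>

lemma integral_root_mean_R:
  fixes f :: "complex \<Rightarrow> complex"
  assumes f: "f \<in> borel_measurable borel" "\<And>z. cmod (f z) \<le> C"
    and g: "continuous_on UNIV g" "root_mean R g \<in> borel_measurable borel"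
    and eq: "\<And>z. z \<in> F \<Longrightarrow> f z = g z"
  shows "integral\<^sup>L \<mu> f = (\<integral>z. root_mean R g z \<partial>\<nu>)"
proof -
  have fm: "(\<lambda>x. f (S i x)) \<in> borel_measurable \<nu>" if "i \<in> B" for i
    using measurable_compose[OF S_measurable[OF that] f(1)] by simp
  have fint: "integrable \<nu> (\<lambda>x. f (S i x))" if "i \<in> B" for i
    by (rule \<nu>.integrable_const_bound[where B = C]) (use f(2) fm[OF that] in auto)
  have "integral\<^sup>L \<mu> f = (\<integral>x. (\<Sum>i\<in>B. f (S i x)) / of_nat (degree R) \<partial>\<nu>)"
    unfolding integral_\<mu>[OF f] by (simp add: Bochner_Integration.integral_sum[OF fint] scaleR_conv_of_real field_simps)
  also have "\<dots> = (\<integral>z. root_mean R g z \<partial>\<nu>)"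
  proof (rule integral_cong_AE)
    show "(\<lambda>x. (\<Sum>i\<in>B. f (S i x)) / of_nat (degree R)) \<in> borel_measurable \<nu>"
      using fm by (intro borel_measurable_divide borel_measurable_sum) auto
    show "root_mean R g \<in> borel_measurable \<nu>" using g(2) by simp
    show "AE x in \<nu>. (\<Sum>i\<in>B. f (S i x)) / of_nat (degree R) = root_mean R g x"
      using AE_J
    proof eventually_elim
      case (elim x)
      have "(\<Sum>i\<in>B. f (S i x)) = (\<Sum>i\<in>B. g (S i x))" using S_in_F[OF elim] eq by (intro sum.cong) auto
      then show ?case by (simp add: sum_S[OF elim])
    qed
  qed
  finally show ?thesis .
qed

theorem dos_weak_convergence: "weak_conv_C (\<lambda>l. dos_trunc p V (3 ^ l)) \<mu>"
  unfolding weak_conv_C_def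
proof (intro allI impI, elim conjE)
  fix f :: "complex \<Rightarrow> real"
  assume f: "continuous_on UNIV f" "bounded (range f)"
  have fm: "f \<in> borel_measurable borel" using f(1) by (rule borel_measurable_continuous_onI)
  obtain C where C: "0 < C" "\<And>z. z \<in> F \<Longrightarrow> z = of_real (Re z) \<and> \<bar>Re z\<bar> \<le> C" by (rule F_interval) blast
  obtain Bf where Bf: "\<And>z. norm (f z) \<le> Bf" using f(2) by (auto simp: bounded_iff)
  show "(\<lambda>l. integral\<^sup>L (dos_trunc p V (3 ^ l)) f) \<longlonglongrightarrow> integral\<^sup>L \<mu> f"
  proof (rule LIMSEQ_I)
    fix e :: real assume e: "0 < e"
    have "continuous_on {-C..C} (\<lambda>t. f (of_real t))"
      by (rule continuous_on_compose2[OF f(1)]) (auto intro: continuous_intros)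
    \<comment> \<open>\<open>F\<close> lies on the real line, so real polynomials on an interval
      suffice for the approximation.\<close>
    then obtain h where h: "real_polynomial_function h" "\<And>t. t \<in> {-C..C} \<Longrightarrow> \<bar>f (of_real t) - h t\<bar> < e / 4"
      using Stone_Weierstrass_real_polynomial_function[of "{-C..C}" "\<lambda>t. f (of_real t)" "e / 4"] e by auto
    obtain co d where "h = (\<lambda>x. \<Sum>i\<le>d. co i * x ^ i)" using h(1) real_polynomial_function_iff_sum by blast
    then have hr: "h t = poly (\<Sum>i\<le>d. monom (co i) i) t" for t by (simp add: poly_sum poly_monom)
    define r where "r = (\<Sum>i\<le>d. monom (co i) i)"
    have r: "\<bar>f (of_real t) - poly r t\<bar> < e / 4" if "\<bar>t\<bar> \<le> C" for t
      using h(2)[of t] that hr by (auto simp: r_def abs_le_iff)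
    have bdd: "\<exists>M. \<forall>t. \<bar>t\<bar> \<le> C \<longrightarrow> \<bar>poly s t\<bar> \<le> M" for s :: "real poly"
    proof -
      have "compact (poly s ` {-C..C})" by (intro compact_continuous_image) (auto intro: continuous_intros)
      then obtain M where M: "\<And>y. y \<in> poly s ` {-C..C} \<Longrightarrow> norm y \<le> M"
        using compact_imp_bounded bounded_iff by metis
      have "\<bar>poly s t\<bar> \<le> M" if "\<bar>t\<bar> \<le> C" for t
      proof -
        have "t \<in> {-C..C}" using that by (auto simp: abs_le_iff)
        then show ?thesis using M[of "poly s t"] by simp
      qed
      then show ?thesis by blast
    qed
    obtain M where M: "\<And>t. \<bar>t\<bar> \<le> C \<Longrightarrow> \<bar>poly r t\<bar> \<le> M" using bdd by blast
    obtain K where K: "\<And>t. \<bar>t\<bar> \<le> C \<Longrightarrow> \<bar>poly (pderiv r) t\<bar> \<le> K" using bdd by blast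
    \<comment> \<open>Clamping to [-C, C] keeps \<open>poly r\<close> bounded without changing it on
      \<open>F\<close>.\<close>
    define cl where "cl z = max (- C) (min C (Re z))" for z
    have cl_bd: "\<bar>cl z\<bar> \<le> C" for z using C(1) by (auto simp: cl_def abs_le_iff)
    have cl_F: "cl z = Re z" if "z \<in> F" for z using C(2)[OF that] by (auto simp: cl_def abs_le_iff)
    define g where "g z = poly r (cl z)" for z
    have gc: "continuous_on UNIV g" unfolding g_def cl_def by (intro continuous_intros)
    then have gm: "g \<in> borel_measurable borel" by (rule borel_measurable_continuous_onI)
    let ?rc = "map_poly complex_of_real r"
    define avg where "avg = integral\<^sup>L \<mu> g"
    have avg: "complex_of_real avg = (\<integral>z. root_mean R (poly ?rc) z \<partial>\<nu>)"
    proof -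
      have "complex_of_real avg = integral\<^sup>L \<mu> (\<lambda>z. complex_of_real (g z))" by (simp add: avg_def)
      also have "\<dots> = (\<integral>z. root_mean R (poly ?rc) z \<partial>\<nu>)"
      proof (rule integral_root_mean_R[where C = M])
        show "(\<lambda>z. complex_of_real (g z)) \<in> borel_measurable borel" using gm by measurable
        show "cmod (complex_of_real (g z)) \<le> M" for z using M[OF cl_bd[of z]] by (simp add: g_def)
        obtain s where "\<And>x. root_mean R (poly ?rc) x = poly s x" using root_mean_poly[OF degree_R] by blast
        then have "root_mean R (poly ?rc) = poly s" by auto
        then show "root_mean R (poly ?rc) \<in> borel_measurable borel"
          by (auto intro!: borel_measurable_continuous_onI continuous_intros)
        show "complex_of_real (g z) = poly ?rc z" if "z \<in> F" for z
        proof -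
          have "poly ?rc z = poly ?rc (of_real (Re z))" using C(2)[OF that] by simp
          then show ?thesis by (simp add: g_def cl_F[OF that] poly_map_poly_complex_of_real)
        qed
      qed (auto intro: continuous_intros)
      finally show ?thesis .
    qed
    have fg: "\<bar>f z - g z\<bar> < e / 4" if "z \<in> F" for z
      using r[of "Re z"] C(2)[OF that] by (simp add: g_def cl_F[OF that])
    have \<mu>_fg: "\<bar>integral\<^sup>L \<mu> f - avg\<bar> \<le> e / 4"
    proof -
      have gB: "norm (g z) \<le> M" for z using M[OF cl_bd[of z]] by (simp add: g_def)
      have int: "integrable \<nu> (\<lambda>x. h (S i x))" if "i \<in> B" "h \<in> borel_measurable borel" "\<And>z. norm (h z) \<le> c" for i c and h :: "complex \<Rightarrow> real"
        by (rule \<nu>.integrable_const_bound[where B = c])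
           (use that measurable_compose[OF S_measurable[OF that(1)] that(2)] in auto)
      have "integral\<^sup>L \<mu> f - avg = (1 / real (degree R)) * (\<Sum>i\<in>B. (\<integral>x. f (S i x) \<partial>\<nu>) - (\<integral>x. g (S i x) \<partial>\<nu>))"
        unfolding avg_def integral_\<mu>[OF fm Bf] integral_\<mu>[OF gm gB] by (simp add: sum_subtractf right_diff_distrib diff_divide_distrib)
      also have "\<bar>\<dots>\<bar> \<le> (1 / real (degree R)) * (\<Sum>i\<in>B. e / 4)"
        unfolding abs_mult
      proof (intro mult_mono order.trans[OF sum_abs] sum_mono)
        fix i assume i: "i \<in> B"
        note fi = int[OF i fm Bf] and gi = int[OF i gm gB]
        have "\<bar>(\<integral>x. f (S i x) \<partial>\<nu>) - (\<integral>x. g (S i x) \<partial>\<nu>)\<bar> = \<bar>\<integral>x. f (S i x) - g (S i x) \<partial>\<nu>\<bar>"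
          using fi gi by simp
        also have "\<dots> \<le> (\<integral>x. \<bar>f (S i x) - g (S i x)\<bar> \<partial>\<nu>)" by (rule integral_abs_bound)
        also have "\<dots> \<le> (\<integral>x. e / 4 \<partial>\<nu>)"
        proof (rule integral_mono_AE)
          show "AE x in \<nu>. \<bar>f (S i x) - g (S i x)\<bar> \<le> e / 4"
            using AE_S_F[OF i] by eventually_elim (use fg in \<open>auto intro: less_imp_le\<close>)
        qed (use fi gi in auto)
        finally show "\<bar>(\<integral>x. f (S i x) \<partial>\<nu>) - (\<integral>x. g (S i x) \<partial>\<nu>)\<bar> \<le> e / 4" using \<nu>.prob_space by simp
      qed auto
      also have "\<dots> = e / 4" using degree_R by (simp add: B_finite_ne(3))
      finally show ?thesis .
    qed
    have l_fg: "\<bar>integral\<^sup>L (dos_trunc p V (3 ^ l)) f - (\<Sum>z\<in>trunc_spectrum p V (3 ^ l). poly r (Re z)) / (3 ^ l + 1)\<bar> \<le> e / 4"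
      if l: "n \<le> l" for l
    proof -
      let ?N = "3 ^ l :: nat" and ?T = "trunc_spectrum p V (3 ^ l)"
      have tc: "finite ?T" "card ?T = Suc ?N" by (rule trunc_card; simp)+
      have "integral\<^sup>L (dos_trunc p V ?N) f - (\<Sum>z\<in>?T. poly r (Re z)) / (3 ^ l + 1)
        = (\<Sum>z\<in>?T. f z - poly r (Re z)) / (real ?N + 1)"
        unfolding integral_dos_trunc[OF tc fm] by (simp add: sum_subtractf diff_divide_distrib)
      also have "\<bar>\<dots>\<bar> \<le> (\<Sum>z\<in>?T. e / 4) / (real ?N + 1)"
        unfolding abs_divide
      proof (intro frac_le order.trans[OF sum_abs] sum_mono)
        fix z assume "z \<in> ?T"
        then have "z \<in> F" using trunc_spectrum_subset_F[OF l] by blast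
        then show "\<bar>f z - poly r (Re z)\<bar> \<le> e / 4" using fg[of z] cl_F[of z] by (simp add: g_def less_imp_le)
      qed (use e in \<open>auto intro!: sum_nonneg add_pos_pos\<close>)
      also have "(\<Sum>z\<in>?T. e / 4) = (real ?N + 1) * (e / 4)"
        unfolding sum_constant tc(2) by (simp add: add.commute)
      also have "\<dots> / (real ?N + 1) = e / 4"
        by (rule nonzero_mult_div_cancel_left) linarith
      finally show ?thesis .
    qed
    \<comment> \<open>\<open>3 ^ k\<close> exceeds the degree of r, so that the average over the
      zeros is exact, and pushes the interlacing error below e / 4. The two approximation errors add
      e / 4 each.\<close>
    obtain k where k: "max (real (degree r)) ((2 * C * K + 2 * M) * 4 / e) < 3 ^ k"
      using real_arch_pow[of 3 "max (real (degree r)) ((2 * C * K + 2 * M) * 4 / e)"] by auto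
    show "\<exists>no. \<forall>l\<ge>no. norm (integral\<^sup>L (dos_trunc p V (3 ^ l)) f - integral\<^sup>L \<mu> f) < e"
    proof (intro exI[of _ "n + k"] allI impI)
      fix l assume l: "n + k \<le> l"
      then obtain m where m: "l = n + m" "k \<le> m" by (metis add_le_cancel_left le_Suc_ex le_add1 le_trans add.assoc nat_le_iff_add)
      have kl: "(3::real) ^ k \<le> 3 ^ l" using l by (intro power_increasing) auto
      have k12: "real (degree r) < 3 ^ k" "(2 * C * K + 2 * M) * 4 / e < 3 ^ k"
        using k unfolding max_less_iff_conj by blast+
      have "real (degree r) < 3 ^ l" using k12(1) kl by linarith
      then have deg: "degree r < 3 ^ (n + m)" unfolding m(1) by (metis of_nat_less_iff of_nat_numeral of_nat_power)
      have "(2 * C * K + 2 * M) * 4 / e < 3 ^ l + 1" using k12(2) kl by linarith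
      then have "(2 * C * K + 2 * M) * 4 < (3 ^ l + 1) * e" using e by (simp add: pos_divide_less_eq)
      then have small: "(2 * C * K + 2 * M) / (3 ^ l + 1) < e / 4"
        by (subst pos_divide_less_eq) (auto simp: add_pos_pos mult.commute)
      have "\<bar>(\<Sum>z\<in>trunc_spectrum p V (3 ^ l). poly r (Re z)) / (3 ^ l + 1) - avg\<bar> \<le> (2 * C * K + 2 * M) / (3 ^ l + 1)"
        unfolding m(1) by (rule dos_polynomial_bound[OF C deg M K avg])
      then show "norm (integral\<^sup>L (dos_trunc p V (3 ^ l)) f - integral\<^sup>L \<mu> f) < e"
        using \<mu>_fg l_fg[of l] small m(1) e unfolding real_norm_def by linarith
    qed
  qed
qed

text \<open>\<open>F\<close> is the preimage of \<open>J\<close> under \<open>R\<close>, so the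
  indicator of \<open>F\<close> at \<open>S i x\<close> agrees almost everywhere with that of
  \<open>J\<close> at x.\<close>

lemma set_integral_\<mu>:
  fixes f :: "complex \<Rightarrow> complex"
  assumes f: "continuous_on UNIV f" "bounded (range f)"
  shows "(LINT x:F|\<mu>. f x) = (1 / of_nat (degree R)) * (\<Sum>i\<in>B. LINT x:J|\<nu>. f (S i x))"
proof -
  have fm [measurable]: "f \<in> borel_measurable borel" using f(1) by (rule borel_measurable_continuous_onI)
  obtain C where C: "\<And>z. norm (f z) \<le> C" using f(2) by (auto simp: bounded_iff)
  have FB [measurable]: "F \<in> sets borel" "J \<in> sets borel" using closed_F closed_filled_julia by auto
  have "(LINT x:F|\<mu>. f x) = (1 / real (degree R)) *\<^sub>R (\<Sum>i\<in>B. \<integral>x. indicator F (S i x) *\<^sub>R f (S i x) \<partial>\<nu>)"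
    unfolding set_lebesgue_integral_def
  proof (rule integral_\<mu>[where C = C])
    show "norm (indicator F z *\<^sub>R f z) \<le> C" for z using C[of z] order.trans[OF norm_ge_zero C[of z]] by (simp add: indicator_def)
  qed measurable
  also have "(\<Sum>i\<in>B. \<integral>x. indicator F (S i x) *\<^sub>R f (S i x) \<partial>\<nu>) = (\<Sum>i\<in>B. LINT x:J|\<nu>. f (S i x))"
  proof (rule sum.cong[OF refl])
    fix i assume i: "i \<in> B"
    note S_measurable[OF i, measurable]
    show "(\<integral>x. indicator F (S i x) *\<^sub>R f (S i x) \<partial>\<nu>) = (LINT x:J|\<nu>. f (S i x))"
      unfolding set_lebesgue_integral_def
    proof (rule integral_cong_AE)
      show "AE x in \<nu>. indicator F (S i x) *\<^sub>R f (S i x) = indicator J x *\<^sub>R f (S i x)"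
        using AE_J by eventually_elim (use S_in_F i in \<open>simp add: indicator_def\<close>)
    qed measurable
  qed
  finally show ?thesis by (simp add: scaleR_conv_of_real)
qed

end

section \<open>The almost Mathieu potential and the conclusion\<close>

lemma amo_pot_shift: "amo_pot \<beta> (real k / 3 ^ n) 0 (3 ^ n * j + r) = amo_pot \<beta> (real k / 3 ^ n) 0 r"
proof -
  have "2 * pi * (real k / 3 ^ n) * real (3 ^ n * j + r) = 2 * pi * (real k / 3 ^ n) * real r + 2 * real (k * j) * pi"
    by (simp add: field_simps)
  also have "cos \<dots> = cos (2 * pi * (real k / 3 ^ n) * real r)"
    unfolding cos_add using cos_npi[of "2 * (k * j)"] sin_npi[of "2 * (k * j)"] by simp
  finally show ?thesis by (simp add: amo_pot_def)
qed

text \<open>At phase 0 the cosine is even, and the frequency times \<open>3 ^ n\<close> is an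
  integer number of turns.\<close>

lemma amo_pot_reflect:
  assumes "r \<le> 3 ^ n * j"
  shows "amo_pot \<beta> (real k / 3 ^ n) 0 (3 ^ n * j - r) = amo_pot \<beta> (real k / 3 ^ n) 0 r"
proof -
  have "2 * pi * (real k / 3 ^ n) * real (3 ^ n * j - r) = - (2 * pi * (real k / 3 ^ n) * real r) + 2 * real (k * j) * pi"
    using assms by (simp add: of_nat_diff field_simps)
  also have "cos \<dots> = cos (2 * pi * (real k / 3 ^ n) * real r)"
    unfolding cos_add cos_minus using cos_npi[of "2 * (k * j)"] sin_npi[of "2 * (k * j)"] by simp
  finally show ?thesis by (simp add: amo_pot_def)
qed

theorem theorem4p2:
  fixes p \<beta> :: real and n k :: nat and R :: "complex poly"
    and S :: "nat \<Rightarrow> complex \<Rightarrow> complex" and \<nu>p :: "complex measure"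
  assumes "0 < p" "p < 1" "1 \<le> n" "k < 3 ^ n"
    and "spectral_decimation_function p (amo_pot \<beta> (real k / 3 ^ n) 0) n R"
    and "degree R = 3 ^ n"
    and "inverse_branches R (3 ^ n) (op_spectrum p (jac p lap_pot)) S"
    and "balanced_invariant_measure (R_Delta p) \<nu>p"
  shows "measure_support (limit_dos (3 ^ n) S \<nu>p (op_spectrum p (jac p lap_pot)))
           = op_spectrum p (jac p (amo_pot \<beta> (real k / 3 ^ n) 0))
       \<and> weak_conv_C (\<lambda>l. dos_trunc p (amo_pot \<beta> (real k / 3 ^ n) 0) (3 ^ l))
           (limit_dos (3 ^ n) S \<nu>p (op_spectrum p (jac p lap_pot)))
       \<and> (\<forall>f :: complex \<Rightarrow> complex. continuous_on UNIV f \<and> bounded (range f) \<longrightarrow>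
            (LINT x : op_spectrum p (jac p (amo_pot \<beta> (real k / 3 ^ n) 0))
                 | limit_dos (3 ^ n) S \<nu>p (op_spectrum p (jac p lap_pot)). f x)
            = (1 / 3 ^ n) * (\<Sum>i\<in>{1..3 ^ n}.
                 LINT x : op_spectrum p (jac p lap_pot) | \<nu>p. f (S i x)))"
proof -
  let ?V = "amo_pot \<beta> (real k / 3 ^ n) 0"
  interpret dm: delta_map p by unfold_locales (use assms in auto)
  interpret wk: walk p ?V by unfold_locales
  interpret decimated_dos p ?V n R \<nu>p S
  proof unfold_locales
    show "wk.P (3 ^ (n + m)) = 1 - dm.W R m" for m by (rule wk.spectral_decimation_P[OF assms(5)])
    \<comment> \<open>The branches are given over the spectrum of the Laplacian, which is the filled
      Julia set.\<close>
    show "inverse_branches R (degree R) (filled_julia (R_Delta p)) S"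
      using assms(6,7) by (simp add: dm.op_spectrum_lap)
  qed (use assms in \<open>auto simp: amo_pot_shift amo_pot_reflect\<close>)
  have \<mu>: "limit_dos (3 ^ n) S \<nu>p (filled_julia (R_Delta p)) = \<mu>"
    by (simp add: \<mu>_def assms(6))
  show ?thesis
    unfolding op_spectrum_eq dm.op_spectrum_lap \<mu>
    using measure_support_\<mu> dos_weak_convergence set_integral_\<mu> by (simp add: assms(6) B_def)
qed

end
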